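(* Let $k\ge1$ and let $m_1,\ldots,m_k$ be positive integers, $d=\sum_{j=1}^k m_j$. For all complex numbers $\alpha,\beta,\gamma,\delta$ with $\gamma+\delta=\alpha+\beta+1+d$ and all distinct complex numbers $a_1,\ldots,a_k\in\mathbb C\setminus\{0,1\}$, there exist at least one and at most $\prod_{j=1}^k(m_j+1)$ differential equations of the form $$y''-\left(\frac{\alpha}{z}+\frac{\beta}{z-1}+\sum_{i=1}^k\frac{m_i}{z-a_i}\right)y'+\frac{P(z)}{z(z-1)\prod_{i=1}^k(z-a_i)}\,y=0,$$ where $P$ is a polynomial of the form $P(z)=\gamma\delta z^k+(\text{a polynomial of degree at most }k-1)$, such that the singularities at all points $a_1,\ldots,a_k$ are apparent. Moreover, for generic $\alpha,\beta,\gamma,\delta,a_1,\ldots,a_k$ (subject to $\gamma+\delta=\alpha+\beta+1+d$), the number of such equations is equal to $\prod_{j=1}^k(m_j+1)$.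
   Context: A singularity $a$ of a second order linear differential equation is called apparent if the ratio of any two linearly independent solutions is meromorphic at $a$. Counting equations means counting the polynomials $P$ of the stated form (the $k$ coefficients of the lower-degree part are free, the "accessory parameters"), without multiplicity. "Generic" is meant in the sense of the Zariski topology: a set of parameters is generic if its complement is contained in a proper algebraic subset of the parameter space; here the parameter space is the affine space of tuples $(\alpha,\beta,\gamma,\delta,a_1,\ldots,a_k)\in\mathbb C^{4+k}$ satisfying $\gamma+\delta=\alpha+\beta+1+d$, with $m_1,\ldots,m_k$ fixed. *)

theory Defs
  imports "HOL-Complex_Analysis.Complex_Analysis" "HOL-Library.FuncSet"
begin

definition ode_solution ::
  "(complex \<Rightarrow> complex) \<Rightarrow> (complex \<Rightarrow> complex) \<Rightarrow> complex set \<Rightarrow> (complex \<Rightarrow> complex) \<Rightarrow> bool" where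
  "ode_solution p q U y \<longleftrightarrow>
     y holomorphic_on U \<and>
     (\<forall>z\<in>U. deriv (deriv y) z + p z * deriv y z + q z * y z = 0)"

definition lin_indep_on ::
  "complex set \<Rightarrow> (complex \<Rightarrow> complex) \<Rightarrow> (complex \<Rightarrow> complex) \<Rightarrow> bool" where
  "lin_indep_on U y1 y2 \<longleftrightarrow>
     (\<forall>c1 c2. (\<forall>z\<in>U. c1 * y1 z + c2 * y2 z = 0) \<longrightarrow> c1 = 0 \<and> c2 = 0)"

text \<open>
  Solutions near a singular point are in general multivalued, so they are represented by their
  holomorphic branches on domains \<open>U\<close> of a punctured disc around \<open>a\<close>. That the ratio is meromorphic
  at \<open>a\<close> means that each branch of it is the restriction of a function meromorphic on the full
  disc. The condition for one radius \<open>r\<close> implies the condition for all smaller radii.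
\<close>

definition apparent_singularity ::
  "(complex \<Rightarrow> complex) \<Rightarrow> (complex \<Rightarrow> complex) \<Rightarrow> complex \<Rightarrow> bool" where
  "apparent_singularity p q a \<longleftrightarrow>
     isolated_singularity_at p a \<and> isolated_singularity_at q a \<and>
     (\<exists>r>0. \<forall>U y1 y2.
        open U \<and> connected U \<and> U \<noteq> {} \<and> U \<subseteq> ball a r - {a} \<and>
        ode_solution p q U y1 \<and> ode_solution p q U y2 \<and> lin_indep_on U y1 y2 \<longrightarrow>
        (\<exists>f. f meromorphic_on ball a r \<and>
             (\<forall>z\<in>U. y2 z \<noteq> 0 \<longrightarrow> f z = y1 z / y2 z)))"

definition coeff_p ::
  "nat \<Rightarrow> (nat \<Rightarrow> nat) \<Rightarrow> complex \<Rightarrow> complex \<Rightarrow> (nat \<Rightarrow> complex) \<Rightarrow> complex \<Rightarrow> complex" where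
  "coeff_p k m \<alpha> \<beta> a z =
     - (\<alpha> / z + \<beta> / (z - 1) + (\<Sum>i=1..k. of_nat (m i) / (z - a i)))"

definition coeff_q ::
  "nat \<Rightarrow> (nat \<Rightarrow> complex) \<Rightarrow> complex poly \<Rightarrow> complex \<Rightarrow> complex" where
  "coeff_q k a P z = poly P z / (z * (z - 1) * (\<Prod>i=1..k. (z - a i)))"

text \<open>The equations are identified with the polynomials \<open>P\<close> that determine them.\<close>

definition apparent_equations ::
  "nat \<Rightarrow> (nat \<Rightarrow> nat) \<Rightarrow> complex \<Rightarrow> complex \<Rightarrow> complex \<Rightarrow> complex \<Rightarrow> (nat \<Rightarrow> complex) \<Rightarrow>
   complex poly set" where
  "apparent_equations k m \<alpha> \<beta> \<gamma> \<delta> a =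
     {P. (\<exists>R. P = monom (\<gamma> * \<delta>) k + R \<and> degree R \<le> k - 1) \<and>
         (\<forall>j\<in>{1..k}. apparent_singularity (coeff_p k m \<alpha> \<beta> a) (coeff_q k a P) (a j))}"

definition admissible_points :: "nat \<Rightarrow> (nat \<Rightarrow> complex) \<Rightarrow> bool" where
  "admissible_points k a \<longleftrightarrow> inj_on a {1..k} \<and> (\<forall>i\<in>{1..k}. a i \<noteq> 0 \<and> a i \<noteq> 1)"

definition affine_space :: "nat \<Rightarrow> (nat \<Rightarrow> complex) set" where
  "affine_space n = {..<n} \<rightarrow>\<^sub>E UNIV"

inductive complex_polynomial_function :: "nat \<Rightarrow> ((nat \<Rightarrow> complex) \<Rightarrow> complex) \<Rightarrow> bool"
  for n :: nat where
  const: "complex_polynomial_function n (\<lambda>x. c)"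
| coord: "i < n \<Longrightarrow> complex_polynomial_function n (\<lambda>x. x i)"
| add: "complex_polynomial_function n f \<Longrightarrow> complex_polynomial_function n g \<Longrightarrow>
          complex_polynomial_function n (\<lambda>x. f x + g x)"
| mult: "complex_polynomial_function n f \<Longrightarrow> complex_polynomial_function n g \<Longrightarrow>
          complex_polynomial_function n (\<lambda>x. f x * g x)"

definition algebraic_set :: "nat \<Rightarrow> (nat \<Rightarrow> complex) set \<Rightarrow> bool" where
  "algebraic_set n W \<longleftrightarrow>
     (\<exists>F. (\<forall>f\<in>F. complex_polynomial_function n f) \<and>
          W = {x \<in> affine_space n. \<forall>f\<in>F. f x = 0})"

definition generic_in :: "nat \<Rightarrow> (nat \<Rightarrow> complex) set \<Rightarrow> (nat \<Rightarrow> complex) set \<Rightarrow> bool" where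
  "generic_in n V G \<longleftrightarrow> (\<exists>W. algebraic_set n W \<and> W \<subset> V \<and> V - G \<subseteq> W)"

text \<open>
  A tuple \<open>(\<alpha>, \<beta>, \<gamma>, \<delta>, a\<^sub>1, \<dots>, a\<^sub>k)\<close> is encoded as \<open>x\<close> with \<open>x 0 = \<alpha>\<close>, \<open>x 1 = \<beta>\<close>, \<open>x 2 = \<gamma>\<close>,
  \<open>x 3 = \<delta>\<close> and \<open>x (3 + i)\<close> equal to the \<open>i\<close>-th singular point for \<open>1 \<le> i \<le> k\<close>.
\<close>

definition parameter_space :: "nat \<Rightarrow> nat \<Rightarrow> (nat \<Rightarrow> complex) set" where
  "parameter_space k d =
     {x \<in> affine_space (4 + k). x 2 + x 3 = x 0 + x 1 + 1 + of_nat d}"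

end

theory Submission
  imports Defs "Jordan_Normal_Form.Char_Poly" "Subresultants.Subresultant_Gcd"
    "HOL-Computational_Algebra.Field_as_Ring"
begin

text \<open>
  An equation of the given form is determined by the residues \<open>c i\<close> of the coefficient of \<open>y\<close> at
  the points \<open>a i\<close>. The exponents at \<open>a j\<close> are \<open>0\<close> and \<open>m j + 1\<close>, so \<open>a j\<close> is apparent iff the
  Frobenius recursion starting from the exponent \<open>0\<close> is solvable at step \<open>m j + 1\<close>. Up to a constant
  factor this is a polynomial equation \<open>c j ^ (m j + 1) + (terms of lower total degree) = 0\<close>.

  For such a system, the products of its polynomials with the reduced monomials (all exponents at
  most \<open>m j\<close>) are unitriangular with respect to the total degree. Hence the quotient algebra has
  the reduced monomials as a basis, of size \<open>(\<Prod>j. m j + 1)\<close>. Dually, the linear functionals on it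
  are the multi-indexed sequences satisfying the corresponding recurrences; common eigenvectors of
  the shifts are the zeros of the system. The values of a linear form \<open>l\<close> at the zeros are therefore
  the eigenvalues of a matrix, which gives existence, the upper bound, and, through the
  discriminant of its characteristic polynomial, a polynomial condition for the maximal count.
  That this condition is not vacuous follows by letting \<open>\<alpha>\<close> tend to infinity with \<open>\<beta> = \<gamma> = 0\<close>: after
  rescaling, the system decouples into \<open>(\<Prod>l\<le>m j. c j - l / a j) = 0\<close>.
\<close>

section \<open>Triangular polynomial systems\<close>


text \<open>Counting by Bezout would require projective intersection theory. It is bypassed because
  the top-degree forms are the pure powers \<open>c j ^ (m j + 1)\<close>, which have no common zero
  at infinity. Working with functionals instead of the quotient ring makes the independence of the
  reduced monomials a recursive construction of sequences, and their spanning a rewriting argument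
  by induction on the size. Since the leading coefficients are one, rewriting never divides, so the
  matrix entries stay in any ring of functions that contains the coefficients of the system. This is
  what turns a maximal count at one parameter value into a maximal count off a hypersurface. The
  choice \<gamma> = 0 is compatible with the linear relation between the parameters, since \<delta>
  can absorb \<alpha>. On the analytic side, the branches live on domains that need not surround the
  singularity, so monodromy is not directly available. Instead, the meromorphic continuation of one
  ratio is converted into a Laurent series solution, and the exponents then exclude a
  logarithm.\<close>

definition low :: "'i set \<Rightarrow> nat \<Rightarrow> 'i multiset set" where
  "low I d = {f. set_mset f \<subseteq> I \<and> size f < d}"

lemma finite_low:
  assumes "finite I"
  shows "finite (low I d)"
proof -
  have "low I d \<subseteq> mset ` {xs. set xs \<subseteq> I \<and> length xs \<le> d}"
  proof
    fix f assume "f \<in> low I d"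
    moreover obtain xs where "mset xs = f" using ex_mset by blast
    ultimately have "xs \<in> {xs. set xs \<subseteq> I \<and> length xs \<le> d}"
      by (auto simp: low_def)
    thus "f \<in> mset ` {xs. set xs \<subseteq> I \<and> length xs \<le> d}"
      using \<open>mset xs = f\<close> by blast
  qed
  thus ?thesis using finite_lists_length_le[OF assms] finite_subset by blast
qed

definition monomial :: "('i \<Rightarrow> complex) \<Rightarrow> 'i multiset \<Rightarrow> complex" where
  "monomial \<mu> g = (\<Prod>i\<in>#g. \<mu> i)"

lemma monomial_simps [simp]:
  "monomial \<mu> {#} = 1"
  "monomial \<mu> (add_mset i g) = \<mu> i * monomial \<mu> g"
  "monomial \<mu> (g + h) = monomial \<mu> g * monomial \<mu> h"
  "monomial \<mu> (replicate_mset k i) = \<mu> i ^ k"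
  by (simp_all add: monomial_def)

locale triangular_system =
  fixes I :: "'i set" and n :: "'i \<Rightarrow> nat" and co :: "'i \<Rightarrow> 'i multiset \<Rightarrow> complex"
  assumes finite_I: "finite I" and n_pos: "\<And>i. i \<in> I \<Longrightarrow> n i > 0"
begin

definition poly_at :: "'i \<Rightarrow> ('i \<Rightarrow> complex) \<Rightarrow> complex" where
  "poly_at i \<mu> = \<mu> i ^ n i + (\<Sum>f\<in>low I (n i). co i f * monomial \<mu> f)"

definition zeros :: "('i \<Rightarrow> complex) set" where
  "zeros = {\<mu> \<in> I \<rightarrow>\<^sub>E UNIV. \<forall>i\<in>I. poly_at i \<mu> = 0}"

text \<open>A sequence \<open>\<phi>\<close> stands for the linear functional on polynomials that
  takes the value \<open>\<phi> g\<close> at the monomial with exponent \<open>g\<close>. Then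
  \<open>act i\<close> is the transpose of multiplication by the polynomial
  \<open>poly_at i\<close>.\<close>

definition act :: "'i \<Rightarrow> ('i multiset \<Rightarrow> complex) \<Rightarrow> 'i multiset \<Rightarrow> complex" where
  "act i \<phi> g = \<phi> (g + replicate_mset (n i) i) + (\<Sum>f\<in>low I (n i). co i f * \<phi> (g + f))"

definition acts :: "'i multiset \<Rightarrow> ('i multiset \<Rightarrow> complex) \<Rightarrow> 'i multiset \<Rightarrow> complex" where
  "acts v \<phi> = fold_mset act \<phi> v"

lemma act_commute: "act i (act j \<phi>) = act j (act i \<phi>)"
proof
  fix g
  have "(\<Sum>f\<in>low I (n i). \<Sum>f'\<in>low I (n j). co i f * (co j f' * \<phi> (g + f + f'))) =
        (\<Sum>f'\<in>low I (n j). \<Sum>f\<in>low I (n i). co i f * (co j f' * \<phi> (g + f + f')))"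
    by (rule sum.swap)
  thus "act i (act j \<phi>) g = act j (act i \<phi>) g"
    unfolding act_def by (simp add: sum_distrib_left distrib_left sum.distrib add_ac mult_ac)
qed

lemma acts_empty [simp]: "acts {#} \<phi> = \<phi>"
  by (simp add: acts_def)

lemma acts_add: "acts (add_mset i v) \<phi> = acts v (act i \<phi>)"
proof -
  interpret comp_fun_commute act
    by unfold_locales (auto simp: act_commute)
  show ?thesis by (simp add: acts_def fold_mset_fun_left_comm)
qed

lemma act_zero [simp]: "act i (\<lambda>_. 0) = (\<lambda>_. 0)"
  by (simp add: act_def fun_eq_iff)

lemma acts_zero [simp]: "acts v (\<lambda>_. 0) = (\<lambda>_. 0)"
  by (induction v) (simp_all add: acts_add)

text \<open>The exponent of the leading monomial of the product of the polynomials of the system,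
  taken with the multiplicities in \<open>v\<close>.\<close>

definition scaled :: "'i multiset \<Rightarrow> 'i multiset" where
  "scaled v = (\<Sum>i\<in>#v. replicate_mset (n i) i)"

lemma scaled_simps [simp]: "scaled {#} = {#}"
  "scaled (add_mset i v) = replicate_mset (n i) i + scaled v"
  by (simp_all add: scaled_def)

lemma count_scaled: "count (scaled v) i = n i * count v i"
  by (induction v) auto

lemma set_scaled: "set_mset v \<subseteq> I \<Longrightarrow> set_mset (scaled v) \<subseteq> I"
  by (induction v) (auto simp: set_mset_replicate_mset_subset split: if_splits)

text \<open>The operator \<^term>\<open>acts v\<close> is the shift by \<^term>\<open>scaled v\<close> up to values at smaller multi-indices:
  the products of the polynomials of the system with the reduced monomials are unitriangular
  with respect to the total degree.\<close>

lemma acts_lower: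
  assumes "set_mset v \<subseteq> I" "set_mset g \<subseteq> I"
    and "\<And>x. set_mset x \<subseteq> I \<Longrightarrow> size x < size g + size (scaled v) \<Longrightarrow> \<phi> x = \<psi> x"
  shows "acts v \<phi> g - \<phi> (g + scaled v) = acts v \<psi> g - \<psi> (g + scaled v)"
  using assms
proof (induction v arbitrary: \<phi> \<psi>)
  case empty
  thus ?case by simp
next
  case (add j v)
  have j: "j \<in> I" "set_mset v \<subseteq> I" using add.prems by auto
  have "acts v (act j \<phi>) g - act j \<phi> (g + scaled v) = acts v (act j \<psi>) g - act j \<psi> (g + scaled v)"
  proof (rule add.IH)
    fix x assume x: "set_mset x \<subseteq> I" "size x < size g + size (scaled v)"
    have "\<phi> (x + replicate_mset (n j) j) = \<psi> (x + replicate_mset (n j) j)"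
      using x j by (intro add.prems) (auto simp: set_mset_replicate_mset_subset)
    moreover have "\<phi> (x + f) = \<psi> (x + f)" if "f \<in> low I (n j)" for f
      using x that by (intro add.prems) (auto simp: low_def)
    ultimately show "act j \<phi> x = act j \<psi> x" by (simp add: act_def)
  qed (use add.prems j in auto)
  moreover have "\<phi> (g + scaled v + f) = \<psi> (g + scaled v + f)" if "f \<in> low I (n j)" for f
    using that add.prems(2) set_scaled[OF j(2)] by (intro add.prems) (auto simp: low_def)
  hence "(\<Sum>f\<in>low I (n j). co j f * \<phi> (g + scaled v + f)) =
         (\<Sum>f\<in>low I (n j). co j f * \<psi> (g + scaled v + f))"
    by (intro sum.cong) auto
  ultimately show ?case
    by (simp add: acts_add act_def add_ac algebra_simps)
qed

definition reduced :: "'i multiset set" where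
  "reduced = {e. set_mset e \<subseteq> I \<and> (\<forall>i\<in>I. count e i < n i)}"

text \<open>Componentwise division of exponents with remainder. The reduced monomial
  \<open>rem g\<close> times the product of the polynomials indexed by \<open>quo g\<close> has
  leading monomial \<open>g\<close>, so these products form a basis of the polynomial ring indexed
  by \<open>g\<close>.\<close>

definition quo :: "'i multiset \<Rightarrow> 'i multiset" where
  "quo g = (\<Sum>i\<in>I. replicate_mset (count g i div n i) i)"

definition rem :: "'i multiset \<Rightarrow> 'i multiset" where
  "rem g = (\<Sum>i\<in>I. replicate_mset (count g i mod n i) i)"

lemma count_sum_replicate:
  "count (\<Sum>i\<in>I. replicate_mset (k i) i) j = (if j \<in> I then k j else 0)"
  using finite_I by (simp add: count_sum sum.delta)

lemma set_mset_subset_iff: "set_mset g \<subseteq> I \<longleftrightarrow> (\<forall>i. i \<notin> I \<longrightarrow> count g i = 0)"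
  by (auto simp: subset_iff count_eq_zero_iff)

lemma set_quo: "set_mset (quo g) \<subseteq> I" and set_rem: "set_mset (rem g) \<subseteq> I"
  unfolding set_mset_subset_iff by (simp_all add: quo_def rem_def count_sum_replicate)

lemma rem_plus_quo: "set_mset g \<subseteq> I \<Longrightarrow> rem g + scaled (quo g) = g"
  by (rule multiset_eqI)
    (auto simp: set_mset_subset_iff quo_def rem_def count_sum_replicate count_scaled)

lemma rem_quo_unique:
  assumes "r \<in> reduced" "set_mset v \<subseteq> I"
  shows "rem (r + scaled v) = r" "quo (r + scaled v) = v"
  using assms unfolding reduced_def set_mset_subset_iff
  by (auto intro!: multiset_eqI simp: quo_def rem_def count_sum_replicate count_scaled n_pos)

lemma rem_reduced: "rem g \<in> reduced"
  using set_rem n_pos by (auto simp: reduced_def rem_def count_sum_replicate)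

text \<open>A functional may be prescribed freely on the unitriangular basis just described. The
  value \<open>\<phi> g\<close> enters the condition at \<open>g\<close> with coefficient one, next
  to values at smaller sizes only, so \<open>\<phi>\<close> is found by recursion on the
  size.\<close>

lemma exists_with_acts:
  "\<exists>\<phi>. \<forall>g. set_mset g \<subseteq> I \<longrightarrow> acts (quo g) \<phi> (rem g) = t g"
proof -
  \<comment> \<open>Keeping only the values below the size of \<open>x\<close> and the candidate
    \<open>r\<close> at \<open>x\<close> itself makes the condition at \<open>x\<close> depend on
    earlier choices alone, as well-founded choice requires.\<close>
  define cut where
    "cut = (\<lambda>\<phi> (x::'i multiset) r. (\<lambda>y. if size y < size x then \<phi> y else (0::complex))(x := r))"
  define P where
    "P = (\<lambda>\<phi> x r. set_mset x \<subseteq> I \<longrightarrow> acts (quo x) (cut \<phi> x r) (rem x) = t x)"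
  have "\<exists>\<phi>. \<forall>x. P \<phi> x (\<phi> x)"
  proof (rule dependent_wf_choice[where R = "Wellfounded.measure size"])
    fix f g :: "'i multiset \<Rightarrow> complex" and x r
    assume "\<And>z. (z, x) \<in> Wellfounded.measure size \<Longrightarrow> f z = g z"
    hence "cut f x r = cut g x r" by (auto simp: cut_def fun_eq_iff)
    thus "P f x r = P g x r" by (simp add: P_def)
  next
    fix x and \<phi> :: "'i multiset \<Rightarrow> complex"
    \<comment> \<open>The defect left when the unknown value is set to 0; it is the right value
      because the unknown has coefficient one.\<close>
    let ?r = "t x - acts (quo x) (cut \<phi> x 0) (rem x)"
    have "acts (quo x) (cut \<phi> x ?r) (rem x) = t x" if x: "set_mset x \<subseteq> I"
    proof -
      have "acts (quo x) (cut \<phi> x ?r) (rem x) - cut \<phi> x ?r (rem x + scaled (quo x)) =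
            acts (quo x) (cut \<phi> x 0) (rem x) - cut \<phi> x 0 (rem x + scaled (quo x))"
      proof (rule acts_lower[OF set_quo set_rem])
        fix y :: "'i multiset" assume "size y < size (rem x) + size (scaled (quo x))"
        hence "size y < size x" using rem_plus_quo[OF x] by (metis size_union)
        thus "cut \<phi> x ?r y = cut \<phi> x 0 y" by (auto simp: cut_def)
      qed
      thus ?thesis using rem_plus_quo[OF x] by (simp add: cut_def)
    qed
    thus "\<exists>r. P \<phi> x r" by (auto simp: P_def)
  qed auto
  then obtain \<phi> where \<phi>: "\<And>x. P \<phi> x (\<phi> x)" by blast
  have "acts (quo x) \<phi> (rem x) = t x" if x: "set_mset x \<subseteq> I" for x
  proof -
    have "acts (quo x) (cut \<phi> x (\<phi> x)) (rem x) - cut \<phi> x (\<phi> x) (rem x + scaled (quo x)) =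
          acts (quo x) \<phi> (rem x) - \<phi> (rem x + scaled (quo x))"
    proof (rule acts_lower[OF set_quo set_rem])
      fix y :: "'i multiset" assume "size y < size (rem x) + size (scaled (quo x))"
      hence "size y < size x" using rem_plus_quo[OF x] by (metis size_union)
      thus "cut \<phi> x (\<phi> x) y = \<phi> y" by (auto simp: cut_def)
    qed
    thus ?thesis using rem_plus_quo[OF x] \<phi>[of x] x by (simp add: cut_def P_def)
  qed
  thus ?thesis by blast
qed

definition sols :: "('i multiset \<Rightarrow> complex) set" where
  "sols = {\<phi>. \<forall>i\<in>I. \<forall>g. set_mset g \<subseteq> I \<longrightarrow> act i \<phi> g = 0}"

text \<open>Independence of the reduced monomials modulo the ideal, in dual form. The functional is
  prescribed as \<open>t\<close> on reduced monomials and as 0 on all basis products containing a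
  polynomial of the system; induction on the size then shows that it annihilates the whole
  ideal.\<close>

lemma sols_extend: "\<exists>\<phi>\<in>sols. \<forall>e\<in>reduced. \<phi> e = t e"
proof -
  obtain \<phi> where \<phi>: "\<And>g. set_mset g \<subseteq> I \<Longrightarrow>
      acts (quo g) \<phi> (rem g) = (if g \<in> reduced then t g else 0)"
    using exists_with_acts[of "\<lambda>g. if g \<in> reduced then t g else 0"] by blast
  have "\<phi> e = t e" if "e \<in> reduced" for e
  proof -
    have "quo e = {#}" "rem e = e" using rem_quo_unique[OF that, of "{#}"] by simp_all
    thus ?thesis using \<phi>[of e] that by (simp add: reduced_def)
  qed
  moreover have "act i \<phi> g = 0" if i: "i \<in> I" and g: "set_mset g \<subseteq> I" for i g
    using g
  proof (induction g rule: measure_induct_rule[where f = size])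
    case (less g)
    \<comment> \<open>The index of the basis product obtained from that of \<open>g\<close> by one
      more factor \<open>i\<close>. It is not reduced, so the prescribed value there is 0.\<close>
    let ?h = "rem g + scaled (add_mset i (quo g))"
    have v: "set_mset (add_mset i (quo g)) \<subseteq> I" using i set_quo by auto
    have "count ?h i \<ge> n i" by (simp add: count_scaled)
    hence "?h \<notin> reduced" using i by (auto simp: reduced_def)
    moreover have "set_mset ?h \<subseteq> I" using set_rem set_scaled[OF v] by auto
    ultimately have "acts (quo g) (act i \<phi>) (rem g) = 0"
      using \<phi>[of ?h] rem_quo_unique[OF rem_reduced v, of g] acts_add by auto
    moreover have "acts (quo g) (act i \<phi>) (rem g) - act i \<phi> (rem g + scaled (quo g)) =
        acts (quo g) (\<lambda>_. 0) (rem g) - 0"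
    proof (rule acts_lower[OF set_quo set_rem])
      fix x :: "'i multiset" assume "set_mset x \<subseteq> I" "size x < size (rem g) + size (scaled (quo g))"
      moreover from this have "size x < size g"
        using rem_plus_quo[OF less.prems] by (metis size_union)
      ultimately show "act i \<phi> x = 0" using less.IH by blast
    qed
    ultimately show ?case using rem_plus_quo[OF less.prems] by simp
  qed
  ultimately show ?thesis unfolding sols_def by blast
qed

lemma split_nonreduced:
  assumes "set_mset g \<subseteq> I" "g \<notin> reduced"
  obtains i g' where "i \<in> I" "set_mset g' \<subseteq> I" "g = g' + replicate_mset (n i) i"
proof -
  obtain i where i: "i \<in> I" "n i \<le> count g i"
    using assms by (force simp: reduced_def not_less)
  have "replicate_mset (n i) i \<subseteq># g"
    using i(2) by (simp add: count_le_replicate_mset_subset_eq)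
  hence "g = (g - replicate_mset (n i) i) + replicate_mset (n i) i" by simp
  moreover have "set_mset (g - replicate_mset (n i) i) \<subseteq> I"
    using assms(1) in_diffD by fastforce
  ultimately show ?thesis using i that by blast
qed

text \<open>Spanning by the reduced monomials, in dual form: at a non-reduced index the recurrence
  expresses the value through values at indices of smaller size.\<close>

lemma sols_unique:
  assumes "\<phi> \<in> sols" "\<And>e. e \<in> reduced \<Longrightarrow> \<phi> e = 0" "set_mset g \<subseteq> I"
  shows "\<phi> g = 0"
  using assms(3)
proof (induction g rule: measure_induct_rule[where f = size])
  case (less g)
  show ?case
  proof (cases "g \<in> reduced")
    case False
    then obtain i g' where i: "i \<in> I" "set_mset g' \<subseteq> I" "g = g' + replicate_mset (n i) i"
      using split_nonreduced less.prems by blast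
    have "\<phi> (g' + f) = 0" if "f \<in> low I (n i)" for f
      using that i by (intro less.IH) (auto simp: low_def)
    moreover have "act i \<phi> g' = 0" using assms(1) i by (auto simp: sols_def)
    ultimately show ?thesis using i by (simp add: act_def)
  qed (use assms in auto)
qed

lemma act_lincomb: "act i (\<lambda>g. \<Sum>x\<in>X. c x * \<phi> x g) g = (\<Sum>x\<in>X. c x * act i (\<phi> x) g)"
proof -
  have "(\<Sum>f\<in>low I (n i). \<Sum>x\<in>X. co i f * (c x * \<phi> x (g + f))) =
        (\<Sum>x\<in>X. \<Sum>f\<in>low I (n i). co i f * (c x * \<phi> x (g + f)))"
    by (rule sum.swap)
  thus ?thesis
    by (simp add: act_def sum_distrib_left distrib_left sum.distrib mult_ac)
qed

lemma sols_lincomb: "(\<And>x. x \<in> X \<Longrightarrow> \<phi> x \<in> sols) \<Longrightarrow> (\<lambda>g. \<Sum>x\<in>X. c x * \<phi> x g) \<in> sols"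
  unfolding sols_def by (simp add: act_lincomb)

lemma sols_lincomb2: 
  assumes "\<phi> \<in> sols" "\<psi> \<in> sols" 
  shows "(\<lambda>g. a * \<phi> g + b * \<psi> g) \<in> sols"
proof -
  have "(\<lambda>g. \<Sum>x\<in>UNIV. (if x then a else b) * (if x then \<phi> else \<psi>) g) \<in> sols"
    by (rule sols_lincomb) (use assms in auto)
  thus ?thesis by (simp add: UNIV_bool add_ac)
qed

lemma sols_shift: "\<phi> \<in> sols \<Longrightarrow> set_mset h \<subseteq> I \<Longrightarrow> (\<lambda>g. \<phi> (g + h)) \<in> sols"
proof -
  assume *: "\<phi> \<in> sols" "set_mset h \<subseteq> I"
  have "act i (\<lambda>g. \<phi> (g + h)) g = act i \<phi> (g + h)" for i g
    by (simp add: act_def add_ac)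
  thus ?thesis using * by (auto simp: sols_def)
qed

lemma monomial_sol: "\<mu> \<in> zeros \<Longrightarrow> monomial \<mu> \<in> sols"
proof -
  assume \<mu>: "\<mu> \<in> zeros"
  have "act i (monomial \<mu>) g = monomial \<mu> g * poly_at i \<mu>" for i g
    by (simp add: act_def poly_at_def algebra_simps sum_distrib_left)
  thus ?thesis using \<mu> by (simp add: sols_def zeros_def)
qed

lemma finite_reduced: "finite reduced" and card_reduced: "card reduced = (\<Prod>i\<in>I. n i)"
proof -
  have "bij_betw (\<lambda>e. restrict (count e) I) reduced (PiE I (\<lambda>i. {..<n i}))"
  proof (rule bij_betwI[where g = "\<lambda>c. \<Sum>i\<in>I. replicate_mset (c i) i"])
    show "(\<lambda>c. \<Sum>i\<in>I. replicate_mset (c i) i) \<in> (\<Pi>\<^sub>E i\<in>I. {..<n i}) \<rightarrow> reduced"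
      by (auto simp: reduced_def set_mset_subset_iff count_sum_replicate PiE_iff)
    show "(\<Sum>i\<in>I. replicate_mset (restrict (count x) I i) i) = x" if "x \<in> reduced" for x
      using that by (auto intro!: multiset_eqI simp: count_sum_replicate reduced_def set_mset_subset_iff)
    show "restrict (count (\<Sum>i\<in>I. replicate_mset (y i) i)) I = y" if "y \<in> (\<Pi>\<^sub>E i\<in>I. {..<n i})" for y
      using that by (auto simp: count_sum_replicate restrict_def PiE_iff extensional_def fun_eq_iff)
  qed (auto simp: reduced_def)
  moreover have "finite (PiE I (\<lambda>i. {..<n i}))" using finite_I by (intro finite_PiE) auto
  moreover have "card (PiE I (\<lambda>i. {..<n i})) = (\<Prod>i\<in>I. n i)" 
    using finite_I by (simp add: card_PiE)
  ultimately show "finite reduced" "card reduced = (\<Prod>i\<in>I. n i)"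
    by (metis bij_betw_finite, metis bij_betw_same_card)
qed

end


section \<open>Common eigenvectors of the shifts and the zeros of the system\<close>

context triangular_system begin

definition invariant :: "('i multiset \<Rightarrow> complex) set \<Rightarrow> bool" where
  "invariant W \<longleftrightarrow> W \<subseteq> sols \<and>
     (\<forall>\<phi>\<in>W. \<forall>\<psi>\<in>W. \<forall>a b. (\<lambda>g. a * \<phi> g + b * \<psi> g) \<in> W) \<and>
     (\<forall>\<phi>\<in>W. \<forall>i\<in>I. (\<lambda>g. \<phi> (add_mset i g)) \<in> W)"

lemma invariantD:
  assumes "invariant W" "\<phi> \<in> W"
  shows "\<phi> \<in> sols" "\<psi> \<in> W \<Longrightarrow> (\<lambda>g. a * \<phi> g + b * \<psi> g) \<in> W"
    "i \<in> I \<Longrightarrow> (\<lambda>g. \<phi> (add_mset i g)) \<in> W"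
  using assms by (auto simp: invariant_def)

text \<open>The recurrences in \<open>sols\<close> constrain only indices supported on
  \<open>I\<close>, so being nonzero must be witnessed at such an index.\<close>

definition nontrivial :: "('i multiset \<Rightarrow> complex) \<Rightarrow> bool" where
  "nontrivial \<phi> \<longleftrightarrow> (\<exists>g. set_mset g \<subseteq> I \<and> \<phi> g \<noteq> 0)"

definition eigen_seq :: "'i \<Rightarrow> complex \<Rightarrow> ('i multiset \<Rightarrow> complex) \<Rightarrow> bool" where
  "eigen_seq i \<mu> \<phi> \<longleftrightarrow> (\<forall>g. set_mset g \<subseteq> I \<longrightarrow> \<phi> (add_mset i g) = \<mu> * \<phi> g)"

text \<open>The linear factors of an annihilating polynomial of the shift are applied one at a time;
  the last nonzero sequence before the result becomes trivial is an eigenvector. The fixed summation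
  bound \<open>K\<close> stays the same while the degree of \<open>p\<close> drops in the
  induction.\<close>

lemma eigen_seq_from_annihilator:
  assumes W: "invariant W" and i: "i \<in> I"
    and "\<phi> \<in> W" "nontrivial \<phi>" "p \<noteq> 0" "degree p \<le> K"
    and "\<And>g. set_mset g \<subseteq> I \<Longrightarrow> (\<Sum>s\<le>K. coeff p s * \<phi> (g + replicate_mset s i)) = 0"
  shows "\<exists>\<psi>\<in>W. nontrivial \<psi> \<and> (\<exists>\<mu>. eigen_seq i \<mu> \<psi>)"
  using assms(3-)
proof (induction "degree p" arbitrary: p \<phi>)
  case 0
  then obtain c where c: "p = [:c:]" "c \<noteq> 0"
    by (metis degree_eq_zeroE pCons_0_0)
  have "\<phi> g = 0" if g: "set_mset g \<subseteq> I" for g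
  proof -
    have "(\<Sum>s\<le>K. coeff p s * \<phi> (g + replicate_mset s i)) = (\<Sum>s\<in>{0}. coeff p s * \<phi> (g + replicate_mset s i))"
      by (rule sum.mono_neutral_right) (auto simp: c coeff_pCons split: nat.splits)
    thus ?thesis using 0(6)[OF g] c by simp
  qed
  thus ?case using 0 by (auto simp: nontrivial_def)
next
  case (Suc d)
  have "\<not> constant (poly p)" using Suc(2) by (simp add: constant_degree)
  then obtain \<mu> where "poly p \<mu> = 0" using fundamental_theorem_of_algebra by blast
  then obtain q where q: "p = [:-\<mu>, 1:] * q" by (auto simp: poly_eq_0_iff_dvd)
  have q0: "q \<noteq> 0" using Suc.prems q by auto
  have "degree p = Suc (degree q)" unfolding q using q0 by (subst degree_mult_eq) auto
  hence dq: "degree q = d" using Suc(2) by simp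
  define \<psi> where "\<psi> = (\<lambda>g. 1 * \<phi> (add_mset i g) + (-\<mu>) * \<phi> g)"
  have \<psi>W: "\<psi> \<in> W"
    unfolding \<psi>_def by (intro invariantD[OF W] Suc.prems(1) i)
  show ?case
  proof (cases "nontrivial \<psi>")
    case False
    thus ?thesis using Suc.prems by (auto simp: nontrivial_def \<psi>_def eigen_seq_def)
  next
    case True
    have "(\<Sum>s\<le>K. coeff q s * \<psi> (g + replicate_mset s i)) = 0" if g: "set_mset g \<subseteq> I" for g
    proof -
      let ?f = "\<lambda>s. \<phi> (g + replicate_mset s i)"
      obtain K' where K': "K = Suc K'" using Suc.prems Suc(2) by (cases K) auto
      have cp: "coeff p s = (if s = 0 then 0 else coeff q (s - 1)) - \<mu> * coeff q s" for s
        unfolding q by (cases s) (auto simp: coeff_pCons)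
      have "coeff q (Suc K') = 0" using dq Suc.prems Suc(2) K' by (intro coeff_eq_0) auto
      hence "(\<Sum>s\<le>K. coeff q s * ?f (Suc s)) = (\<Sum>s\<le>K. (if s = 0 then 0 else coeff q (s - 1)) * ?f s)"
        unfolding K' by (subst (2) sum.atMost_Suc_shift) simp
      moreover have "(\<Sum>s\<le>K. coeff p s * ?f s) = (\<Sum>s\<le>K. (if s = 0 then 0 else coeff q (s - 1)) * ?f s)
            - \<mu> * (\<Sum>s\<le>K. coeff q s * ?f s)"
        by (simp add: cp left_diff_distrib sum_subtractf sum_distrib_left mult.assoc)
      moreover have "(\<Sum>s\<le>K. coeff q s * \<psi> (g + replicate_mset s i)) =
          (\<Sum>s\<le>K. coeff q s * ?f (Suc s)) - \<mu> * (\<Sum>s\<le>K. coeff q s * ?f s)"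
        by (simp add: \<psi>_def right_diff_distrib sum_subtractf sum_distrib_left mult_ac)
      ultimately show ?thesis using Suc.prems(5)[OF g] by simp
    qed
    thus ?thesis using Suc.hyps(1)[of q \<psi>] dq q0 \<psi>W True Suc.prems(4) Suc(2) by auto
  qed
qed

definition dimE :: nat where "dimE = card reduced"

text \<open>Numbers the reduced indices for use as matrix indices. It depends only on
  \<open>I\<close> and \<open>n\<close>, so one numbering serves every member of a family of
  systems.\<close>

definition enum :: "nat \<Rightarrow> 'i multiset" where
  "enum = (SOME f. bij_betw f {..<dimE} reduced)"

lemma bij_enum: "bij_betw enum {..<dimE} reduced"
proof -
  have "\<exists>f. bij_betw f {..<dimE} reduced"
    using ex_bij_betw_nat_finite[OF finite_reduced] by (simp add: dimE_def atLeast0LessThan)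
  thus ?thesis unfolding enum_def by (rule someI_ex)
qed

lemma dimE: "dimE = (\<Prod>i\<in>I. n i)"
  by (simp add: dimE_def card_reduced)

lemma dimE_pos: "dimE > 0"
  unfolding dimE using n_pos finite_I by (intro prod_pos) auto

lemma enum_reduced: "a < dimE \<Longrightarrow> enum a \<in> reduced"
  using bij_enum bij_betwE by blast

lemma reduced_enumE:
  assumes "e \<in> reduced" obtains a where "a < dimE" "e = enum a"
  using assms bij_enum unfolding bij_betw_def by auto

lemma reduced_subset: "e \<in> reduced \<Longrightarrow> set_mset e \<subseteq> I"
  by (simp add: reduced_def)

text \<open>A sequence in \<open>sols\<close> is determined by \<open>dimE\<close> values, so its
  first \<open>dimE + 1\<close> shifts in direction \<open>i\<close> are linearly dependent.\<close>

lemma annihilator: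
  assumes \<phi>: "\<phi> \<in> sols" and i: "i \<in> I"
  shows "\<exists>p. p \<noteq> 0 \<and> degree p \<le> dimE \<and>
     (\<forall>g. set_mset g \<subseteq> I \<longrightarrow> (\<Sum>s\<le>dimE. coeff p s * \<phi> (g + replicate_mset s i)) = 0)"
proof -
  \<comment> \<open>The extra zero row makes the matrix square and its determinant zero, so that a
    kernel vector supplies the dependence.\<close>
  define A where "A = mat (Suc dimE) (Suc dimE)
    (\<lambda>(a, s). if a < dimE then \<phi> (enum a + replicate_mset s i) else 0)"
  have A: "A \<in> carrier_mat (Suc dimE) (Suc dimE)" by (simp add: A_def)
  have "Determinant.det A = 0"
    unfolding laplace_expansion_row[OF A lessI] by (rule sum.neutral) (auto simp: A_def)
  then obtain v where v: "v \<in> carrier_vec (Suc dimE)" "v \<noteq> 0\<^sub>v (Suc dimE)" "A *\<^sub>v v = 0\<^sub>v (Suc dimE)"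
    using det_0_iff_vec_prod_zero_field[OF A] by blast
  define p where "p = (\<Sum>s\<le>dimE. monom (vec_index v s) s)"
  have cp: "coeff p s = (if s \<le> dimE then vec_index v s else 0)" for s
    by (simp add: p_def coeff_sum sum.delta)
  have "p \<noteq> 0"
  proof
    assume "p = 0"
    hence "vec_index v s = 0" if "s < Suc dimE" for s using cp[of s] that by simp
    thus False using v(1,2) by (auto intro!: eq_vecI)
  qed
  moreover have "degree p \<le> dimE" by (rule degree_le) (simp add: cp)
  moreover have "(\<Sum>s\<le>dimE. coeff p s * \<phi> (g + replicate_mset s i)) = 0" if "set_mset g \<subseteq> I" for g
  proof (rule sols_unique[OF _ _ that])
    show "(\<lambda>g. \<Sum>s\<le>dimE. coeff p s * \<phi> (g + replicate_mset s i)) \<in> sols"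
      using \<phi> i by (intro sols_lincomb sols_shift) (auto simp: set_mset_replicate_mset_subset)
    fix e assume "e \<in> reduced"
    then obtain a where a: "a < dimE" "e = enum a" by (rule reduced_enumE)
    have "0 = vec_index (A *\<^sub>v v) a" using v a by simp
    also have "\<dots> = (\<Sum>s\<in>{0..<Suc dimE}. \<phi> (e + replicate_mset s i) * vec_index v s)"
      using a v(1) by (simp add: A_def scalar_prod_def)
    also have "\<dots> = (\<Sum>s\<le>dimE. coeff p s * \<phi> (e + replicate_mset s i))"
      by (rule sum.cong) (auto simp: cp)
    finally show "(\<Sum>s\<le>dimE. coeff p s * \<phi> (e + replicate_mset s i)) = 0" by simp
  qed
  ultimately show ?thesis by blast
qed

text \<open>The shifts commute, so the joint eigenspace for the directions treated so far is again
  invariant, and an eigenvector for the next direction can be found inside it.\<close>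

lemma common_eigen_seq:
  assumes W: "invariant W" and ex: "\<exists>\<phi>\<in>W. nontrivial \<phi>" and J: "J \<subseteq> I"
  shows "\<exists>\<phi>\<in>W. nontrivial \<phi> \<and> (\<forall>j\<in>J. \<exists>\<mu>. eigen_seq j \<mu> \<phi>)"
proof -
  have "finite J" using J finite_I finite_subset by blast
  thus ?thesis using J
  proof (induction J)
    case empty
    thus ?case using ex by auto
  next
    case (insert i J)
    then obtain \<phi> where \<phi>: "\<phi> \<in> W" "nontrivial \<phi>" "\<forall>j\<in>J. \<exists>\<mu>. eigen_seq j \<mu> \<phi>" by auto
    then obtain \<mu> where \<mu>: "\<And>j. j \<in> J \<Longrightarrow> eigen_seq j (\<mu> j) \<phi>" by metis
    define W' where "W' = {\<psi>\<in>W. \<forall>j\<in>J. eigen_seq j (\<mu> j) \<psi>}"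
    have i: "i \<in> I" using insert by auto
    have "eigen_seq j (\<mu> j) (\<lambda>g. \<psi> (add_mset i' g))"
      if "eigen_seq j (\<mu> j) \<psi>" "i' \<in> I" for j i' \<psi>
      unfolding eigen_seq_def
    proof (intro allI impI)
      fix g assume "set_mset g \<subseteq> I"
      hence "\<psi> (add_mset j (add_mset i' g)) = \<mu> j * \<psi> (add_mset i' g)"
        using that unfolding eigen_seq_def by simp
      thus "\<psi> (add_mset i' (add_mset j g)) = \<mu> j * \<psi> (add_mset i' g)"
        by (simp add: add_mset_commute)
    qed
    moreover have "eigen_seq j (\<mu> j) (\<lambda>g. a * \<psi> g + b * \<psi>' g)"
      if "eigen_seq j (\<mu> j) \<psi>" "eigen_seq j (\<mu> j) \<psi>'" for j a b \<psi> \<psi>'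
      using that unfolding eigen_seq_def by (auto simp: algebra_simps)
    ultimately have "invariant W'"
      unfolding invariant_def[of W'] using invariantD[OF W] by (auto simp: W'_def)
    moreover have "\<phi> \<in> W'" using \<phi> \<mu> by (simp add: W'_def)
    moreover have "\<phi> \<in> sols" using W \<phi> by (auto simp: invariant_def)
    then obtain p where "p \<noteq> 0" "degree p \<le> dimE"
     "\<And>g. set_mset g \<subseteq> I \<Longrightarrow> (\<Sum>s\<le>dimE. coeff p s * \<phi> (g + replicate_mset s i)) = 0"
      using annihilator[OF _ i] by blast
    ultimately obtain \<psi> where \<psi>: "\<psi> \<in> W'" "nontrivial \<psi>" "\<exists>\<mu>. eigen_seq i \<mu> \<psi>"
      using eigen_seq_from_annihilator[of W' i \<phi> p dimE] i \<phi>(2) by blast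
    thus ?case by (intro bexI[of _ \<psi>]) (auto simp: W'_def)
  qed
qed

text \<open>A common eigen sequence is its value at \<open>{#}\<close> times the monomials in its
  eigenvalues. Nontriviality makes that value nonzero, and dividing the recurrence at
  \<open>{#}\<close> by it gives the equations of the system.\<close>

lemma zero_from_invariant:
  assumes W: "invariant W" and ex: "\<exists>\<phi>\<in>W. nontrivial \<phi>"
  shows "\<exists>\<mu>\<in>zeros. \<exists>\<phi>\<in>W. nontrivial \<phi> \<and> (\<forall>i\<in>I. eigen_seq i (\<mu> i) \<phi>)"
proof -
  obtain \<phi> where \<phi>: "\<phi> \<in> W" "nontrivial \<phi>" "\<forall>i\<in>I. \<exists>\<mu>. eigen_seq i \<mu> \<phi>"
    using common_eigen_seq[OF W ex order_refl] by blast
  then obtain \<mu>0 where \<mu>0: "\<And>i. i \<in> I \<Longrightarrow> eigen_seq i (\<mu>0 i) \<phi>" by metis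
  define \<mu> where "\<mu> = restrict \<mu>0 I"
  have \<mu>: "eigen_seq i (\<mu> i) \<phi>" if "i \<in> I" for i using \<mu>0 that by (simp add: \<mu>_def)
  have mon: "\<phi> g = monomial \<mu> g * \<phi> {#}" if "set_mset g \<subseteq> I" for g
    using that by (induction g) (use \<mu> in \<open>auto simp: eigen_seq_def\<close>)
  obtain g0 where "set_mset g0 \<subseteq> I" "\<phi> g0 \<noteq> 0" using \<phi>(2) unfolding nontrivial_def by blast
  hence ne: "\<phi> {#} \<noteq> 0" using mon[of g0] by auto
  have "poly_at i \<mu> = 0" if i: "i \<in> I" for i
  proof -
    have "0 = act i \<phi> {#}" using W \<phi>(1) i by (auto simp: invariant_def sols_def)
    also have "(\<Sum>f\<in>low I (n i). co i f * \<phi> f) = (\<Sum>f\<in>low I (n i). co i f * (monomial \<mu> f * \<phi> {#}))"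
      by (intro sum.cong refl arg_cong2[where f = "(*)"] mon) (auto simp: low_def)
    hence "act i \<phi> {#} = poly_at i \<mu> * \<phi> {#}"
      using mon[of "replicate_mset (n i) i"] i
      by (simp add: act_def poly_at_def set_mset_replicate_mset_subset sum_distrib_left distrib_left mult_ac)
    finally show ?thesis using ne by simp
  qed
  hence "\<mu> \<in> zeros" by (simp add: zeros_def \<mu>_def)
  thus ?thesis using \<phi> \<mu> by blast
qed

text \<open>The basis of \<open>sols\<close> dual to the reduced monomials, determined on all
  indices supported on \<open>I\<close>.\<close>

definition basis :: "'i multiset \<Rightarrow> 'i multiset \<Rightarrow> complex" where
  "basis e = (SOME \<phi>. \<phi> \<in> sols \<and> (\<forall>e'\<in>reduced. \<phi> e' = (if e' = e then 1 else 0)))"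

lemma basis: "basis e \<in> sols" "e' \<in> reduced \<Longrightarrow> basis e e' = (if e' = e then 1 else 0)"
proof -
  have "\<exists>\<phi>. \<phi> \<in> sols \<and> (\<forall>e'\<in>reduced. \<phi> e' = (if e' = e then 1 else 0))"
    using sols_extend[of "\<lambda>e'. if e' = e then 1 else 0"] by blast
  from someI_ex[OF this] show "basis e \<in> sols" "e' \<in> reduced \<Longrightarrow> basis e e' = (if e' = e then 1 else 0)"
    unfolding basis_def by auto
qed

lemma basis_enum: "a < dimE \<Longrightarrow> b < dimE \<Longrightarrow> basis (enum b) (enum a) = (if a = b then 1 else 0)"
  using basis(2)[OF enum_reduced, of a "enum b"] bij_enum
  by (auto simp: bij_betw_def inj_on_def)

lemma sum_basis_enum:
  "a < dimE \<Longrightarrow> (\<Sum>b<dimE. c b * basis (enum b) (enum a)) = c a"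
  by (simp add: basis_enum if_distrib[of "\<lambda>x. _ * x"] sum.delta cong: if_cong)

lemma expand_basis:
  assumes "\<phi> \<in> sols" "set_mset g \<subseteq> I"
  shows "\<phi> g = (\<Sum>b<dimE. \<phi> (enum b) * basis (enum b) g)"
proof -
  have "1 * \<phi> g + (-1) * (\<Sum>b<dimE. \<phi> (enum b) * basis (enum b) g) = 0"
  proof (rule sols_unique[OF _ _ assms(2)])
    show "(\<lambda>g. 1 * \<phi> g + (-1) * (\<Sum>b<dimE. \<phi> (enum b) * basis (enum b) g)) \<in> sols"
      by (intro sols_lincomb2 sols_lincomb assms basis)
    show "1 * \<phi> e + (-1) * (\<Sum>b<dimE. \<phi> (enum b) * basis (enum b) e) = 0" if "e \<in> reduced" for e
      using that by (elim reduced_enumE) (simp add: sum_basis_enum)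
  qed
  thus ?thesis by simp
qed

definition shift :: "('i \<Rightarrow> complex) \<Rightarrow> ('i multiset \<Rightarrow> complex) \<Rightarrow> 'i multiset \<Rightarrow> complex" where
  "shift l \<phi> g = (\<Sum>i\<in>I. l i * \<phi> (add_mset i g))"

text \<open>The matrix of \<open>shift l\<close> in the dual basis, where the coordinates of a
  sequence are its values at the reduced indices. It is the transpose of multiplication by the
  linear form \<open>l\<close> on the quotient algebra.\<close>

definition mult_mat :: "('i \<Rightarrow> complex) \<Rightarrow> complex mat" where
  "mult_mat l = mat dimE dimE (\<lambda>(a, b). shift l (basis (enum b)) (enum a))"

lemma mult_mat_carrier: "mult_mat l \<in> carrier_mat dimE dimE"
  by (simp add: mult_mat_def)

lemma shift_sols: "\<phi> \<in> sols \<Longrightarrow> shift l \<phi> \<in> sols"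
proof -
  assume \<phi>: "\<phi> \<in> sols"
  have "(\<lambda>g. \<Sum>i\<in>I. l i * \<phi> (g + {#i#})) \<in> sols"
    by (intro sols_lincomb sols_shift \<phi>) auto
  thus ?thesis by (simp add: shift_def[abs_def])
qed

lemma mult_mat_vec:
  assumes "\<phi> \<in> sols"
  shows "mult_mat l *\<^sub>v Matrix.vec dimE (\<lambda>a. \<phi> (enum a)) = Matrix.vec dimE (\<lambda>a. shift l \<phi> (enum a))"
proof (rule eq_vecI)
  fix a assume "a < dim_vec (Matrix.vec dimE (\<lambda>a. shift l \<phi> (enum a)))"
  hence a: "a < dimE" by simp
  have sub: "set_mset (add_mset i (enum a)) \<subseteq> I" if "i \<in> I" for i
    using that reduced_subset[OF enum_reduced[OF a]] by auto
  have "vec_index (mult_mat l *\<^sub>v Matrix.vec dimE (\<lambda>a. \<phi> (enum a))) a =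
      (\<Sum>b\<in>{0..<dimE}. shift l (basis (enum b)) (enum a) * \<phi> (enum b))"
    using a by (simp add: mult_mat_def scalar_prod_def)
  also have "\<dots> = (\<Sum>b<dimE. \<Sum>i\<in>I. l i * (\<phi> (enum b) * basis (enum b) (add_mset i (enum a))))"
    by (simp add: shift_def sum_distrib_left mult_ac atLeast0LessThan)
  also have "\<dots> = (\<Sum>i\<in>I. l i * (\<Sum>b<dimE. \<phi> (enum b) * basis (enum b) (add_mset i (enum a))))"
    by (subst sum.swap) (simp add: sum_distrib_left)
  also have "\<dots> = shift l \<phi> (enum a)"
    unfolding shift_def using expand_basis[OF assms sub] by (intro sum.cong) auto
  finally show "vec_index (mult_mat l *\<^sub>v Matrix.vec dimE (\<lambda>a. \<phi> (enum a))) a =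
     vec_index (Matrix.vec dimE (\<lambda>a. shift l \<phi> (enum a))) a" using a by simp
qed (simp add: mult_mat_def)

lemma empty_reduced: "{#} \<in> reduced"
  using n_pos by (auto simp: reduced_def)

text \<open>Stickelberger's eigenvalue theorem for a linear form. Evaluation at a zero is an
  eigenvector, nonzero because it is 1 at \<open>{#}\<close>. Conversely the eigenspace of
  \<open>shift l\<close> is invariant under every shift, so it contains a common eigenvector, whose
  eigenvalues form a zero with the required value of \<open>l\<close>.\<close>

lemma eigenvalue_mult_mat:
  "eigenvalue (mult_mat l) x \<longleftrightarrow> (\<exists>\<mu>\<in>zeros. (\<Sum>i\<in>I. l i * \<mu> i) = x)"
proof
  assume "\<exists>\<mu>\<in>zeros. (\<Sum>i\<in>I. l i * \<mu> i) = x"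
  then obtain \<mu> where \<mu>: "\<mu> \<in> zeros" "(\<Sum>i\<in>I. l i * \<mu> i) = x" by blast
  have sh: "shift l (monomial \<mu>) g = x * monomial \<mu> g" for g
    by (simp add: shift_def sum_distrib_left mult_ac flip: \<mu>(2))
  obtain a0 where a0: "a0 < dimE" "enum a0 = {#}" using empty_reduced reduced_enumE by metis
  let ?v = "Matrix.vec dimE (\<lambda>a. monomial \<mu> (enum a))"
  have "vec_index ?v a0 = 1" using a0 by simp
  hence "?v \<noteq> 0\<^sub>v dimE" using a0 by (metis index_zero_vec(1) zero_neq_one)
  moreover have "mult_mat l *\<^sub>v ?v = x \<cdot>\<^sub>v ?v"
    unfolding mult_mat_vec[OF monomial_sol[OF \<mu>(1)]] by (intro eq_vecI) (auto simp: sh)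
  ultimately have "eigenvector (mult_mat l) ?v x"
    unfolding eigenvector_def by (auto simp: mult_mat_def)
  thus "eigenvalue (mult_mat l) x" unfolding eigenvalue_def by blast
next
  assume "eigenvalue (mult_mat l) x"
  then obtain v where v: "v \<in> carrier_vec dimE" "v \<noteq> 0\<^sub>v dimE" "mult_mat l *\<^sub>v v = x \<cdot>\<^sub>v v"
    unfolding eigenvalue_def eigenvector_def by (auto simp: mult_mat_def)
  define \<phi> where "\<phi> = (\<lambda>g. \<Sum>b<dimE. vec_index v b * basis (enum b) g)"
  have \<phi>: "\<phi> \<in> sols" unfolding \<phi>_def by (intro sols_lincomb basis)
  have \<phi>e: "\<phi> (enum a) = vec_index v a" if "a < dimE" for a
    using that by (simp add: \<phi>_def sum_basis_enum)
  have veq: "v = Matrix.vec dimE (\<lambda>a. \<phi> (enum a))"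
    using v(1) \<phi>e by (intro eq_vecI) auto
  have ev: "Matrix.vec dimE (\<lambda>a. shift l \<phi> (enum a)) = x \<cdot>\<^sub>v v"
    using v(3) mult_mat_vec[OF \<phi>] veq by simp
  have she: "shift l \<phi> g = x * \<phi> g" if "set_mset g \<subseteq> I" for g
  proof -
    have "1 * shift l \<phi> g + (-x) * \<phi> g = 0"
    proof (rule sols_unique[OF _ _ that])
      show "(\<lambda>g. 1 * shift l \<phi> g + (-x) * \<phi> g) \<in> sols"
        by (intro sols_lincomb2 shift_sols \<phi>)
      fix e assume "e \<in> reduced"
      then obtain a where a: "a < dimE" "e = enum a" by (rule reduced_enumE)
      have "vec_index (Matrix.vec dimE (\<lambda>a. shift l \<phi> (enum a))) a = vec_index (x \<cdot>\<^sub>v v) a"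
        using ev by simp
      thus "1 * shift l \<phi> e + (-x) * \<phi> e = 0" using a v(1) \<phi>e by simp
    qed
    thus ?thesis by simp
  qed
  define W where "W = {\<psi>\<in>sols. \<forall>g. set_mset g \<subseteq> I \<longrightarrow> shift l \<psi> g = x * \<psi> g}"
  have "invariant W" unfolding invariant_def
  proof (intro conjI ballI allI)
    fix \<phi>1 \<phi>2 a b assume "\<phi>1 \<in> W" "\<phi>2 \<in> W"
    moreover have "shift l (\<lambda>g. a * \<phi>1 g + b * \<phi>2 g) g = a * shift l \<phi>1 g + b * shift l \<phi>2 g" for g
      by (simp add: shift_def sum_distrib_left sum.distrib distrib_left mult_ac)
    ultimately show "(\<lambda>g. a * \<phi>1 g + b * \<phi>2 g) \<in> W"
      by (auto simp: W_def sols_lincomb2 algebra_simps)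
  next
    fix \<phi>1 i assume *: "\<phi>1 \<in> W" "i \<in> I"
    have "shift l (\<lambda>g. \<phi>1 (add_mset i g)) g = shift l \<phi>1 (add_mset i g)" for g
      by (simp add: shift_def add_mset_commute)
    moreover have "(\<lambda>g. \<phi>1 (g + {#i#})) \<in> sols" using * by (intro sols_shift) (auto simp: W_def)
    ultimately show "(\<lambda>g. \<phi>1 (add_mset i g)) \<in> W" using * by (auto simp: W_def)
  qed (auto simp: W_def)
  moreover have "\<phi> \<in> W" using \<phi> she by (simp add: W_def)
  moreover have "nontrivial \<phi>"
  proof (rule ccontr)
    assume "\<not> nontrivial \<phi>"
    hence "vec_index v a = 0" if "a < dimE" for a
      using \<phi>e[OF that] reduced_subset[OF enum_reduced[OF that]] by (auto simp: nontrivial_def)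
    thus False using v(1,2) by (auto intro!: eq_vecI)
  qed
  ultimately obtain \<mu> \<psi> where \<mu>: "\<mu> \<in> zeros" and \<psi>: "\<psi> \<in> W" "nontrivial \<psi>"
    and ei: "\<And>i. i \<in> I \<Longrightarrow> eigen_seq i (\<mu> i) \<psi>"
    using zero_from_invariant[of W] by blast
  obtain g where g: "set_mset g \<subseteq> I" "\<psi> g \<noteq> 0" using \<psi>(2) by (auto simp: nontrivial_def)
  have "x * \<psi> g = shift l \<psi> g" using \<psi>(1) g by (simp add: W_def)
  also have "\<dots> = (\<Sum>i\<in>I. l i * \<mu> i) * \<psi> g"
    unfolding shift_def sum_distrib_right using ei g by (intro sum.cong) (auto simp: eigen_seq_def)
  finally have "(\<Sum>i\<in>I. l i * \<mu> i) = x" using g by simp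
  thus "\<exists>\<mu>\<in>zeros. (\<Sum>i\<in>I. l i * \<mu> i) = x" using \<mu> by blast
qed

end


section \<open>Separating linear forms and the discriminant\<close>

lemma resultant_pderiv_nonzero_iff:
  fixes p :: "complex poly"
  assumes "p \<noteq> 0"
  shows "resultant p (pderiv p) \<noteq> 0 \<longleftrightarrow> card {x. poly p x = 0} = degree p"
proof -
  have "resultant p (pderiv p) = 0 \<longleftrightarrow> (\<exists>x. poly p x = 0 \<and> poly (pderiv p) x = 0)"
  proof
    assume "resultant p (pderiv p) = 0"
    hence "\<not> constant (poly (gcd p (pderiv p)))" by (simp add: resultant_0_gcd constant_degree)
    then obtain x where "poly (gcd p (pderiv p)) x = 0" using fundamental_theorem_of_algebra by blast
    hence "[:-x, 1:] dvd gcd p (pderiv p)" by (simp add: poly_eq_0_iff_dvd)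
    thus "\<exists>x. poly p x = 0 \<and> poly (pderiv p) x = 0"
      by (auto simp: poly_eq_0_iff_dvd)
  next
    assume "\<exists>x. poly p x = 0 \<and> poly (pderiv p) x = 0"
    then obtain x where "[:-x, 1:] dvd gcd p (pderiv p)" by (auto simp: poly_eq_0_iff_dvd)
    from dvd_imp_degree_le[OF this] have "degree (gcd p (pderiv p)) \<noteq> 0" using assms by simp
    thus "resultant p (pderiv p) = 0" by (simp add: resultant_0_gcd)
  qed
  moreover have "card {x. poly p x = 0} = degree p" if "\<forall>x. \<not> (poly p x = 0 \<and> poly (pderiv p) x = 0)"
  proof -
    have "Polynomial.smult (lead_coeff p) (\<Prod>z|poly p z = 0. [:-z, 1:]) = p"
      using that by (intro complex_poly_decompose_rsquarefree) (simp add: rsquarefree_roots)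
    hence "degree p = degree (\<Prod>z|poly p z = 0. [:-z, 1:])"
      by (metis assms degree_smult_eq leading_coeff_0_iff)
    also have "\<dots> = (\<Sum>z|poly p z = 0. degree [:-z, 1:])"
      by (rule degree_prod_sum_eq) auto
    finally show ?thesis by simp
  qed
  moreover have "card {x. poly p x = 0} \<noteq> degree p" if x: "poly p x = 0" "poly (pderiv p) x = 0" for x
  proof -
    obtain q where q: "p = [:-x, 1:] * q" using x(1) by (auto simp: poly_eq_0_iff_dvd)
    have "poly q x = 0" using x(2) unfolding q pderiv_mult by (simp add: pderiv_pCons)
    hence "{x. poly p x = 0} = {x. poly q x = 0}" by (auto simp: q)
    moreover have "q \<noteq> 0" using assms q by auto
    hence "card {x. poly q x = 0} \<le> degree q" by (rule poly_roots_degree)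
    moreover have "degree p = Suc (degree q)" unfolding q using \<open>q \<noteq> 0\<close> by (subst degree_mult_eq) auto
    ultimately show ?thesis by simp
  qed
  ultimately show ?thesis by blast
qed

text \<open>Varying one coefficient of a form that works for \<open>D\<close> treats the new vector
  as well, because each vector excludes at most one value of the variation.\<close>

lemma separating_form:
  fixes D :: "('i \<Rightarrow> complex) set"
  assumes "finite I" "finite D" "\<And>d. d \<in> D \<Longrightarrow> \<exists>i\<in>I. d i \<noteq> 0"
  shows "\<exists>l. \<forall>d\<in>D. (\<Sum>i\<in>I. l i * d i) \<noteq> 0"
  using assms(2,3)
proof (induction D)
  case empty
  thus ?case by simp
next
  case (insert d D)
  then obtain l where l: "\<And>d. d \<in> D \<Longrightarrow> (\<Sum>i\<in>I. l i * d i) \<noteq> 0" by auto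
  obtain i0 where i0: "i0 \<in> I" "d i0 \<noteq> 0" using insert by auto
  define l' where "l' = (\<lambda>t i. l i + (if i = i0 then t else 0))"
  have l': "(\<Sum>i\<in>I. l' t i * e i) = (\<Sum>i\<in>I. l i * e i) + t * e i0" for t e
  proof -
    have "(\<Sum>i\<in>I. (if i = i0 then t else 0) * e i) = (\<Sum>i\<in>I. if i = i0 then t * e i else 0)"
      by (intro sum.cong) auto
    thus ?thesis using i0 assms(1) by (simp add: l'_def distrib_right sum.distrib sum.delta)
  qed
  \<comment> \<open>For \<open>e i0 \<noteq> 0\<close> the listed quotient is the only
    \<open>t\<close> at which the new form vanishes on \<open>e\<close>. For \<open>e i0 = 0\<close>
    the form does not depend on \<open>t\<close>, and the induction hypothesis already applies since
    \<open>e\<close> cannot be \<open>d\<close>.\<close>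
  define bad where "bad = (\<lambda>e. - (\<Sum>i\<in>I. l i * e i) / e i0) ` (insert d D)"
  have "finite bad" using insert by (simp add: bad_def)
  then obtain t where t: "t \<notin> bad" using ex_new_if_finite[OF infinite_UNIV_char_0] by blast
  have "(\<Sum>i\<in>I. l' t i * e i) \<noteq> 0" if e: "e \<in> insert d D" for e
  proof
    assume *: "(\<Sum>i\<in>I. l' t i * e i) = 0"
    show False
    proof (cases "e i0 = 0")
      case True
      thus ?thesis using * e i0 l unfolding l' by auto
    next
      case False
      hence "t = - (\<Sum>i\<in>I. l i * e i) / e i0"
        using * unfolding l' by (simp add: field_simps eq_neg_iff_add_eq_0)
      thus ?thesis using t e by (auto simp: bad_def)
    qed
  qed
  thus ?case by blast
qed

lemma separating_form_inj:
  fixes Z :: "('i \<Rightarrow> complex) set"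
  assumes "finite I" "finite Z" "Z \<subseteq> I \<rightarrow>\<^sub>E UNIV"
  shows "\<exists>l. inj_on (\<lambda>\<mu>. \<Sum>i\<in>I. l i * \<mu> i) Z"
proof -
  define D where "D = (\<lambda>(\<mu>, \<nu>) i. \<mu> i - \<nu> i) ` {(\<mu>, \<nu>) \<in> Z \<times> Z. \<mu> \<noteq> \<nu>}"
  have "finite {(\<mu>, \<nu>) \<in> Z \<times> Z. \<mu> \<noteq> \<nu>}"
    using assms(2) by (auto intro: finite_subset[OF _ finite_cartesian_product[OF assms(2) assms(2)]])
  hence "finite D" by (simp add: D_def)
  have nz: "\<exists>i\<in>I. d i \<noteq> 0" if d: "d \<in> D" for d
  proof -
    obtain \<mu> \<nu> where *: "\<mu> \<in> Z" "\<nu> \<in> Z" "\<mu> \<noteq> \<nu>" "d = (\<lambda>i. \<mu> i - \<nu> i)"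
      using d by (auto simp: D_def)
    then obtain i where "i \<in> I" "\<mu> i \<noteq> \<nu> i" using assms(3) PiE_ext[of \<mu> I "\<lambda>_. UNIV" \<nu>] by blast
    thus ?thesis using * by auto
  qed
  obtain l where l: "\<And>d. d \<in> D \<Longrightarrow> (\<Sum>i\<in>I. l i * d i) \<noteq> 0"
    using separating_form[OF assms(1) \<open>finite D\<close> nz] by auto
  have "inj_on (\<lambda>\<mu>. \<Sum>i\<in>I. l i * \<mu> i) Z"
  proof (rule inj_onI, rule ccontr)
    fix \<mu> \<nu> assume *: "\<mu> \<in> Z" "\<nu> \<in> Z" "(\<Sum>i\<in>I. l i * \<mu> i) = (\<Sum>i\<in>I. l i * \<nu> i)" "\<mu> \<noteq> \<nu>"
    have "(\<lambda>i. \<mu> i - \<nu> i) \<in> D"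
      unfolding D_def by (rule image_eqI[of _ _ "(\<mu>, \<nu>)"]) (use * in auto)
    hence "(\<Sum>i\<in>I. l i * (\<mu> i - \<nu> i)) \<noteq> 0" by (rule l)
    thus False using *(3) by (simp add: right_diff_distrib sum_subtractf)
  qed
  thus ?thesis by blast
qed

context triangular_system begin

definition linear_form :: "('i \<Rightarrow> complex) \<Rightarrow> ('i \<Rightarrow> complex) \<Rightarrow> complex" where
  "linear_form l \<mu> = (\<Sum>i\<in>I. l i * \<mu> i)"

definition discriminant :: "('i \<Rightarrow> complex) \<Rightarrow> complex" where
  "discriminant l = resultant (char_poly (mult_mat l)) (pderiv (char_poly (mult_mat l)))"

lemma char_poly_mult_mat:
  "degree (char_poly (mult_mat l)) = dimE" "char_poly (mult_mat l) \<noteq> 0"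
  "{x. poly (char_poly (mult_mat l)) x = 0} = linear_form l ` zeros"
proof -
  show "degree (char_poly (mult_mat l)) = dimE"
    using degree_monic_char_poly[OF mult_mat_carrier] by blast
  show "char_poly (mult_mat l) \<noteq> 0"
    using degree_monic_char_poly[OF mult_mat_carrier, of l] by auto
  show "{x. poly (char_poly (mult_mat l)) x = 0} = linear_form l ` zeros"
    unfolding eigenvalue_root_char_poly[OF mult_mat_carrier, symmetric] eigenvalue_mult_mat
    by (auto simp: linear_form_def)
qed

lemma card_linear_form_zeros: "card (linear_form l ` zeros) \<le> dimE" "finite (linear_form l ` zeros)"
  using poly_roots_degree[of "char_poly (mult_mat l)"] poly_roots_finite[of "char_poly (mult_mat l)"]
  by (simp_all add: char_poly_mult_mat)

lemma zeros_nonempty: "zeros \<noteq> {}"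
proof -
  have "\<not> constant (poly (char_poly (mult_mat (\<lambda>_. 0))))"
    using char_poly_mult_mat(1) dimE_pos by (simp add: constant_degree)
  then obtain x where "poly (char_poly (mult_mat (\<lambda>_. 0))) x = 0"
    using fundamental_theorem_of_algebra by blast
  thus ?thesis using char_poly_mult_mat(3) by blast
qed

text \<open>The separating form is chosen for a finite subset, because finiteness is still open at
  this point. Its values are roots of a characteristic polynomial of degree \<open>dimE\<close>,
  which bounds every finite subset and hence the whole set.\<close>

lemma finite_zeros: "finite zeros" and card_zeros_le: "card zeros \<le> dimE"
proof -
  have le: "card Z \<le> dimE" if Z: "Z \<subseteq> zeros" "finite Z" for Z
  proof -
    obtain l where "inj_on (linear_form l) Z"
      using separating_form_inj[OF finite_I Z(2)] Z(1) unfolding zeros_def linear_form_def[abs_def]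
      by blast
    hence "card Z = card (linear_form l ` Z)" by (simp add: card_image)
    also have "\<dots> \<le> card (linear_form l ` zeros)"
      using Z card_linear_form_zeros by (intro card_mono) auto
    finally show ?thesis using card_linear_form_zeros le_trans by blast
  qed
  show "finite zeros"
  proof (rule ccontr)
    assume "infinite zeros"
    then obtain Z where "Z \<subseteq> zeros" "finite Z" "card Z = Suc dimE"
      using infinite_arbitrarily_large by blast
    thus False using le[of Z] by simp
  qed
  thus "card zeros \<le> dimE" using le by blast
qed

lemma card_zeros_eq:
  assumes "discriminant l \<noteq> 0"
  shows "card zeros = dimE"
proof -
  have "dimE = card (linear_form l ` zeros)"
    using assms resultant_pderiv_nonzero_iff[OF char_poly_mult_mat(2)[of l]]
    by (simp add: discriminant_def char_poly_mult_mat)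
  also have "\<dots> \<le> card zeros" by (rule card_image_le) (rule finite_zeros)
  finally show ?thesis using card_zeros_le by simp
qed

lemma discriminant_nonzero:
  assumes "inj_on (linear_form l) Z" "Z \<subseteq> zeros" "card Z = dimE"
  shows "discriminant l \<noteq> 0"
proof -
  have "Z = zeros" using assms finite_zeros card_zeros_le card_subset_eq by (metis card_mono le_antisym)
  hence "card (linear_form l ` zeros) = dimE" using assms by (simp add: card_image)
  thus ?thesis using resultant_pderiv_nonzero_iff[OF char_poly_mult_mat(2)[of l]]
    by (simp add: discriminant_def char_poly_mult_mat)
qed

end

section \<open>Polynomial dependence on parameters\<close>

locale param_ring =
  fixes R :: "('x \<Rightarrow> complex) \<Rightarrow> bool"
  assumes R_const: "R (\<lambda>_. c)"
    and R_add: "R f \<Longrightarrow> R g \<Longrightarrow> R (\<lambda>\<theta>. f \<theta> + g \<theta>)"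
    and R_mult: "R f \<Longrightarrow> R g \<Longrightarrow> R (\<lambda>\<theta>. f \<theta> * g \<theta>)"
begin

lemma R_uminus: "R f \<Longrightarrow> R (\<lambda>\<theta>. - f \<theta>)"
  using R_mult[OF R_const[of "-1"]] by simp

lemma R_diff: "R f \<Longrightarrow> R g \<Longrightarrow> R (\<lambda>\<theta>. f \<theta> - g \<theta>)"
  using R_add[OF _ R_uminus] by simp

lemma R_sum: "(\<And>x. x \<in> X \<Longrightarrow> R (f x)) \<Longrightarrow> R (\<lambda>\<theta>. \<Sum>x\<in>X. f x \<theta>)"
  by (induction X rule: infinite_finite_induct) (auto intro: R_const R_add)

lemma R_prod: "(\<And>x. x \<in> X \<Longrightarrow> R (f x)) \<Longrightarrow> R (\<lambda>\<theta>. \<Prod>x\<in>X. f x \<theta>)"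
  by (induction X rule: infinite_finite_induct) (auto intro: R_const R_mult)

lemma R_if: "(b \<Longrightarrow> R f) \<Longrightarrow> (\<not> b \<Longrightarrow> R g) \<Longrightarrow> R (\<lambda>\<theta>. if b then f \<theta> else g \<theta>)"
  by (cases b) simp_all

lemma R_power: "R f \<Longrightarrow> R (\<lambda>\<theta>. f \<theta> ^ k)"
  by (induction k) (auto intro: R_const R_mult)

definition RP :: "('x \<Rightarrow> complex poly) \<Rightarrow> bool" where
  "RP P \<longleftrightarrow> (\<forall>k. R (\<lambda>\<theta>. coeff (P \<theta>) k))"

lemma RP_const: "RP (\<lambda>_. c)"
  by (simp add: RP_def R_const)

lemma RP_add: "RP f \<Longrightarrow> RP g \<Longrightarrow> RP (\<lambda>\<theta>. f \<theta> + g \<theta>)"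
  by (simp add: RP_def R_add)

lemma RP_mult: "RP f \<Longrightarrow> RP g \<Longrightarrow> RP (\<lambda>\<theta>. f \<theta> * g \<theta>)"
  unfolding RP_def coeff_mult by (auto intro!: R_sum R_mult)

lemma RP_pCons0: "R f \<Longrightarrow> RP (\<lambda>\<theta>. [:f \<theta>:])"
  unfolding RP_def
proof
  show "R (\<lambda>\<theta>. coeff [:f \<theta>:] k)" if "R f" for k
    using that by (cases k) (simp_all add: R_const)
qed

lemma RP_sum: "(\<And>x. x \<in> X \<Longrightarrow> RP (f x)) \<Longrightarrow> RP (\<lambda>\<theta>. \<Sum>x\<in>X. f x \<theta>)"
  by (induction X rule: infinite_finite_induct) (auto intro: RP_const RP_add)

lemma RP_prod: "(\<And>x. x \<in> X \<Longrightarrow> RP (f x)) \<Longrightarrow> RP (\<lambda>\<theta>. \<Prod>x\<in>X. f x \<theta>)"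
  by (induction X rule: infinite_finite_induct) (auto intro: RP_const RP_mult)

lemma R_det:
  assumes "\<And>\<theta>. A \<theta> \<in> carrier_mat n n" "\<And>i j. i < n \<Longrightarrow> j < n \<Longrightarrow> R (\<lambda>\<theta>. A \<theta> $$ (i, j))"
  shows "R (\<lambda>\<theta>. Determinant.det (A \<theta>))"
  unfolding det_def'[OF assms(1)]
  by (intro R_sum R_mult R_const R_prod assms(2)) (auto simp: permutes_in_image)

lemma RP_char_poly:
  assumes "\<And>\<theta>. A \<theta> \<in> carrier_mat n n" "\<And>i j. i < n \<Longrightarrow> j < n \<Longrightarrow> R (\<lambda>\<theta>. A \<theta> $$ (i, j))"
  shows "RP (\<lambda>\<theta>. char_poly (A \<theta>))"
proof -
  have "RP (\<lambda>\<theta>. char_poly_matrix (A \<theta>) $$ (i, j))" if ij: "i < n" "j < n" for i j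
  proof -
    have "char_poly_matrix (A \<theta>) $$ (i, j) = (if i = j then [:0, 1:] else 0) + [:- A \<theta> $$ (i, j):]" for \<theta>
      using assms(1)[of \<theta>] ij by (simp add: char_poly_matrix_def)
    thus ?thesis by (simp only:) (intro RP_add RP_const RP_pCons0 R_uminus assms(2) ij)
  qed
  thus ?thesis
    unfolding char_poly_def det_def'[OF char_poly_matrix_closed[OF assms(1)]]
    by (intro RP_sum RP_mult RP_const RP_prod) (auto simp: permutes_in_image)
qed

text \<open>The degree has to be the same for all parameters: only then does the Sylvester matrix
  have a fixed size, so that its determinant is one polynomial expression in the
  coefficients.\<close>

lemma R_resultant_pderiv:
  assumes "RP P" "\<And>\<theta>. degree (P \<theta>) = n"
  shows "R (\<lambda>\<theta>. resultant (P \<theta>) (pderiv (P \<theta>)))"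
proof -
  have "degree (pderiv (P \<theta>)) = n - 1" for \<theta> using assms(2) by (simp add: degree_pderiv)
  hence eq: "resultant (P \<theta>) (pderiv (P \<theta>)) = Determinant.det (sylvester_mat_sub n (n - 1) (P \<theta>) (pderiv (P \<theta>)))" for \<theta>
    by (simp add: resultant_sub resultant_sub_def assms(2))
  have c: "R (\<lambda>\<theta>. coeff (P \<theta>) k)" for k using assms(1) by (simp add: RP_def)
  have c': "R (\<lambda>\<theta>. coeff (pderiv (P \<theta>)) k)" for k
    unfolding coeff_pderiv by (intro R_mult R_const c)
  show ?thesis unfolding eq
  proof (rule R_det[OF sylvester_mat_sub_carrier])
    fix i j assume "i < n + (n - 1)" "j < n + (n - 1)"
    thus "R (\<lambda>\<theta>. sylvester_mat_sub n (n - 1) (P \<theta>) (pderiv (P \<theta>)) $$ (i, j))"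
      by (simp only: sylvester_mat_sub_index) (intro R_if c c' R_const)
  qed
qed

end

locale system_family = param_ring R
  for R :: "('x \<Rightarrow> complex) \<Rightarrow> bool" +
  fixes I :: "'i set" and n :: "'i \<Rightarrow> nat" and co :: "'x \<Rightarrow> 'i \<Rightarrow> 'i multiset \<Rightarrow> complex"
  assumes finite_index: "finite I" and exponent_pos: "\<And>i. i \<in> I \<Longrightarrow> n i > 0"
    and R_co: "\<And>i f. i \<in> I \<Longrightarrow> f \<in> low I (n i) \<Longrightarrow> R (\<lambda>\<theta>. co \<theta> i f)"
begin

sublocale T: triangular_system I n "co \<theta>" for \<theta>
  by unfold_locales (auto intro: finite_index exponent_pos)

text \<open>The rewriting of a non-reduced index uses only sums and products of the coefficients
  \<open>co\<close>, so no denominators appear.\<close>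

lemma R_basis:
  assumes "set_mset g \<subseteq> I"
  shows "R (\<lambda>\<theta>. T.basis \<theta> e g)"
  using assms
proof (induction g rule: measure_induct_rule[where f = size])
  case (less g)
  show ?case
  proof (cases "g \<in> T.reduced")
    case True
    thus ?thesis by (simp add: T.basis(2) R_const)
  next
    case False
    then obtain i g' where i: "i \<in> I" "set_mset g' \<subseteq> I" "g = g' + replicate_mset (n i) i"
      using T.split_nonreduced less.prems by blast
    have "T.basis \<theta> e g = - (\<Sum>f\<in>low I (n i). co \<theta> i f * T.basis \<theta> e (g' + f))" for \<theta>
    proof -
      have "T.act \<theta> i (T.basis \<theta> e) g' = 0"
        using T.basis(1)[of \<theta> e] i by (simp add: T.sols_def)
      thus ?thesis using i by (simp add: T.act_def eq_neg_iff_add_eq_0)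
    qed
    moreover have "R (\<lambda>\<theta>. T.basis \<theta> e (g' + f))" if "f \<in> low I (n i)" for f
      using that i by (intro less.IH) (auto simp: low_def)
    ultimately show ?thesis using R_co i
      by (simp only:) (intro R_uminus R_sum R_mult)
  qed
qed

lemma R_discriminant: "R (\<lambda>\<theta>. T.discriminant \<theta> l)"
  unfolding T.discriminant_def
proof (rule R_resultant_pderiv[OF RP_char_poly T.char_poly_mult_mat(1)])
  show "T.mult_mat \<theta> l \<in> carrier_mat T.dimE T.dimE" for \<theta> by (rule T.mult_mat_carrier)
  fix a b assume ab: "a < T.dimE" "b < T.dimE"
  have "T.mult_mat \<theta> l $$ (a, b) = (\<Sum>i\<in>I. l i * T.basis \<theta> (T.enum b) (add_mset i (T.enum a)))" for \<theta>
    using ab by (simp add: T.mult_mat_def T.shift_def)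
  thus "R (\<lambda>\<theta>. T.mult_mat \<theta> l $$ (a, b))"
    using T.reduced_subset[OF T.enum_reduced[OF ab(1)]]
    by (simp only:) (intro R_sum R_mult R_const R_basis, auto)
qed

end

section \<open>Frobenius series\<close>


text \<open>Coefficients of the series solution starting with \<open>1\<close> at index
  \<open>s\<close>, for exponents 0 and \<open>m + 1\<close>. For \<open>s = 0\<close> the
  denominator vanishes at \<open>n = m + 1\<close>; division by zero then sets this coefficient,
  which is free when the recursion is solvable, to 0.\<close>

function frobenius :: "nat \<Rightarrow> (nat \<Rightarrow> complex) \<Rightarrow> (nat \<Rightarrow> complex) \<Rightarrow> nat \<Rightarrow> nat \<Rightarrow> complex" where
  "frobenius m A B s n = (if n = s then 1 else
     - (\<Sum>l<n. (of_nat l * A (n - l) + B (n - Suc l)) * frobenius m A B s l) /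
       (of_nat n * (of_nat n - 1 - of_nat m)))"
  by pat_completeness auto
termination by (relation "Wellfounded.measure (\<lambda>(m, A, B, s, n). n)") auto

declare frobenius.simps [simp del]

lemma frobenius_denominator:
  assumes "k \<noteq> m"
  shows "of_nat (Suc k) * (of_nat (Suc k) - 1 - of_nat m) \<noteq> (0::complex)"
proof -
  have "of_nat (Suc k) - 1 - of_nat m = (of_nat k - of_nat m :: complex)" by simp
  thus ?thesis using assms of_nat_neq_0[where 'a = complex, of k] by simp
qed

text \<open>The right-hand side of the recursion at index \<open>m + 1\<close>, where the factor of
  the unknown coefficient vanishes. A nonzero value forces a logarithm.\<close>

definition obstruction :: "nat \<Rightarrow> (nat \<Rightarrow> complex) \<Rightarrow> (nat \<Rightarrow> complex) \<Rightarrow> complex" where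
  "obstruction m A B =
     (\<Sum>l<Suc m. (of_nat l * A (Suc m - l) + B (m - l)) * frobenius m A B 0 l)"

text \<open>The equation multiplied by the local coordinate; \<open>A\<close> and \<open>B\<close>
  are the expansions of that coordinate times the coefficients of y' and y.\<close>

definition formal_ode :: "complex fps \<Rightarrow> complex fps \<Rightarrow> complex fps \<Rightarrow> complex fps" where
  "formal_ode A B Y = fps_X * fps_deriv (fps_deriv Y) + A * fps_deriv Y + B * Y"

lemma formal_ode_nth:
  assumes "fps_nth A 0 = - of_nat m"
  shows "fps_nth (formal_ode A B Y) k =
    of_nat (Suc k) * (of_nat (Suc k) - 1 - of_nat m) * fps_nth Y (Suc k) +
    (\<Sum>l<Suc k. (of_nat l * fps_nth A (Suc k - l) + fps_nth B (Suc k - Suc l)) * fps_nth Y l)"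
proof -
  have X: "fps_nth (fps_X * fps_deriv (fps_deriv Y)) k = of_nat (Suc k) * of_nat k * fps_nth Y (Suc k)"
    by (cases k) (simp_all add: algebra_simps)
  have "fps_nth (A * fps_deriv Y) k = (\<Sum>i\<le>k. fps_nth A (k - i) * (of_nat (Suc i) * fps_nth Y (Suc i)))"
    unfolding fps_mult_nth atLeast0AtMost
    by (rule sum.reindex_bij_witness[of _ "\<lambda>i. k - i" "\<lambda>i. k - i"]) auto
  also have "\<dots> = (\<Sum>i\<le>k. fps_nth A (Suc k - Suc i) * (of_nat (Suc i) * fps_nth Y (Suc i)))" by simp
  also have "\<dots> = (\<Sum>i\<le>Suc k. fps_nth A (Suc k - i) * (of_nat i * fps_nth Y i))"
    by (subst sum.atMost_Suc_shift) simp
  also have "\<dots> = (\<Sum>l<Suc k. of_nat l * fps_nth A (Suc k - l) * fps_nth Y l)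
      - of_nat m * of_nat (Suc k) * fps_nth Y (Suc k)"
    by (simp add: assms lessThan_Suc_atMost mult_ac)
  finally have A: "fps_nth (A * fps_deriv Y) k = \<dots>" .
  have B: "fps_nth (B * Y) k = (\<Sum>l<Suc k. fps_nth B (Suc k - Suc l) * fps_nth Y l)"
    unfolding fps_mult_nth atLeast0AtMost lessThan_Suc_atMost
    by (rule sum.reindex_bij_witness[of _ "\<lambda>i. k - i" "\<lambda>i. k - i"]) auto
  show ?thesis
    unfolding formal_ode_def fps_add_nth X A B
    by (simp add: distrib_right sum.distrib) (simp add: algebra_simps)
qed

lemma frobenius_below: "n < s \<Longrightarrow> frobenius m A B s n = 0"
proof (induction n rule: less_induct)
  case (less n)
  have "(\<Sum>l<n. (of_nat l * A (n - l) + B (n - Suc l)) * frobenius m A B s l) = 0"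
    by (rule sum.neutral) (use less in auto)
  thus ?case using less.prems by (subst frobenius.simps) simp
qed

text \<open>The only critical coefficient of the equation is the one at \<open>k = m\<close>, where
  the factor of the new unknown is 0. The remaining sum vanishes there for \<open>s = Suc m\<close>
  because all earlier coefficients do, and for \<open>s = 0\<close> by the hypothesis on the
  obstruction.\<close>

lemma frobenius_formal_ode:
  assumes "fps_nth A 0 = - of_nat m"
    and "s = Suc m \<or> s = 0 \<and> obstruction m (fps_nth A) (fps_nth B) = 0"
  shows "formal_ode A B (Abs_fps (frobenius m (fps_nth A) (fps_nth B) s)) = 0"
proof (rule fps_ext)
  fix k
  let ?y = "frobenius m (fps_nth A) (fps_nth B) s"
  let ?S = "\<Sum>l<Suc k. (of_nat l * fps_nth A (Suc k - l) + fps_nth B (Suc k - Suc l)) * ?y l"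
  have "of_nat (Suc k) * (of_nat (Suc k) - 1 - of_nat m) * ?y (Suc k) + ?S = 0"
  proof (cases "k = m")
    case True
    moreover have "?S = 0"
    proof (cases "s = Suc m")
      case True
      thus ?thesis using \<open>k = m\<close> by (intro sum.neutral) (auto simp: frobenius_below)
    next
      case False
      thus ?thesis using assms(2) \<open>k = m\<close> by (simp add: obstruction_def)
    qed
    ultimately show ?thesis by simp
  next
    case False
    hence ne: "of_nat (Suc k) * (of_nat (Suc k) - 1 - of_nat m) \<noteq> (0::complex)"
      by (rule frobenius_denominator)
    have "Suc k \<noteq> s" using False assms(2) by auto
    hence "?y (Suc k) = - ?S / (of_nat (Suc k) * (of_nat (Suc k) - 1 - of_nat m))"
      by (subst frobenius.simps) simp
    moreover have "d * y + S = 0" if "d \<noteq> 0" "y = - S / d" for d y S :: complex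
      using that by simp
    ultimately show ?thesis using ne by blast
  qed
  thus "fps_nth (formal_ode A B (Abs_fps ?y)) k = fps_nth 0 k"
    unfolding formal_ode_nth[OF assms(1)] by simp
qed

text \<open>For \<open>s = 0\<close> the comparison stops at index \<open>m\<close>, because a
  multiple of the solution of exponent \<open>m + 1\<close> may be added from index
  \<open>m + 1\<close> on.\<close>

lemma formal_solution_unique:
  assumes A0: "fps_nth A 0 = - of_nat m" and Y: "formal_ode A B Y = 0"
    and s: "s = 0 \<or> s = Suc m" "\<And>n. n < s \<Longrightarrow> fps_nth Y n = 0"
    and n: "s = Suc m \<or> n \<le> m"
  shows "fps_nth Y n = fps_nth Y s * frobenius m (fps_nth A) (fps_nth B) s n"
  using n
proof (induction n rule: less_induct)
  case (less n)
  let ?y = "frobenius m (fps_nth A) (fps_nth B) s"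
  consider "n < s" | "n = s" | "n > s" by linarith
  thus ?case
  proof cases
    case 3
    then obtain k where k: "n = Suc k" by (cases n) auto
    have ne: "of_nat (Suc k) * (of_nat (Suc k) - 1 - of_nat m) \<noteq> (0::complex)"
      using 3 less.prems s(1) k by (intro frobenius_denominator) auto
    let ?S = "\<lambda>y. \<Sum>l<Suc k. (of_nat l * fps_nth A (Suc k - l) + fps_nth B (Suc k - Suc l)) * y l"
    have "?S (fps_nth Y) = ?S (\<lambda>l. fps_nth Y s * ?y l)"
      by (intro sum.cong refl arg_cong2[where f = "(*)"] less.IH) (use k less.prems in auto)
    also have "\<dots> = fps_nth Y s * ?S ?y"
      unfolding sum_distrib_left by (intro sum.cong) auto
    finally have "of_nat (Suc k) * (of_nat (Suc k) - 1 - of_nat m) * fps_nth Y (Suc k) = - fps_nth Y s * ?S ?y"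
      using formal_ode_nth[OF A0, of B Y k] Y by (simp add: eq_neg_iff_add_eq_0)
    moreover have "?y (Suc k) = - ?S ?y / (of_nat (Suc k) * (of_nat (Suc k) - 1 - of_nat m))"
      using 3 k by (subst frobenius.simps) simp
    moreover have "Z = c * y" if "d \<noteq> 0" "d * Z = - c * S" "y = - S / d" for d Z c S y :: complex
    proof -
      have "d * y = - S" using that by simp
      hence "d * (c * y) = - c * S" by (simp add: mult.left_commute)
      hence "d * Z = d * (c * y)" using that(2) by simp
      thus ?thesis using that(1) by simp
    qed
    ultimately show ?thesis unfolding k using ne by blast
  next
    case 1
    thus ?thesis using s by (simp add: frobenius_below)
  next
    case 2
    thus ?thesis by (subst frobenius.simps) simp
  qed
qed

lemma fps_nth_bound:
  fixes F :: "complex fps"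
  assumes "fps_conv_radius F > 0"
  shows "\<exists>K r. \<forall>n. norm (fps_nth F n) \<le> K * r ^ n"
proof -
  obtain r where r: "0 < ereal r" "ereal r < fps_conv_radius F" using ereal_dense2[OF assms] by blast
  hence "summable (\<lambda>n. fps_nth F n * of_real r ^ n)" 
    by (intro summable_fps) auto
  hence "Bseq (\<lambda>n. fps_nth F n * of_real r ^ n)"
    using summable_LIMSEQ_zero convergentI convergent_imp_Bseq by blast
  then obtain K where K: "\<And>n. norm (fps_nth F n * of_real r ^ n) \<le> K" by (auto simp: Bseq_def)
  have "norm (fps_nth F n) \<le> K * (1 / r) ^ n" for n
    using K[of n] r by (simp add: norm_mult norm_power field_simps)
  thus ?thesis by blast
qed

lemma fps_conv_radius_pos:
  fixes F :: "complex fps"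
  assumes "\<And>n. norm (fps_nth F n) \<le> C * \<sigma> ^ n" "\<sigma> > 0"
  shows "fps_conv_radius F > 0"
proof -
  let ?z = "of_real (1 / (2 * \<sigma>)) :: complex"
  have "summable (\<lambda>n. fps_nth F n * ?z ^ n)"
  proof (rule summable_comparison_test')
    show "summable (\<lambda>n. C * (1 / 2) ^ n :: real)" by (intro summable_mult summable_geometric) auto
    fix n
    have z: "norm ?z = 1 / (2 * \<sigma>)" using assms(2) by (simp add: norm_divide norm_mult)
    have "norm (fps_nth F n * ?z ^ n) \<le> (C * \<sigma> ^ n) * (1 / (2 * \<sigma>)) ^ n"
      unfolding norm_mult norm_power z using assms by (intro mult_right_mono) auto
    also have "\<dots> = C * (1 / 2) ^ n" using assms(2) by (simp add: power_divide power_mult_distrib)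
    finally show "norm (fps_nth F n * ?z ^ n) \<le> C * (1 / 2) ^ n" .
  qed
  hence "ereal (norm ?z) \<le> fps_conv_radius F" unfolding fps_conv_radius_def by (rule conv_radius_geI)
  moreover have "0 < ereal (norm ?z)" using assms(2) by simp
  ultimately show ?thesis by (metis order.strict_trans2)
qed

text \<open>A majorant argument for regular singular points: the recursion divides by a quantity of
  order \<open>k * k\<close>, which compensates the number of terms and the factor \<open>l\<close>
  coming from y'.\<close>

lemma formal_solution_converges:
  assumes A0: "fps_nth A 0 = - of_nat m" and Y: "formal_ode A B Y = 0"
    and "fps_conv_radius A > 0" "fps_conv_radius B > 0"
  shows "fps_conv_radius Y > 0"
proof -
  obtain K1 r1 where 1: "\<And>n. norm (fps_nth A n) \<le> K1 * r1 ^ n" using fps_nth_bound assms by blast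
  obtain K2 r2 where 2: "\<And>n. norm (fps_nth B n) \<le> K2 * r2 ^ n" using fps_nth_bound assms by blast
  define K where "K = max 1 (\<bar>K1\<bar> + \<bar>K2\<bar>)"
  define \<rho> where "\<rho> = max 1 (\<bar>r1\<bar> + \<bar>r2\<bar>)"
  \<comment> \<open>Each of the \<open>Suc k\<close> terms is at most
    \<open>Suc k * (2 * K) * \<rho> * C * \<sigma> ^ k\<close>, and the divisor is
    \<open>Suc k * (k - m)\<close>. Since \<open>Suc k \<le> (m + 2) * (k - m)\<close> for
    \<open>k \<ge> m + 1\<close>, one step costs at most this factor.\<close>
  define \<sigma> where "\<sigma> = \<rho> * (real (m + 2) * (2 * K))"
  have K: "K \<ge> 1" and \<rho>: "\<rho> \<ge> 1" by (simp_all add: K_def \<rho>_def)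
  have \<sigma>\<rho>: "\<sigma> \<ge> \<rho>"
    unfolding \<sigma>_def using K \<rho> mult_mono[of 1 "real (m + 2)" 1 "2 * K"]
    by (intro mult_right_le_one_le[THEN order_trans] mult_le_cancel_left1[THEN iffD2]) auto
  have bnd: "norm (fps_nth A n) \<le> K * \<rho> ^ n" "norm (fps_nth B n) \<le> K * \<rho> ^ n" for n
  proof -
    have "norm (fps_nth A n) \<le> \<bar>K1\<bar> * \<bar>r1\<bar> ^ n"
      using 1[of n] by (metis abs_ge_self abs_mult order_trans power_abs)
    also have "\<dots> \<le> K * \<rho> ^ n" by (intro mult_mono power_mono) (auto simp: K_def \<rho>_def)
    finally show "norm (fps_nth A n) \<le> K * \<rho> ^ n" .
    have "norm (fps_nth B n) \<le> \<bar>K2\<bar> * \<bar>r2\<bar> ^ n"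
      using 2[of n] by (metis abs_ge_self abs_mult order_trans power_abs)
    also have "\<dots> \<le> K * \<rho> ^ n" by (intro mult_mono power_mono) (auto simp: K_def \<rho>_def)
    finally show "norm (fps_nth B n) \<le> K * \<rho> ^ n" .
  qed
  \<comment> \<open>Up to index \<open>m + 1\<close> the factor \<open>k - m\<close> is negative or
    zero, so these coefficients are bounded outright.\<close>
  define C where "C = (\<Sum>n\<le>Suc m. norm (fps_nth Y n))"
  have C0: "C \<ge> 0" by (simp add: C_def sum_nonneg)
  have \<sigma>1: "\<sigma> \<ge> 1" using \<sigma>\<rho> \<rho> by linarith
  have "norm (fps_nth Y n) \<le> C * \<sigma> ^ n" for n
  proof (induction n rule: less_induct)
    case (less n)
    show ?case
    proof (cases "n \<le> Suc m")
      case True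
      hence "norm (fps_nth Y n) \<le> C" unfolding C_def by (intro member_le_sum) auto
      also have "\<dots> \<le> C * \<sigma> ^ n" using C0 \<sigma>1 by (simp add: mult_le_cancel_left1)
      finally show ?thesis .
    next
      case False
      then obtain k where k: "n = Suc k" "k \<ge> Suc m" by (cases n) auto
      let ?t = "\<lambda>l. (of_nat l * fps_nth A (Suc k - l) + fps_nth B (Suc k - Suc l)) * fps_nth Y l"
      have t: "norm (?t l) \<le> real (Suc k) * (2 * K) * \<rho> * C * \<sigma> ^ k" if l: "l < Suc k" for l
      proof -
        have "norm (of_nat l * fps_nth A (Suc k - l) + fps_nth B (Suc k - Suc l))
            \<le> real l * (K * \<rho> ^ (Suc k - l)) + K * \<rho> ^ (Suc k - Suc l)"
          by (rule norm_triangle_mono) (auto simp: norm_mult bnd intro!: mult_left_mono)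
        also have "\<dots> \<le> real k * (K * \<rho> ^ (Suc k - l)) + K * \<rho> ^ (Suc k - l)"
          using l K \<rho> by (intro add_mono mult_mono power_increasing) auto
        also have "\<dots> = real (Suc k) * K * \<rho> ^ (Suc k - l)" by (simp add: algebra_simps)
        also have "\<dots> \<le> real (Suc k) * (2 * K) * (\<rho> * \<sigma> ^ (k - l))"
        proof (intro mult_mono)
          have "\<rho> ^ (Suc k - l) = \<rho> * \<rho> ^ (k - l)" using l by (simp add: Suc_diff_le)
          also have "\<dots> \<le> \<rho> * \<sigma> ^ (k - l)" using \<rho> \<sigma>\<rho> by (intro mult_left_mono power_mono) auto
          finally show "\<rho> ^ (Suc k - l) \<le> \<rho> * \<sigma> ^ (k - l)" .
        qed (use K \<rho> in auto)
        finally have "norm (?t l) \<le> real (Suc k) * (2 * K) * (\<rho> * \<sigma> ^ (k - l)) * (C * \<sigma> ^ l)"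
          unfolding norm_mult using less.IH[of l] l k K \<rho> \<sigma>1 by (intro mult_mono) auto
        also have "\<dots> = real (Suc k) * (2 * K) * \<rho> * C * (\<sigma> ^ (k - l) * \<sigma> ^ l)" by (simp add: mult_ac)
        also have "\<sigma> ^ (k - l) * \<sigma> ^ l = \<sigma> ^ k" using l by (simp flip: power_add)
        finally show ?thesis .
      qed
      have "of_nat (Suc k) * (of_nat (Suc k) - 1 - of_nat m) * fps_nth Y (Suc k) = - sum ?t {..<Suc k}"
        using formal_ode_nth[OF A0, of B Y k] Y unfolding eq_neg_iff_add_eq_0 by simp
      hence "norm (of_nat (Suc k) * (of_nat (Suc k) - 1 - of_nat m) * fps_nth Y (Suc k)) = norm (sum ?t {..<Suc k})"
        by (simp only: norm_minus_cancel)
      also have "\<dots> \<le> real (Suc k) * (real (Suc k) * (2 * K) * \<rho> * C * \<sigma> ^ k)"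
        using sum_norm_bound[of "{..<Suc k}" ?t, OF t] by simp
      also have "norm (of_nat (Suc k) * (of_nat (Suc k) - 1 - of_nat m) * fps_nth Y (Suc k)) =
          real (Suc k) * (real k - real m) * norm (fps_nth Y n)"
      proof -
        have "of_nat (Suc k) * (of_nat (Suc k) - 1 - of_nat m) = (of_real (real (Suc k) * (real k - real m)) :: complex)"
          by simp
        moreover have "real (Suc k) * (real k - real m) \<ge> 0" using k by auto
        ultimately show ?thesis
          by (simp only: norm_mult[of _ "fps_nth Y (Suc k)"] norm_of_real abs_of_nonneg k(1))
      qed
      finally have "real (Suc k) * ((real k - real m) * norm (fps_nth Y n))
          \<le> real (Suc k) * (real (Suc k) * (2 * K) * \<rho> * C * \<sigma> ^ k)" by (simp add: mult_ac)
      hence "(real k - real m) * norm (fps_nth Y n) \<le> real (Suc k) * (2 * K) * \<rho> * C * \<sigma> ^ k"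
        by (simp only: mult_le_cancel_left_pos of_nat_0_less_iff zero_less_Suc)
      also have "\<dots> = real (Suc k) * ((2 * K) * \<rho> * C * \<sigma> ^ k)" by (simp only: mult.assoc)
      also have "\<dots> \<le> (real (m + 2) * (real k - real m)) * ((2 * K) * \<rho> * C * \<sigma> ^ k)"
      proof (rule mult_right_mono)
        have "real (m + 2) * (real k - real m) = real (Suc k) + (real (m + 1)) * (real k - real (Suc m))"
          by (simp add: algebra_simps)
        moreover have "real (m + 1) * (real k - real (Suc m)) \<ge> 0" using k by (intro mult_nonneg_nonneg) auto
        ultimately show "real (Suc k) \<le> real (m + 2) * (real k - real m)" by linarith
      qed (use K \<rho> C0 \<sigma>1 in auto)
      also have "\<dots> = (real k - real m) * (C * \<sigma> ^ n)" by (simp add: k(1) \<sigma>_def mult_ac)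
      finally show ?thesis using k by (simp add: mult_le_cancel_left)
    qed
  qed
  thus ?thesis using \<sigma>1 by (intro fps_conv_radius_pos[of Y C \<sigma>]) auto
qed

section \<open>Apparent singularities\<close>


definition wronskian :: "(complex \<Rightarrow> complex) \<Rightarrow> (complex \<Rightarrow> complex) \<Rightarrow> complex \<Rightarrow> complex" where
  "wronskian f g z = f z * deriv g z - deriv f z * g z"

text \<open>Abel's identity: the terms with \<open>q\<close> cancel.\<close>

lemma wronskian_deriv:
  assumes "open U" "z \<in> U" "ode_solution p q U f" "ode_solution p q U g"
  shows "(wronskian f g has_field_derivative (- p z * wronskian f g z)) (at z)"
proof -
  have hol: "f holomorphic_on U" "g holomorphic_on U" using assms by (auto simp: ode_solution_def)
  have D: "(h has_field_derivative deriv h z) (at z)"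
    "(deriv h has_field_derivative deriv (deriv h) z) (at z)" if "h holomorphic_on U" for h
    using that assms(1,2) holomorphic_derivI holomorphic_deriv by blast+
  have "deriv (deriv f) z + p z * deriv f z + q z * f z = 0"
    "deriv (deriv g) z + p z * deriv g z + q z * g z = 0"
    using assms by (auto simp: ode_solution_def)
  hence eqs: "deriv (deriv f) z = - (p z * deriv f z + q z * f z)" 
    "deriv (deriv g) z = - (p z * deriv g z + q z * g z)"
    by (simp_all only: eq_neg_iff_add_eq_0 add.assoc)
  have "f z * deriv (deriv g) z + deriv f z * deriv g z - (deriv f z * deriv g z + deriv (deriv f) z * g z)
    = - p z * wronskian f g z"
    unfolding eqs by (simp add: wronskian_def algebra_simps)
  thus ?thesis unfolding wronskian_def[abs_def]
    by (auto intro!: derivative_eq_intros D hol simp: algebra_simps)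
qed

text \<open>By Abel's identity, quotients of Wronskians are constant on a connected domain. Cramer's
  rule then expresses \<open>y\<close> through \<open>u\<close> and \<open>v\<close> with the
  constants W(y,v) / W(u,v) and W(u,y) / W(u,v), without any uniqueness theorem for initial
  values.\<close>

lemma solution_combination:
  assumes U: "open U" "connected U"
    and sol: "ode_solution p q U u" "ode_solution p q U v" "ode_solution p q U y"
    and W: "\<And>z. z \<in> U \<Longrightarrow> wronskian u v z \<noteq> 0"
  shows "\<exists>c d. \<forall>z\<in>U. y z = c * u z + d * v z"
proof -
  have const: "\<exists>c. \<forall>z\<in>U. wronskian f g z = c * wronskian u v z"
    if "ode_solution p q U f" "ode_solution p q U g" for f g
  proof -
    have "((\<lambda>z. wronskian f g z / wronskian u v z) has_field_derivative 0) (at z)" if z: "z \<in> U" for z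
      using wronskian_deriv[OF U(1) z \<open>ode_solution p q U f\<close> \<open>ode_solution p q U g\<close>]
        wronskian_deriv[OF U(1) z sol(1,2)] W[OF z]
      by (auto intro!: derivative_eq_intros)
    hence "(\<lambda>z. wronskian f g z / wronskian u v z) constant_on U"
      using U by (intro has_field_derivative_0_imp_constant_on) auto
    then obtain c where "\<And>z. z \<in> U \<Longrightarrow> wronskian f g z / wronskian u v z = c"
      by (auto simp: constant_on_def)
    thus ?thesis using W by (intro exI[of _ c]) (auto simp: field_simps)
  qed
  obtain c d where "\<And>z. z \<in> U \<Longrightarrow> wronskian y v z = c * wronskian u v z"
    "\<And>z. z \<in> U \<Longrightarrow> wronskian u y z = d * wronskian u v z"
    using const[OF sol(3,2)] const[OF sol(1,3)] by blast
  moreover have "y z * wronskian u v z = wronskian y v z * u z + wronskian u y z * v z" for z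
    by (simp add: wronskian_def algebra_simps)
  ultimately have "y z * wronskian u v z = (c * u z + d * v z) * wronskian u v z" if "z \<in> U" for z
    using that by (simp add: algebra_simps)
  thus ?thesis using W by auto
qed

definition series :: "complex \<Rightarrow> complex fps \<Rightarrow> complex \<Rightarrow> complex" where
  "series a Y z = eval_fps Y (z - a)"

lemma series_has_deriv:
  assumes "ereal r \<le> fps_conv_radius Y" "z \<in> ball a r"
  shows "(series a Y has_field_derivative series a (fps_deriv Y) z) (at z)"
proof -
  have "norm (z - a) < r" using assms(2) by (simp add: dist_norm norm_minus_commute)
  hence "ereal (norm (z - a)) < fps_conv_radius Y" using assms(1) by (meson ereal_less_eq(3) less_le_not_le less_ereal.simps(1) order.strict_trans2)
  hence "((\<lambda>z. eval_fps Y (z - a)) has_field_derivative eval_fps (fps_deriv Y) (z - a) * 1) (at z)"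
    by (intro DERIV_chain2[where f = "eval_fps Y"] has_field_derivative_eval_fps)
      (auto intro!: derivative_eq_intros)
  thus ?thesis by (simp add: series_def[abs_def])
qed

lemma series_holomorphic: "ereal r \<le> fps_conv_radius Y \<Longrightarrow> series a Y holomorphic_on ball a r"
  using series_has_deriv by (metis holomorphic_onI field_differentiable_at_within field_differentiable_def)

lemma deriv_series: "ereal r \<le> fps_conv_radius Y \<Longrightarrow> z \<in> ball a r \<Longrightarrow> deriv (series a Y) z = series a (fps_deriv Y) z"
  by (rule DERIV_imp_deriv[OF series_has_deriv])

lemma deriv_deriv_series:
  assumes "ereal r \<le> fps_conv_radius Y" "z \<in> ball a r"
  shows "deriv (deriv (series a Y)) z = series a (fps_deriv (fps_deriv Y)) z"
proof -
  have r': "ereal r \<le> fps_conv_radius (fps_deriv Y)" using assms(1) fps_conv_radius_deriv order_trans by blast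
  have "deriv (deriv (series a Y)) z = deriv (series a (fps_deriv Y)) z"
    using assms by (intro deriv_cong_ev refl eventually_nhds_in_open[of "ball a r" z, THEN eventually_mono])
      (auto simp: deriv_series)
  thus ?thesis using deriv_series[OF r' assms(2)] by simp
qed

lemma series_laurent:
  assumes "fps_conv_radius Y > 0"
  shows "(\<lambda>w. series a Y (a + w)) has_laurent_expansion fps_to_fls Y"
  using has_laurent_expansion_fps[OF eval_fps_has_fps_expansion[OF assms]] by (simp add: series_def)

lemma series_eventually_nonzero:
  assumes "fps_conv_radius Y > 0" "Y \<noteq> 0"
  shows "eventually (\<lambda>z. series a Y z \<noteq> 0) (at a)"
  using has_laurent_expansion_eventually_nonzero_iff[OF series_laurent[OF assms(1), of a]] assms(2) by simp

text \<open>Both coefficients have at most a simple pole at \<open>a\<close>. The residue of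
  \<open>p\<close> is \<open>- m\<close>, which makes the exponents 0 and
  \<open>m + 1\<close>.\<close>

locale regular_singular_point =
  fixes p q :: "complex \<Rightarrow> complex" and a :: complex and m :: nat and A B :: "complex fps" and r0 :: real
  assumes r0: "r0 > 0" "ereal r0 \<le> fps_conv_radius A" "ereal r0 \<le> fps_conv_radius B"
    and A0: "fps_nth A 0 = - of_nat m"
    and p_eq: "\<And>z. z \<in> ball a r0 - {a} \<Longrightarrow> p z = series a A z / (z - a)"
    and q_eq: "\<And>z. z \<in> ball a r0 - {a} \<Longrightarrow> q z = series a B z / (z - a)"
begin

lemma conv_radius_pos: "fps_conv_radius A > 0" "fps_conv_radius B > 0"
  using r0 by (metis ereal_less(2) order.strict_trans2)+

lemma coefficients_holomorphic: "p holomorphic_on ball a r0 - {a}" "q holomorphic_on ball a r0 - {a}"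
proof -
  have hol: "(\<lambda>z. series a F z / (z - a)) holomorphic_on ball a r0 - {a}" if "ereal r0 \<le> fps_conv_radius F" for F
    by (intro holomorphic_intros holomorphic_on_subset[OF series_holomorphic[OF that]]) auto
  show "p holomorphic_on ball a r0 - {a}"
    by (rule holomorphic_transform[OF hol[OF r0(2)]]) (simp add: p_eq)
  show "q holomorphic_on ball a r0 - {a}"
    by (rule holomorphic_transform[OF hol[OF r0(3)]]) (simp add: q_eq)
qed

lemma isolated: "isolated_singularity_at p a" "isolated_singularity_at q a"
  unfolding isolated_singularity_at_def using coefficients_holomorphic r0(1)
  by (auto simp: analytic_on_open open_Diff)

lemma series_solution:
  assumes Y: "formal_ode A B Y = 0"
  shows "\<exists>r>0. r \<le> r0 \<and> ereal r \<le> fps_conv_radius Y \<and> ode_solution p q (ball a r - {a}) (series a Y)"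
proof -
  have "0 < fps_conv_radius Y"
    using formal_solution_converges[OF A0 Y] conv_radius_pos by blast
  then obtain r1 where r1: "0 < ereal r1" "ereal r1 < fps_conv_radius Y" using ereal_dense2 by blast
  define r where "r = min r0 r1"
  have r: "r > 0" "r \<le> r0" "ereal r \<le> fps_conv_radius Y" "ereal r \<le> fps_conv_radius A" "ereal r \<le> fps_conv_radius B"
    using r0 r1 order_trans[of "ereal r" "ereal r0"] order_trans[of "ereal r" "ereal r1"]
    by (auto simp: r_def)
  have "deriv (deriv (series a Y)) z + p z * deriv (series a Y) z + q z * series a Y z = 0"
    if z: "z \<in> ball a r - {a}" for z
  proof -
    have ne: "z \<noteq> a" using z by auto
    have "norm (z - a) < r" using z by (simp add: dist_norm norm_minus_commute)
    hence lt: "ereal (norm (z - a)) < ereal r" by simp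
    note R = order.strict_trans2[OF lt r(3)] order.strict_trans2[OF lt r(4)] order.strict_trans2[OF lt r(5)]
    have R1: "ereal (norm (z - a)) < fps_conv_radius (fps_deriv Y)"
      using R(1) fps_conv_radius_deriv order.strict_trans2 by blast
    have R2: "ereal (norm (z - a)) < fps_conv_radius (fps_deriv (fps_deriv Y))"
      using R1 fps_conv_radius_deriv order.strict_trans2 by blast
    have RM: "ereal (norm (z - a)) < fps_conv_radius (F * G)"
      if "ereal (norm (z - a)) < fps_conv_radius F" "ereal (norm (z - a)) < fps_conv_radius G" for F G
      using that fps_conv_radius_mult[of F G] by (metis min_less_iff_conj order.strict_trans2)
    have RA: "ereal (norm (z - a)) < fps_conv_radius (F + G)"
      if "ereal (norm (z - a)) < fps_conv_radius F" "ereal (norm (z - a)) < fps_conv_radius G" for F G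
      using that fps_conv_radius_add[of F G] by (metis min_less_iff_conj order.strict_trans2)
    have "0 = eval_fps (formal_ode A B Y) (z - a)" by (simp add: Y)
    also have "\<dots> = (z - a) * eval_fps (fps_deriv (fps_deriv Y)) (z - a)
       + eval_fps A (z - a) * eval_fps (fps_deriv Y) (z - a) + eval_fps B (z - a) * eval_fps Y (z - a)"
      unfolding formal_ode_def using R R1 R2
      by (simp add: eval_fps_add eval_fps_mult RM RA)
    finally have *: "(z - a) * deriv (deriv (series a Y)) z
       + series a A z * deriv (series a Y) z + series a B z * series a Y z = 0"
      using z r by (simp add: deriv_series deriv_deriv_series series_def)
    have "z \<in> ball a r0 - {a}" using z r by auto
    hence "(z - a) * (deriv (deriv (series a Y)) z + p z * deriv (series a Y) z + q z * series a Y z) = 0"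
      using * ne by (simp add: p_eq q_eq distrib_left)
    thus ?thesis using ne by simp
  qed
  moreover have "series a Y holomorphic_on ball a r - {a}"
    using series_holomorphic[OF r(3)] holomorphic_on_subset by blast
  ultimately show ?thesis using r unfolding ode_solution_def by blast
qed

definition Frob :: "nat \<Rightarrow> complex fps" where
  "Frob s = Abs_fps (frobenius m (fps_nth A) (fps_nth B) s)"

lemma Frob_nth: "n < s \<Longrightarrow> fps_nth (Frob s) n = 0" and Frob_nth_self: "fps_nth (Frob s) s = 1"
  by (simp add: Frob_def frobenius_below) (simp add: Frob_def frobenius.simps[of _ _ _ _ s])

text \<open>With a vanishing obstruction both Frobenius series are holomorphic solutions at
  \<open>a\<close>, and near \<open>a\<close> they span all branches. Every ratio is thus a quotient
  of two holomorphic functions on the full disc.\<close>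

lemma apparent_if:
  assumes obs: "obstruction m (fps_nth A) (fps_nth B) = 0"
  shows "apparent_singularity p q a"
proof -
  define u where "u = series a (Frob 0)"
  define v where "v = series a (Frob (Suc m))"
  have formal: "formal_ode A B (Frob 0) = 0" "formal_ode A B (Frob (Suc m)) = 0"
    unfolding Frob_def using obs by (intro frobenius_formal_ode[OF A0]; simp)+
  obtain r1 where r1: "r1 > 0" "r1 \<le> r0" "ereal r1 \<le> fps_conv_radius (Frob 0)" "ode_solution p q (ball a r1 - {a}) u"
    using series_solution[OF formal(1)] u_def by blast
  obtain r2 where r2: "r2 > 0" "r2 \<le> r0" "ereal r2 \<le> fps_conv_radius (Frob (Suc m))" "ode_solution p q (ball a r2 - {a}) v"
    using series_solution[OF formal(2)] v_def by blast
  \<comment> \<open>The formal Wronskian. Its coefficient at index \<open>m\<close> is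
    \<open>m + 1\<close>, so it is a nonzero series and has no zero in a small punctured
    disc.\<close>
  define F where "F = Frob 0 * fps_deriv (Frob (Suc m)) - fps_deriv (Frob 0) * Frob (Suc m)"
  have "fps_nth (Frob 0 * fps_deriv (Frob (Suc m))) m = (\<Sum>i\<in>{0}. fps_nth (Frob 0) i * fps_nth (fps_deriv (Frob (Suc m))) (m - i))"
    unfolding fps_mult_nth by (rule sum.mono_neutral_right) (auto simp: Frob_nth)
  moreover have "fps_nth (fps_deriv (Frob 0) * Frob (Suc m)) m = 0"
    unfolding fps_mult_nth by (rule sum.neutral) (auto simp: Frob_nth)
  ultimately have "fps_nth F m = of_nat (Suc m)"
    by (simp add: F_def Frob_nth_self del: of_nat_Suc)
  hence F0: "F \<noteq> 0" by (metis fps_zero_nth of_nat_neq_0)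
  define r12 where "r12 = min r1 r2"
  have W: "wronskian u v z = series a F z" if z: "z \<in> ball a r12" for z
  proof -
    have "norm (z - a) < r12" using z by (simp add: dist_norm norm_minus_commute)
    hence "ereal (norm (z - a)) < ereal r1" "ereal (norm (z - a)) < ereal r2" by (auto simp: r12_def)
    hence R: "ereal (norm (z - a)) < fps_conv_radius (Frob 0)" "ereal (norm (z - a)) < fps_conv_radius (Frob (Suc m))"
      using r1 r2 order.strict_trans2 by blast+
    have R': "ereal (norm (z - a)) < fps_conv_radius (fps_deriv (Frob 0))"
       "ereal (norm (z - a)) < fps_conv_radius (fps_deriv (Frob (Suc m)))"
      using R fps_conv_radius_deriv order.strict_trans2 by blast+
    have RM: "ereal (norm (z - a)) < fps_conv_radius (F * G)"
      if "ereal (norm (z - a)) < fps_conv_radius F" "ereal (norm (z - a)) < fps_conv_radius G" for F G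
      using that fps_conv_radius_mult[of F G] by (metis min_less_iff_conj order.strict_trans2)
    have z12: "z \<in> ball a r1" "z \<in> ball a r2" using z by (auto simp: r12_def)
    show ?thesis
      unfolding wronskian_def u_def v_def deriv_series[OF r1(3) z12(1)] deriv_series[OF r2(3) z12(2)]
      using R R' by (simp add: F_def series_def eval_fps_diff eval_fps_mult RM)
  qed
  have "0 < fps_conv_radius (Frob 0)" "0 < fps_conv_radius (Frob (Suc m))"
    using formal_solution_converges[OF A0] formal conv_radius_pos by blast+
  hence "0 < fps_conv_radius (fps_deriv (Frob 0))" "0 < fps_conv_radius (fps_deriv (Frob (Suc m)))"
    using fps_conv_radius_deriv order.strict_trans2 by blast+
  hence "0 < fps_conv_radius F"
    using \<open>0 < fps_conv_radius (Frob 0)\<close> \<open>0 < fps_conv_radius (Frob (Suc m))\<close>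
    unfolding F_def by (metis fps_conv_radius_diff fps_conv_radius_mult min_less_iff_conj order.strict_trans2)
  then obtain r3 where r3: "r3 > 0" "\<And>z. z \<noteq> a \<Longrightarrow> dist z a < r3 \<Longrightarrow> series a F z \<noteq> 0"
    using series_eventually_nonzero[OF _ F0, of a] unfolding eventually_at by auto
  define r where "r = min r12 r3"
  have r: "r > 0" "r \<le> r1" "r \<le> r2" using r1 r2 r3 by (auto simp: r_def r12_def)
  have hol: "u holomorphic_on ball a r" "v holomorphic_on ball a r"
    unfolding u_def v_def using r r1(3) r2(3)
    by (auto intro!: series_holomorphic intro: order_trans[OF _ r1(3)] order_trans[OF _ r2(3)])
  show ?thesis unfolding apparent_singularity_def
  proof (intro conjI isolated exI[of _ r] allI impI)
    fix U y1 y2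
    assume *: "open U \<and> connected U \<and> U \<noteq> {} \<and> U \<subseteq> ball a r - {a} \<and>
       ode_solution p q U y1 \<and> ode_solution p q U y2 \<and> lin_indep_on U y1 y2"
    have sub: "U \<subseteq> ball a r1 - {a}" "U \<subseteq> ball a r2 - {a}" using * r by auto
    have sol: "ode_solution p q U u" "ode_solution p q U v"
      using r1(4) r2(4) sub unfolding ode_solution_def by (meson holomorphic_on_subset subsetD)+
    have nz: "wronskian u v z \<noteq> 0" if "z \<in> U" for z
    proof -
      have "z \<in> ball a r12" "z \<noteq> a" "dist z a < r3" using that * by (auto simp: r_def dist_commute)
      thus ?thesis using W r3(2) by simp
    qed
    obtain c1 d1 where 1: "\<And>z. z \<in> U \<Longrightarrow> y1 z = c1 * u z + d1 * v z"
      using solution_combination[OF _ _ sol, of y1] * nz by metis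
    obtain c2 d2 where 2: "\<And>z. z \<in> U \<Longrightarrow> y2 z = c2 * u z + d2 * v z"
      using solution_combination[OF _ _ sol, of y2] * nz by metis
    have "(\<lambda>z. (c1 * u z + d1 * v z) / (c2 * u z + d2 * v z)) meromorphic_on ball a r"
      by (intro meromorphic_intros analytic_on_imp_meromorphic_on) (use hol in \<open>simp_all add: analytic_on_open\<close>)
    thus "\<exists>f. f meromorphic_on ball a r \<and> (\<forall>z\<in>U. y2 z \<noteq> 0 \<longrightarrow> f z = y1 z / y2 z)"
      using 1 2 by (intro exI[of _ "\<lambda>z. (c1 * u z + d1 * v z) / (c2 * u z + d2 * v z)"]) auto
  qed (use r in auto)
qed

end


section \<open>Meromorphic ratios force the obstruction to vanish\<close>

lemma fls_times_lowest:
  fixes f g :: "complex fls"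
  assumes "\<And>i. i < a \<Longrightarrow> fls_nth f i = 0" "\<And>i. i < b \<Longrightarrow> fls_nth g i = 0"
  shows "fls_nth (f * g) (a + b) = fls_nth f a * fls_nth g b"
proof -
  let ?S = "{fls_subdegree f..a + b - fls_subdegree g}"
  have "fls_nth (f * g) (a + b) = (\<Sum>i\<in>?S. fls_nth f i * fls_nth g (a + b - i))"
    by (rule fls_times_nth(2))
  also have "\<dots> = (\<Sum>i\<in>?S. if i = a then fls_nth f a * fls_nth g b else 0)"
  proof (rule sum.cong)
    fix i show "fls_nth f i * fls_nth g (a + b - i) = (if i = a then fls_nth f a * fls_nth g b else 0)"
      using assms(1)[of i] assms(2)[of "a + b - i"] by (cases i a rule: linorder_cases) auto
  qed simp
  also have "\<dots> = fls_nth f a * fls_nth g b"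
    by (subst sum.delta) (auto simp: not_le)
  finally show ?thesis .
qed

text \<open>The lowest coefficient of the equation is the indicial polynomial
  \<open>s * (s - 1 - m)\<close> at the order \<open>s\<close> of \<open>V\<close>. Hence
  \<open>V\<close> has no polar part, and its order is 0 or \<open>m + 1\<close>.\<close>

lemma formal_ode_laurent:
  assumes A0: "fps_nth A 0 = - of_nat m" and V0: "V \<noteq> 0"
    and V: "fls_X * fls_deriv (fls_deriv V) + fps_to_fls A * fls_deriv V + fps_to_fls B * V = 0"
  shows "\<exists>Y. V = fps_to_fls Y \<and> formal_ode A B Y = 0 \<and>
           (fps_nth Y 0 \<noteq> 0 \<or> (\<forall>n<Suc m. fps_nth Y n = 0))"
proof -
  define s where "s = fls_subdegree V"
  have vs: "fls_nth V s \<noteq> 0" using V0 by (simp add: s_def)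
  have below: "fls_nth V i = 0" if "i < s" for i using that by (simp add: s_def)
  have "fls_nth (fls_X * fls_deriv (fls_deriv V)) (s - 1) = of_int (s - 1) * (of_int s * fls_nth V s)"
    by (simp add: fls_X_times_conv_shift)
  moreover have "fls_nth (fps_to_fls A * fls_deriv V) (0 + (s - 1)) = fls_nth (fps_to_fls A) 0 * fls_nth (fls_deriv V) (s - 1)"
    by (rule fls_times_lowest) (auto simp: below)
  moreover have "fls_nth (fps_to_fls B * V) (0 + (s - 1)) = fls_nth (fps_to_fls B) 0 * fls_nth V (s - 1)"
    by (rule fls_times_lowest) (auto simp: below)
  ultimately have "of_int (s - 1) * (of_int s * fls_nth V s) - of_nat m * (of_int s * fls_nth V s) = 0"
    using arg_cong[OF V, of "\<lambda>F. fls_nth F (s - 1)"] below[of "s - 1"] by (simp add: A0)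
  hence "(of_int (s * (s - 1 - int m)) :: complex) * fls_nth V s = 0" by (simp add: algebra_simps)
  hence "(of_int (s * (s - 1 - int m)) :: complex) = 0" using vs by simp
  hence "s * (s - 1 - int m) = 0" by (simp only: of_int_eq_0_iff)
  hence s: "s = 0 \<or> s = int (Suc m)" by auto
  define Y where "Y = fls_regpart V"
  have VY: "V = fps_to_fls Y" using s by (auto simp: Y_def s_def)
  have "fps_to_fls (formal_ode A B Y) = 0"
    using V unfolding VY fls_deriv_fps_to_fls fps_X_to_fls[symmetric] fls_times_fps_to_fls[symmetric]
      fps_to_fls_plus[symmetric] formal_ode_def .
  hence "formal_ode A B Y = 0" by simp
  moreover have "fps_nth Y 0 \<noteq> 0 \<or> (\<forall>n<Suc m. fps_nth Y n = 0)"
    using s vs below by (auto simp: Y_def)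
  ultimately show ?thesis using VY by blast
qed

text \<open>At index \<open>m\<close> of the equation the coefficient \<open>m + 1\<close> of
  \<open>Y\<close> drops out; what remains is the obstruction times the nonzero constant term of
  \<open>Y\<close>.\<close>

lemma obstruction_zero_if_regular_solution:
  assumes A0: "fps_nth A 0 = - of_nat m" and Y: "formal_ode A B Y = 0" and Y0: "fps_nth Y 0 \<noteq> 0"
  shows "obstruction m (fps_nth A) (fps_nth B) = 0"
proof -
  let ?y = "frobenius m (fps_nth A) (fps_nth B) 0"
  have y: "fps_nth Y n = fps_nth Y 0 * ?y n" if "n \<le> m" for n
    using that by (intro formal_solution_unique[OF A0 Y]) auto
  have "0 = (\<Sum>l<Suc m. (of_nat l * fps_nth A (Suc m - l) + fps_nth B (Suc m - Suc l)) * fps_nth Y l)"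
    using formal_ode_nth[OF A0, of B Y m] Y by simp
  also have "\<dots> = (\<Sum>l<Suc m. (of_nat l * fps_nth A (Suc m - l) + fps_nth B (Suc m - Suc l)) * (fps_nth Y 0 * ?y l))"
    by (intro sum.cong refl arg_cong2[where f = "(*)"] y) auto
  also have "\<dots> = fps_nth Y 0 * obstruction m (fps_nth A) (fps_nth B)"
    unfolding obstruction_def sum_distrib_left by (intro sum.cong) auto
  finally show ?thesis using Y0 by simp
qed

lemma deriv_translate: "deriv (\<lambda>w. f (a + w)) = (\<lambda>w. deriv f (a + w :: complex))"
  unfolding deriv_def using DERIV_shift[of f _ _ a] by (simp add: fun_eq_iff add.commute)

context regular_singular_point begin

text \<open>On a disc beside \<open>a\<close>, reduction of order supplies a second solution
  \<open>v = u * G\<close>, where \<open>u\<close> is the Frobenius solution of exponent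
  \<open>m + 1\<close>. The meromorphic extension \<open>f\<close> of \<open>G\<close> makes
  \<open>u * f\<close> a Laurent series solution at \<open>a\<close>. If its order were not 0, it
  would be a multiple of \<open>u\<close> and \<open>G\<close> would be constant; order 0 means a
  vanishing obstruction.\<close>

lemma apparent_only_if:
  assumes app: "apparent_singularity p q a"
  shows "obstruction m (fps_nth A) (fps_nth B) = 0"
proof -
  obtain r where r: "r > 0" and R: "\<forall>U y1 y2. open U \<and> connected U \<and> U \<noteq> {} \<and> U \<subseteq> ball a r - {a} \<and>
        ode_solution p q U y1 \<and> ode_solution p q U y2 \<and> lin_indep_on U y1 y2 \<longrightarrow>
        (\<exists>f. f meromorphic_on ball a r \<and> (\<forall>z\<in>U. y2 z \<noteq> 0 \<longrightarrow> f z = y1 z / y2 z))"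
    using app unfolding apparent_singularity_def by (elim conjE exE)
  define u where "u = series a (Frob (Suc m))"
  have formal: "formal_ode A B (Frob (Suc m)) = 0"
    unfolding Frob_def by (intro frobenius_formal_ode[OF A0]) simp
  have radius: "0 < fps_conv_radius (Frob (Suc m))"
    by (rule formal_solution_converges[OF A0 formal conv_radius_pos])
  obtain r1 where r1: "r1 > 0" "r1 \<le> r0" "ereal r1 \<le> fps_conv_radius (Frob (Suc m))"
      and sol1: "ode_solution p q (ball a r1 - {a}) u"
    using series_solution[OF formal] u_def by blast
  have "Frob (Suc m) \<noteq> 0" using Frob_nth_self[of "Suc m"] by auto
  then obtain r2 where r2: "r2 > 0" "\<And>z. z \<noteq> a \<Longrightarrow> dist z a < r2 \<Longrightarrow> u z \<noteq> 0"
    using series_eventually_nonzero[OF radius, of a] unfolding eventually_at u_def by auto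
  define \<rho> where "\<rho> = min r (min r1 r2)"
  have \<rho>: "\<rho> > 0" "\<rho> \<le> r" "\<rho> \<le> r0" "\<rho> \<le> r1" "\<rho> \<le> r2" using r r1 r2 by (auto simp: \<rho>_def)
  \<comment> \<open>The disc around \<open>b\<close> of radius \<open>\<rho> / 2\<close> has
    \<open>a\<close> on its boundary. It lies in the punctured disc and is convex, so holomorphic
    functions on it have primitives.\<close>
  define b where "b = a + of_real (\<rho> / 2)"
  define U where "U = ball b (\<rho> / 2)"
  have ab: "dist a b = \<rho> / 2" using \<rho> by (simp add: b_def dist_norm)
  have U_sub: "U \<subseteq> ball a \<rho> - {a}"
  proof
    fix z assume z: "z \<in> U"
    hence bz: "dist b z < \<rho> / 2" by (simp add: U_def)
    have "dist a z < \<rho>" using dist_triangle[of a z b] ab bz by linarith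
    moreover have "z \<noteq> a" using ab bz dist_commute[of a b] by auto
    ultimately show "z \<in> ball a \<rho> - {a}" by simp
  qed
  have U: "open U" "connected U" "convex U" "U \<noteq> {}" "b \<in> U" using \<rho> by (auto simp: U_def)
  have unz: "u z \<noteq> 0" if "z \<in> U" for z
    using U_sub that \<rho> by (intro r2) (auto simp: dist_commute)
  have solU: "ode_solution p q U u"
  proof -
    have "U \<subseteq> ball a r1 - {a}" using U_sub \<rho> by auto
    thus ?thesis using sol1 unfolding ode_solution_def by (meson holomorphic_on_subset subsetD)
  qed
  have u_hol: "u holomorphic_on U" using solU by (simp add: ode_solution_def)
  have "p holomorphic_on U"
    using coefficients_holomorphic(1) U_sub \<rho> by (elim holomorphic_on_subset) auto
  then obtain P where P: "\<And>z. z \<in> U \<Longrightarrow> (P has_field_derivative p z) (at z within U)"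
    using holomorphic_convex_primitive'[OF U(3,1)] by blast
  have P': "(P has_field_derivative p z) (at z)" if "z \<in> U" for z
    using P[OF that] at_within_open[OF that U(1)] by simp
  \<comment> \<open>Reduction of order: the derivative of \<open>v / u\<close> is the Wronskian
    divided by \<open>u ^ 2\<close>, and by Abel's identity \<open>exp (- P)\<close> is an
    admissible Wronskian.\<close>
  define g where "g = (\<lambda>z. exp (- P z) / u z ^ 2)"
  have P_hol: "P holomorphic_on U" using P' by (auto simp: holomorphic_on_open[OF U(1)])
  have "g holomorphic_on U" unfolding g_def by (intro holomorphic_intros P_hol u_hol) (use unz in auto)
  then obtain G where G: "\<And>z. z \<in> U \<Longrightarrow> (G has_field_derivative g z) (at z within U)"
    using holomorphic_convex_primitive'[OF U(3,1)] by blast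
  have G': "(G has_field_derivative g z) (at z)" if "z \<in> U" for z
    using G[OF that] at_within_open[OF that U(1)] by simp
  have gnz: "g z \<noteq> 0" if "z \<in> U" for z using unz that by (simp add: g_def)
  have G_hol: "G holomorphic_on U" using G' by (auto simp: holomorphic_on_open[OF U(1)])
  define v where "v = (\<lambda>z. u z * G z)"
  have Du: "(u has_field_derivative deriv u z) (at z)" "(deriv u has_field_derivative deriv (deriv u) z) (at z)"
    if "z \<in> U" for z
    using that u_hol U(1) holomorphic_derivI holomorphic_deriv by blast+
  have dv: "deriv v z = deriv u z * G z + exp (- P z) / u z" if z: "z \<in> U" for z
  proof -
    have "(v has_field_derivative (deriv u z * G z + exp (- P z) / u z)) (at z)"
      unfolding v_def using unz[OF z]
      by (auto intro!: derivative_eq_intros Du[OF z] G'[OF z] simp: g_def power2_eq_square)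
    thus ?thesis by (rule DERIV_imp_deriv)
  qed
  have ddv: "deriv (deriv v) z = deriv (deriv u) z * G z - p z * exp (- P z) / u z" if z: "z \<in> U" for z
  proof -
    have "deriv (deriv v) z = deriv (\<lambda>z. deriv u z * G z + exp (- P z) / u z) z"
      using z U(1) by (intro deriv_cong_ev refl eventually_nhds_in_open[THEN eventually_mono]) (auto simp: dv)
    moreover have "((\<lambda>z. deriv u z * G z + exp (- P z) / u z) has_field_derivative
        (deriv (deriv u) z * G z - p z * exp (- P z) / u z)) (at z)"
      using unz[OF z]
      by (auto intro!: derivative_eq_intros Du[OF z] G'[OF z] P'[OF z] simp: g_def power2_eq_square field_simps)
    ultimately show ?thesis by (simp add: DERIV_imp_deriv)
  qed
  have solv: "ode_solution p q U v"
    unfolding ode_solution_def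
  proof (intro conjI ballI)
    show "v holomorphic_on U" unfolding v_def by (intro holomorphic_intros u_hol G_hol)
    fix z assume z: "z \<in> U"
    have "deriv (deriv u) z + p z * deriv u z + q z * u z = 0" using solU z by (simp add: ode_solution_def)
    moreover have "deriv (deriv v) z + p z * deriv v z + q z * v z =
        (deriv (deriv u) z + p z * deriv u z + q z * u z) * G z"
      unfolding ddv[OF z] dv[OF z] by (simp add: v_def algebra_simps)
    ultimately show "deriv (deriv v) z + p z * deriv v z + q z * v z = 0" by simp
  qed
  have indep: "lin_indep_on U v u"
    unfolding lin_indep_on_def
  proof (intro allI impI)
    fix c1 c2 assume *: "\<forall>z\<in>U. c1 * v z + c2 * u z = 0"
    have eq: "c1 * G z + c2 = 0" if "z \<in> U" for z
    proof -
      have "u z * (c1 * G z + c2) = 0" using * that by (simp add: v_def algebra_simps)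
      thus ?thesis using unz[OF that] by simp
    qed
    have "((\<lambda>z. c1 * G z + c2) has_field_derivative c1 * g b) (at b)"
      by (auto intro!: derivative_eq_intros G'[OF U(5)])
    moreover have "((\<lambda>z. c1 * G z + c2) has_field_derivative 0) (at b)"
      by (rule has_field_derivative_transform_within_open[of "\<lambda>_. 0" _ _ U]) (use U eq in auto)
    ultimately have "c1 * g b = 0" using DERIV_unique by blast
    hence "c1 = 0" using gnz[OF U(5)] by simp
    thus "c1 = 0 \<and> c2 = 0" using eq[OF U(5)] by simp
  qed
  obtain f where f: "f meromorphic_on ball a r" "\<And>z. z \<in> U \<Longrightarrow> f z = G z"
  proof -
    have "U \<subseteq> ball a r - {a}" using U_sub \<rho> by auto
    then obtain f where "f meromorphic_on ball a r" "\<forall>z\<in>U. u z \<noteq> 0 \<longrightarrow> f z = v z / u z"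
      using R[rule_format, of U v u] U solv solU indep by auto
    thus ?thesis using unz by (intro that[of f]) (auto simp: v_def)
  qed
  have f_mer: "f meromorphic_on ball a \<rho>" using f(1) \<rho> by (elim meromorphic_on_subset) auto
  define h where "h = (\<lambda>z. u z * f z)"
  have hv: "h z = v z" if "z \<in> U" for z using that f(2) by (simp add: h_def v_def)
  have ser_mer: "series a F meromorphic_on ball a \<rho>" if "ereal \<rho> \<le> fps_conv_radius F" for F
    using series_holomorphic[OF that] by (intro analytic_on_imp_meromorphic_on) (simp add: analytic_on_open)
  have rad: "ereal \<rho> \<le> fps_conv_radius A" "ereal \<rho> \<le> fps_conv_radius B" "ereal \<rho> \<le> fps_conv_radius (Frob (Suc m))"
    using \<rho> r0 r1 by (auto intro: order_trans[OF _ r0(2)] order_trans[OF _ r0(3)] order_trans[OF _ r1(3)])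
  have h_mer: "h meromorphic_on ball a \<rho>"
    unfolding h_def using f_mer ser_mer[OF rad(3)] by (auto simp: u_def intro: meromorphic_intros)
  \<comment> \<open>The left-hand side of the equation for \<open>h\<close>, multiplied by
    \<open>z - a\<close>. It vanishes on \<open>U\<close>, and the identity theorem for meromorphic
    functions carries this to a punctured neighbourhood of \<open>a\<close>.\<close>
  define E where "E = (\<lambda>z. (z - a) * deriv (deriv h) z + series a A z * deriv h z + series a B z * h z)"
  have "E meromorphic_on ball a \<rho>"
    unfolding E_def by (intro meromorphic_intros h_mer ser_mer rad)
  hence "eventually (\<lambda>z. E z = 0) (cosparse (ball a \<rho>)) \<or> eventually (\<lambda>z. E z \<noteq> 0) (cosparse (ball a \<rho>))"
    by (rule meromorphic_imp_constant_or_avoid) auto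
  moreover have b_ball: "b \<in> ball a \<rho>" using U_sub U by auto
  have evU: "eventually (\<lambda>z. z \<in> U) (at b)" using U by (intro eventually_at_in_open') auto
  have E0: "E z = 0" if z: "z \<in> U" for z
  proof -
    have dh: "deriv h w = deriv v w" if "w \<in> U" for w
      using that U(1) by (intro deriv_cong_ev refl eventually_nhds_in_open[THEN eventually_mono]) (auto simp: hv)
    have ddh: "deriv (deriv h) z = deriv (deriv v) z"
      using z U(1)
      by (intro deriv_cong_ev[of "deriv h" "deriv v"] refl eventually_nhds_in_open[THEN eventually_mono])
        (auto simp: dh)
    have za: "z \<in> ball a r0 - {a}" using U_sub z \<rho> by auto
    have "deriv (deriv v) z + p z * deriv v z + q z * v z = 0" using solv z by (simp add: ode_solution_def)
    hence "(z - a) * (deriv (deriv v) z + p z * deriv v z + q z * v z) = 0" by simp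
    thus ?thesis unfolding E_def ddh dh[OF z] hv[OF z] p_eq[OF za] q_eq[OF za]
      using za by (simp add: distrib_left)
  qed
  have "\<not> eventually (\<lambda>z. E z \<noteq> 0) (cosparse (ball a \<rho>))"
  proof
    assume "eventually (\<lambda>z. E z \<noteq> 0) (cosparse (ball a \<rho>))"
    hence "eventually (\<lambda>z. E z \<noteq> 0) (at b)" using b_ball by (rule eventually_cosparse_imp_eventually_at)
    hence "eventually (\<lambda>z. False) (at b)" using evU by eventually_elim (use E0 in auto)
    thus False by simp
  qed
  ultimately have Ecos: "eventually (\<lambda>z. E z = 0) (cosparse (ball a \<rho>))" by blast
  have a_ball: "a \<in> ball a \<rho>" using \<rho> by simp
  have Eat: "eventually (\<lambda>z. E z = 0) (at a)" using Ecos a_ball by (rule eventually_cosparse_imp_eventually_at)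
  obtain V where V: "(\<lambda>w. h (a + w)) has_laurent_expansion V"
    using h_mer a_ball unfolding meromorphic_on_def by blast
  have V': "(\<lambda>w. deriv h (a + w)) has_laurent_expansion fls_deriv V"
    using has_laurent_expansion_deriv[OF V] by (simp add: deriv_translate)
  have V'': "(\<lambda>w. deriv (deriv h) (a + w)) has_laurent_expansion fls_deriv (fls_deriv V)"
    using has_laurent_expansion_deriv[OF V'] by (simp add: deriv_translate)
  have "(\<lambda>w. w * deriv (deriv h) (a + w) + series a A (a + w) * deriv h (a + w) + series a B (a + w) * h (a + w))
     has_laurent_expansion (fls_X * fls_deriv (fls_deriv V) + fps_to_fls A * fls_deriv V + fps_to_fls B * V)"
    by (intro laurent_expansion_intros V V' V'' series_laurent conv_radius_pos)
  hence "(\<lambda>w. E (a + w)) has_laurent_expansion (fls_X * fls_deriv (fls_deriv V) + fps_to_fls A * fls_deriv V + fps_to_fls B * V)"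
    by (simp add: E_def)
  hence Vode: "fls_X * fls_deriv (fls_deriv V) + fps_to_fls A * fls_deriv V + fps_to_fls B * V = 0"
    using Eat has_laurent_expansion_eventually_zero_iff by blast
  \<comment> \<open>The same identity theorem for \<open>deriv f\<close>: on \<open>U\<close> it
    equals \<open>g\<close>, which has no zeros, so it cannot vanish identically near
    \<open>a\<close>.\<close>
  have not_const: False if c: "eventually (\<lambda>z. f z = c) (at a)" for c
  proof -
    obtain e where e: "e > 0" "\<And>z. z \<noteq> a \<Longrightarrow> dist z a < e \<Longrightarrow> f z = c" using c unfolding eventually_at by auto
    have "deriv f z = 0" if "z \<in> ball a e - {a}" for z
    proof -
      have "deriv f z = deriv (\<lambda>_. c) z"
        using that by (intro deriv_cong_ev refl eventually_nhds_in_open[of "ball a e - {a}", THEN eventually_mono])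
          (auto simp: e dist_commute)
      thus ?thesis by simp
    qed
    moreover have "eventually (\<lambda>z. z \<in> ball a e - {a}) (at a)"
      using e(1) by (intro eventually_at_in_open) auto
    ultimately have fa: "eventually (\<lambda>z. deriv f z = 0) (at a)" by (auto elim: eventually_mono)
    have fb: "eventually (\<lambda>z. deriv f z \<noteq> 0) (at b)"
      using evU
    proof eventually_elim
      case (elim z)
      have "deriv f z = deriv G z"
        using elim U(1) by (intro deriv_cong_ev refl eventually_nhds_in_open[THEN eventually_mono]) (auto simp: f)
      also have "\<dots> = g z" by (rule DERIV_imp_deriv[OF G'[OF elim]])
      finally show ?case using gnz[OF elim] by simp
    qed
    have "deriv f meromorphic_on ball a \<rho>" by (intro meromorphic_intros f_mer)
    hence "eventually (\<lambda>z. deriv f z = 0) (cosparse (ball a \<rho>)) \<or> eventually (\<lambda>z. deriv f z \<noteq> 0) (cosparse (ball a \<rho>))"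
      by (rule meromorphic_imp_constant_or_avoid) auto
    hence "eventually (\<lambda>z. deriv f z = 0) (at b) \<or> eventually (\<lambda>z. deriv f z \<noteq> 0) (at a)"
      using eventually_cosparse_imp_eventually_at[OF _ b_ball] eventually_cosparse_imp_eventually_at[OF _ a_ball]
      by (elim disjE) simp_all
    thus False
    proof
      assume "eventually (\<lambda>z. deriv f z = 0) (at b)"
      hence "eventually (\<lambda>z. False) (at b)" using fb by eventually_elim auto
      thus False by simp
    next
      assume "eventually (\<lambda>z. deriv f z \<noteq> 0) (at a)"
      hence "eventually (\<lambda>z. False) (at a)" using fa by eventually_elim auto
      thus False by simp
    qed
  qed
  have ev_ball: "eventually (\<lambda>z. z \<in> ball a \<rho> - {a}) (at a)"
    using \<rho> by (intro eventually_at_in_open) auto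
  have mult_case: False if "V = fls_const c * fps_to_fls (Frob (Suc m))" for c
  proof -
    have "(\<lambda>w. h (a + w) - c * u (a + w)) has_laurent_expansion (V - fls_const c * fps_to_fls (Frob (Suc m)))"
      unfolding u_def by (intro laurent_expansion_intros V series_laurent radius)
    hence "eventually (\<lambda>z. h z - c * u z = 0) (at a)"
      using that has_laurent_expansion_eventually_zero_iff[of "\<lambda>z. h z - c * u z" a] by simp
    hence "eventually (\<lambda>z. f z = c) (at a)" using ev_ball
    proof eventually_elim
      case (elim z)
      have "u z \<noteq> 0" using elim(2) \<rho> by (intro r2) (auto simp: dist_commute)
      moreover have "u z * (f z - c) = 0" using elim(1) by (simp add: h_def algebra_simps)
      ultimately show ?case by simp
    qed
    thus False by (rule not_const)
  qed
  have "V \<noteq> 0" using mult_case[of 0] by auto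
  from formal_ode_laurent[OF A0 this Vode] obtain Y where Y: "V = fps_to_fls Y" "formal_ode A B Y = 0"
    "fps_nth Y 0 \<noteq> 0 \<or> (\<forall>n<Suc m. fps_nth Y n = 0)" by (elim exE conjE)
  show ?thesis
  proof (cases "fps_nth Y 0 = 0")
    case False
    thus ?thesis using obstruction_zero_if_regular_solution[OF A0 Y(2)] by blast
  next
    case True
    define c where "c = fps_nth Y (Suc m)"
    have "fps_nth Y n = c * fps_nth (Frob (Suc m)) n" for n
      unfolding Frob_def c_def fps_nth_Abs_fps
      by (rule formal_solution_unique[OF A0 Y(2)]) (use Y(3) True in auto)
    hence "Y = fps_const c * Frob (Suc m)" by (intro fps_ext) simp
    hence "V = fls_const c * fps_to_fls (Frob (Suc m))"
      by (simp add: Y(1) fls_times_fps_to_fls)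
    thus ?thesis using mult_case by blast
  qed
qed

theorem apparent_iff: "apparent_singularity p q a \<longleftrightarrow> obstruction m (fps_nth A) (fps_nth B) = 0"
  using apparent_if apparent_only_if by blast

end

section \<open>The obstruction as a function of the residues\<close>


context param_ring begin

text \<open>Polynomial functions of total degree strictly below \<open>d\<close> in the residues
  \<open>c\<close>, with coefficients in \<open>R\<close>. The strict bound makes the error term
  next to a leading power \<open>c j ^ n\<close> a \<open>poly_fun I n\<close>, including the zero
  error at \<open>n = 0\<close>; affine functions are those with \<open>d = 2\<close>.\<close>

definition poly_fun :: "'i set \<Rightarrow> nat \<Rightarrow> ('x \<Rightarrow> ('i \<Rightarrow> complex) \<Rightarrow> complex) \<Rightarrow> bool" where
  "poly_fun I d h \<longleftrightarrow> (\<exists>co. (\<forall>f\<in>low I d. R (\<lambda>\<theta>. co \<theta> f)) \<and>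
     (\<forall>\<theta> c. h \<theta> c = (\<Sum>f\<in>low I d. co \<theta> f * monomial c f)))"

lemma poly_funI:
  "(\<And>f. f \<in> low I d \<Longrightarrow> R (\<lambda>\<theta>. co \<theta> f)) \<Longrightarrow>
   (\<And>\<theta> c. h \<theta> c = (\<Sum>f\<in>low I d. co \<theta> f * monomial c f)) \<Longrightarrow> poly_fun I d h"
  unfolding poly_fun_def by blast

lemma poly_fun_zero: "poly_fun I d (\<lambda>_ _. 0)"
  by (rule poly_funI[where co = "\<lambda>_ _. 0"]) (auto intro: R_const)

lemma poly_fun_add:
  assumes "poly_fun I d h" "poly_fun I d k"
  shows "poly_fun I d (\<lambda>\<theta> c. h \<theta> c + k \<theta> c)"
proof -
  obtain u where u: "\<And>f. f \<in> low I d \<Longrightarrow> R (\<lambda>\<theta>. u \<theta> f)"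
    "\<And>\<theta> c. h \<theta> c = (\<Sum>f\<in>low I d. u \<theta> f * monomial c f)" using assms(1) unfolding poly_fun_def by blast
  obtain v where v: "\<And>f. f \<in> low I d \<Longrightarrow> R (\<lambda>\<theta>. v \<theta> f)"
    "\<And>\<theta> c. k \<theta> c = (\<Sum>f\<in>low I d. v \<theta> f * monomial c f)" using assms(2) unfolding poly_fun_def by blast
  show ?thesis
    by (rule poly_funI[where co = "\<lambda>\<theta> f. u \<theta> f + v \<theta> f"])
      (auto intro: R_add u(1) v(1) simp: u(2) v(2) distrib_right sum.distrib)
qed

lemma poly_fun_scale:
  assumes "R r" "poly_fun I d h"
  shows "poly_fun I d (\<lambda>\<theta> c. r \<theta> * h \<theta> c)"
proof -
  obtain u where u: "\<And>f. f \<in> low I d \<Longrightarrow> R (\<lambda>\<theta>. u \<theta> f)"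
    "\<And>\<theta> c. h \<theta> c = (\<Sum>f\<in>low I d. u \<theta> f * monomial c f)" using assms(2) unfolding poly_fun_def by blast
  show ?thesis
    by (rule poly_funI[where co = "\<lambda>\<theta> f. r \<theta> * u \<theta> f"])
      (auto intro: R_mult assms u(1) simp: u(2) sum_distrib_left mult.assoc)
qed

lemma poly_fun_mono:
  assumes "finite I" "poly_fun I d h" "d \<le> d'"
  shows "poly_fun I d' h"
proof -
  obtain u where u: "\<And>f. f \<in> low I d \<Longrightarrow> R (\<lambda>\<theta>. u \<theta> f)"
    "\<And>\<theta> c. h \<theta> c = (\<Sum>f\<in>low I d. u \<theta> f * monomial c f)" using assms(2) unfolding poly_fun_def by blast
  have sub: "low I d \<subseteq> low I d'" using assms(3) by (auto simp: low_def)
  show ?thesis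
  proof (rule poly_funI[where co = "\<lambda>\<theta> f. if f \<in> low I d then u \<theta> f else 0"])
    show "R (\<lambda>\<theta>. if f \<in> low I d then u \<theta> f else 0)" for f
      by (rule R_if) (auto intro: u(1) R_const)
    show "h \<theta> c = (\<Sum>f\<in>low I d'. (if f \<in> low I d then u \<theta> f else 0) * monomial c f)" for \<theta> c
      unfolding u(2) by (rule sum.mono_neutral_cong_left) (use sub finite_low[OF assms(1)] in auto)
  qed
qed

lemma poly_fun_var:
  assumes "finite I" "i \<in> I" "poly_fun I d h"
  shows "poly_fun I (Suc d) (\<lambda>\<theta> c. c i * h \<theta> c)"
proof -
  obtain u where u: "\<And>f. f \<in> low I d \<Longrightarrow> R (\<lambda>\<theta>. u \<theta> f)"
    "\<And>\<theta> c. h \<theta> c = (\<Sum>f\<in>low I d. u \<theta> f * monomial c f)" using assms(3) unfolding poly_fun_def by blast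
  have low: "f - {#i#} \<in> low I d" if "f \<in> low I (Suc d)" "i \<in># f" for f
    using that by (auto simp: low_def dest!: multi_member_split)
  show ?thesis
  proof (rule poly_funI[where co = "\<lambda>\<theta> f. if i \<in># f then u \<theta> (f - {#i#}) else 0"])
    show "R (\<lambda>\<theta>. if i \<in># f then u \<theta> (f - {#i#}) else 0)" if "f \<in> low I (Suc d)" for f
      by (rule R_if) (auto intro: u(1) R_const low that)
    fix \<theta> c
    have "(\<Sum>f\<in>low I (Suc d). (if i \<in># f then u \<theta> (f - {#i#}) else 0) * monomial c f)
        = (\<Sum>f\<in>{f \<in> low I (Suc d). i \<in># f}. u \<theta> (f - {#i#}) * monomial c f)"
      by (rule sum.mono_neutral_cong_right) (use finite_low[OF assms(1)] in auto)
    also have "\<dots> = (\<Sum>f\<in>low I d. u \<theta> f * monomial c (add_mset i f))"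
      by (rule sum.reindex_bij_witness[of _ "add_mset i" "\<lambda>f. f - {#i#}"])
        (use low assms(2) in \<open>auto simp: low_def\<close>)
    finally show "c i * h \<theta> c = (\<Sum>f\<in>low I (Suc d). (if i \<in># f then u \<theta> (f - {#i#}) else 0) * monomial c f)"
      by (simp add: u(2) sum_distrib_left mult_ac)
  qed
qed

lemma poly_fun_sum:
  "(\<And>x. x \<in> X \<Longrightarrow> poly_fun I d (h x)) \<Longrightarrow> poly_fun I d (\<lambda>\<theta> c. \<Sum>x\<in>X. h x \<theta> c)"
  by (induction X rule: infinite_finite_induct) (auto intro: poly_fun_zero poly_fun_add)

lemma poly_fun_const:
  assumes "finite I" "R r" "d > 0"
  shows "poly_fun I d (\<lambda>\<theta> _. r \<theta>)"
proof -
  have "low I (Suc 0) = {{#}}" by (auto simp: low_def)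
  hence "poly_fun I (Suc 0) (\<lambda>\<theta> _. r \<theta>)"
    using assms(2) by (intro poly_funI[where co = "\<lambda>\<theta> _. r \<theta>"]) simp_all
  thus ?thesis by (rule poly_fun_mono[OF assms(1)]) (use assms(3) in simp)
qed

lemma poly_fun_affine_mult:
  assumes "finite I" "poly_fun I 2 g" "poly_fun I d h"
  shows "poly_fun I (Suc d) (\<lambda>\<theta> c. g \<theta> c * h \<theta> c)"
proof -
  obtain u where u: "\<And>f. f \<in> low I 2 \<Longrightarrow> R (\<lambda>\<theta>. u \<theta> f)"
    "\<And>\<theta> c. g \<theta> c = (\<Sum>f\<in>low I 2. u \<theta> f * monomial c f)" using assms(2) unfolding poly_fun_def by blast
  have "poly_fun I (Suc d) (\<lambda>\<theta> c. \<Sum>f\<in>low I 2. u \<theta> f * (monomial c f * h \<theta> c))"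
  proof (intro poly_fun_sum poly_fun_scale u(1))
    fix f assume f: "f \<in> low I 2"
    consider "f = {#}" | i where "i \<in> I" "f = {#i#}"
      using f by (cases f) (auto simp: low_def)
    thus "poly_fun I (Suc d) (\<lambda>\<theta> c. monomial c f * h \<theta> c)"
    proof cases
      case 1
      thus ?thesis using assms by (simp add: poly_fun_mono[of I d])
    next
      case 2
      thus ?thesis using poly_fun_var[OF assms(1) 2(1) assms(3)] by simp
    qed
  qed
  thus ?thesis by (simp add: u(2) sum_distrib_right mult.assoc)
qed

end

text \<open>Keeps of the differential equation only what the degree count uses: \<open>A\<close> is
  free of \<open>c\<close>, while \<open>B\<close> is affine in \<open>c\<close> with initial
  coefficient \<open>c j\<close>. The locale is instantiated for one fixed equation, for the whole
  parameter space and for the rescaled system.\<close>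

locale recursion_family = param_ring R
  for R :: "('x \<Rightarrow> complex) \<Rightarrow> bool" +
  fixes I :: "'i set" and m :: "'i \<Rightarrow> nat"
    and A :: "'x \<Rightarrow> 'i \<Rightarrow> nat \<Rightarrow> complex" and B :: "'x \<Rightarrow> ('i \<Rightarrow> complex) \<Rightarrow> 'i \<Rightarrow> nat \<Rightarrow> complex"
  assumes finite_index: "finite I"
    and R_A: "\<And>j n. j \<in> I \<Longrightarrow> R (\<lambda>\<theta>. A \<theta> j n)"
    and poly_B: "\<And>j n. j \<in> I \<Longrightarrow> poly_fun I 2 (\<lambda>\<theta> c. B \<theta> c j n)"
    and B_0: "\<And>\<theta> c j. j \<in> I \<Longrightarrow> B \<theta> c j 0 = c j"
begin

definition obstruction_zeros :: "'x \<Rightarrow> ('i \<Rightarrow> complex) set" where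
  "obstruction_zeros \<theta> = {c \<in> I \<rightarrow>\<^sub>E UNIV. \<forall>j\<in>I. obstruction (m j) (A \<theta> j) (B \<theta> c j) = 0}"

text \<open>The sequence \<open>y\<close> is left abstract so that the same computation serves every
  recursion step and the obstruction itself, which is the same sum without the final
  division.\<close>

lemma step_sum_poly:
  assumes j: "j \<in> I"
    and IH: "\<And>l. l \<le> n \<Longrightarrow> \<exists>h. poly_fun I l h \<and> (\<forall>\<theta> c. y l \<theta> c = \<kappa> l * c j ^ l + h \<theta> c)"
  shows "\<exists>h. poly_fun I (Suc n) h \<and> (\<forall>\<theta> c.
     (\<Sum>l<Suc n. (of_nat l * A \<theta> j (Suc n - l) + B \<theta> c j (n - l)) * y l \<theta> c) = \<kappa> n * c j ^ Suc n + h \<theta> c)"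
proof -
  have y: "poly_fun I (Suc l) (y l)" if "l \<le> n" for l
  proof -
    obtain h where h: "poly_fun I l h" "\<And>\<theta> c. y l \<theta> c = \<kappa> l * c j ^ l + h \<theta> c" using IH \<open>l \<le> n\<close> by blast
    have "poly_fun I (Suc k) (\<lambda>\<theta> c. c j ^ k)" for k
    proof (induction k)
      case 0
      show ?case using poly_fun_const[OF finite_index R_const[of 1], of 1] by simp
    next
      case (Suc k)
      from poly_fun_var[OF finite_index j this] show ?case by simp
    qed
    from poly_fun_scale[OF R_const this] have "poly_fun I (Suc l) (\<lambda>\<theta> c. \<kappa> l * c j ^ l + h \<theta> c)"
      by (intro poly_fun_add poly_fun_mono[OF finite_index h(1)]) auto
    thus ?thesis unfolding h(2)[abs_def, symmetric] by (simp add: h(2))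
  qed
  obtain h where h: "poly_fun I n h" "\<And>\<theta> c. y n \<theta> c = \<kappa> n * c j ^ n + h \<theta> c" using IH[of n] by blast
  define H where "H = (\<lambda>\<theta> c. (\<Sum>l<n. (of_nat l * A \<theta> j (Suc n - l) + B \<theta> c j (n - l)) * y l \<theta> c)
     + (of_nat n * A \<theta> j 1 * y n \<theta> c + c j * h \<theta> c))"
  have "poly_fun I (Suc n) (\<lambda>\<theta> c. (of_nat l * A \<theta> j (Suc n - l) + B \<theta> c j (n - l)) * y l \<theta> c)" if "l < n" for l
  proof (rule poly_fun_mono[OF finite_index poly_fun_affine_mult[OF finite_index]])
    show "poly_fun I 2 (\<lambda>\<theta> c. of_nat l * A \<theta> j (Suc n - l) + B \<theta> c j (n - l))"
      by (intro poly_fun_add poly_B j poly_fun_const finite_index R_mult R_const R_A) auto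
    show "poly_fun I (Suc l) (y l)" using y that by auto
  qed (use that in auto)
  hence "poly_fun I (Suc n) H"
    unfolding H_def by (intro poly_fun_add poly_fun_sum poly_fun_scale poly_fun_var finite_index j h(1) y
        R_mult R_const R_A) auto
  moreover have "(\<Sum>l<Suc n. (of_nat l * A \<theta> j (Suc n - l) + B \<theta> c j (n - l)) * y l \<theta> c)
      = \<kappa> n * c j ^ Suc n + H \<theta> c" for \<theta> c
    by (simp add: H_def B_0[OF j] h(2) algebra_simps)
  ultimately show ?thesis by blast
qed

text \<open>Among all terms of the recursion, only the chain of steps of length one, each contributing
  the residue \<open>B \<theta> c j 0 = c j\<close>, reaches the top total degree.\<close>

lemma frobenius_poly:
  assumes j: "j \<in> I"
  shows "\<exists>\<kappa>. \<forall>n\<le>m j. \<kappa> n \<noteq> 0 \<and>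
     (\<exists>h. poly_fun I n h \<and> (\<forall>\<theta> c. frobenius (m j) (A \<theta> j) (B \<theta> c j) 0 n = \<kappa> n * c j ^ n + h \<theta> c))"
proof -
  let ?D = "\<lambda>k. of_nat k * (of_nat k - 1 - of_nat (m j)) :: complex"
  \<comment> \<open>Each step of length one contributes the factor \<open>- 1 / ?D k\<close>; none
    of the denominators up to \<open>m j\<close> vanishes, the first zero being at
    \<open>m j + 1\<close>.\<close>
  define \<kappa> where "\<kappa> = (\<lambda>n. \<Prod>k=1..n. - 1 / ?D k)"
  let ?y = "\<lambda>n \<theta> c. frobenius (m j) (A \<theta> j) (B \<theta> c j) 0 n"
  have "\<kappa> n \<noteq> 0 \<and> (\<exists>h. poly_fun I n h \<and> (\<forall>\<theta> c. ?y n \<theta> c = \<kappa> n * c j ^ n + h \<theta> c))" if "n \<le> m j" for n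
    using that
  proof (induction n rule: less_induct)
    case (less n)
    show ?case
    proof (cases n)
      case 0
      thus ?thesis using poly_fun_zero[of I 0]
        by (intro conjI exI[of _ "\<lambda>_ _. 0"]) (auto simp: \<kappa>_def frobenius.simps)
    next
      case (Suc k)
      have Dne: "?D (Suc k) \<noteq> 0" using less.prems Suc by (intro frobenius_denominator) auto
      obtain h where h: "poly_fun I (Suc k) h"
        "\<And>\<theta> c. (\<Sum>l<Suc k. (of_nat l * A \<theta> j (Suc k - l) + B \<theta> c j (k - l)) * ?y l \<theta> c) = \<kappa> k * c j ^ Suc k + h \<theta> c"
      proof -
        have "\<exists>h. poly_fun I (Suc k) h \<and> (\<forall>\<theta> c.
            (\<Sum>l<Suc k. (of_nat l * A \<theta> j (Suc k - l) + B \<theta> c j (k - l)) * ?y l \<theta> c) = \<kappa> k * c j ^ Suc k + h \<theta> c)"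
          by (rule step_sum_poly[OF j]) (use less Suc in auto)
        thus ?thesis using that by blast
      qed
      have "\<kappa> n = (- 1 / ?D (Suc k)) * \<kappa> k" by (simp add: \<kappa>_def Suc)
      moreover have "?y n \<theta> c = (- 1 / ?D (Suc k)) * (\<kappa> k * c j ^ Suc k + h \<theta> c)" for \<theta> c
      proof -
        have "?y (Suc k) \<theta> c = - (\<Sum>l<Suc k. (of_nat l * A \<theta> j (Suc k - l) + B \<theta> c j (k - l)) * ?y l \<theta> c) / ?D (Suc k)"
          by (subst frobenius.simps) simp
        also have "\<dots> = (- 1 / ?D (Suc k)) * (\<kappa> k * c j ^ Suc k + h \<theta> c)" unfolding h(2)
          by (simp only: divide_minus_left mult_minus_left times_divide_eq_left mult_1_left)
        finally show ?thesis unfolding Suc .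
      qed
      ultimately have "?y n \<theta> c = \<kappa> n * c j ^ n + (- 1 / ?D (Suc k)) * h \<theta> c" for \<theta> c
        using Suc by (simp only: distrib_left mult.assoc)
      moreover have "poly_fun I n (\<lambda>\<theta> c. (- 1 / ?D (Suc k)) * h \<theta> c)"
        unfolding Suc by (intro poly_fun_scale R_const h(1))
      moreover have "\<kappa> k \<noteq> 0" using less Suc by auto
      hence "\<kappa> n \<noteq> 0" using \<open>\<kappa> n = _\<close> Dne by simp
      ultimately show ?thesis by blast
    qed
  qed
  thus ?thesis by blast
qed

lemma obstruction_poly:
  assumes j: "j \<in> I"
  shows "\<exists>\<kappa> co. \<kappa> \<noteq> 0 \<and> (\<forall>f\<in>low I (Suc (m j)). R (\<lambda>\<theta>. co \<theta> f)) \<and>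
    (\<forall>\<theta> c. obstruction (m j) (A \<theta> j) (B \<theta> c j) =
       \<kappa> * (c j ^ Suc (m j) + (\<Sum>f\<in>low I (Suc (m j)). co \<theta> f * monomial c f)))"
proof -
  obtain \<kappa> where \<kappa>: "\<And>n. n \<le> m j \<Longrightarrow> \<kappa> n \<noteq> 0"
    "\<And>n. n \<le> m j \<Longrightarrow> \<exists>h. poly_fun I n h \<and> (\<forall>\<theta> c. frobenius (m j) (A \<theta> j) (B \<theta> c j) 0 n = \<kappa> n * c j ^ n + h \<theta> c)"
    using frobenius_poly[OF j] by blast
  obtain h where h: "poly_fun I (Suc (m j)) h"
    "\<And>\<theta> c. obstruction (m j) (A \<theta> j) (B \<theta> c j) = \<kappa> (m j) * c j ^ Suc (m j) + h \<theta> c"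
    using step_sum_poly[OF j \<kappa>(2)] unfolding obstruction_def by blast
  from poly_fun_scale[OF R_const[of "1 / \<kappa> (m j)"] h(1)]
  obtain co where co: "\<forall>f\<in>low I (Suc (m j)). R (\<lambda>\<theta>. co \<theta> f)"
    "\<And>\<theta> c. 1 / \<kappa> (m j) * h \<theta> c = (\<Sum>f\<in>low I (Suc (m j)). co \<theta> f * monomial c f)"
    unfolding poly_fun_def by blast
  have "h \<theta> c = \<kappa> (m j) * (\<Sum>f\<in>low I (Suc (m j)). co \<theta> f * monomial c f)" for \<theta> c
    using \<kappa>(1)[of "m j"] by (simp flip: co(2))
  thus ?thesis using co(1) \<kappa>(1)[of "m j"]
    by (intro exI[of _ "\<kappa> (m j)"] exI[of _ co]) (simp add: h(2) distrib_left)
qed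

lemma obstruction_zeros_family:
  "\<exists>co. system_family R I (\<lambda>j. Suc (m j)) co \<and>
     (\<forall>\<theta>. obstruction_zeros \<theta> = triangular_system.zeros I (\<lambda>j. Suc (m j)) (co \<theta>))"
proof -
  define Q where "Q = (\<lambda>j \<kappa> co. \<kappa> \<noteq> 0 \<and> (\<forall>f\<in>low I (Suc (m j)). R (\<lambda>\<theta>. co \<theta> f)) \<and>
    (\<forall>\<theta> c. obstruction (m j) (A \<theta> j) (B \<theta> c j) =
       \<kappa> * (c j ^ Suc (m j) + (\<Sum>f\<in>low I (Suc (m j)). co \<theta> f * monomial c f))))"
  have "\<forall>j\<in>I. \<exists>\<kappa> co. Q j \<kappa> co"
    unfolding Q_def using obstruction_poly by blast
  from bchoice[OF this] obtain \<kappa> where "\<forall>j\<in>I. \<exists>co. Q j (\<kappa> j) co" by (elim exE)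
  from bchoice[OF this] obtain co where Q: "\<forall>j\<in>I. Q j (\<kappa> j) (co j)" by (elim exE)
  have co: "\<kappa> j \<noteq> 0" "\<And>f. f \<in> low I (Suc (m j)) \<Longrightarrow> R (\<lambda>\<theta>. co j \<theta> f)"
    "\<And>\<theta> c. obstruction (m j) (A \<theta> j) (B \<theta> c j) =
       \<kappa> j * (c j ^ Suc (m j) + (\<Sum>f\<in>low I (Suc (m j)). co j \<theta> f * monomial c f))"
    if "j \<in> I" for j
    using bspec[OF Q that] unfolding Q_def by simp_all
  interpret S: system_family R I "\<lambda>j. Suc (m j)" "\<lambda>\<theta> j. co j \<theta>"
    by unfold_locales (use finite_index co(2) in auto)
  have "obstruction_zeros \<theta> = S.T.zeros \<theta>" for \<theta>
    unfolding obstruction_zeros_def S.T.zeros_def S.T.poly_at_def using co(1,3) by auto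
  thus ?thesis using S.system_family_axioms by blast
qed

lemma card_obstruction_zeros:
  "finite (obstruction_zeros \<theta>)" "obstruction_zeros \<theta> \<noteq> {}"
  "card (obstruction_zeros \<theta>) \<le> (\<Prod>j\<in>I. m j + 1)"
proof -
  obtain co where "system_family R I (\<lambda>j. Suc (m j)) co"
    and Z: "\<And>\<theta>. obstruction_zeros \<theta> = triangular_system.zeros I (\<lambda>j. Suc (m j)) (co \<theta>)"
    using obstruction_zeros_family by blast
  then interpret S: system_family R I "\<lambda>j. Suc (m j)" co by simp
  show "finite (obstruction_zeros \<theta>)" "obstruction_zeros \<theta> \<noteq> {}"
    "card (obstruction_zeros \<theta>) \<le> (\<Prod>j\<in>I. m j + 1)"
    unfolding Z using S.T.finite_zeros S.T.zeros_nonempty S.T.card_zeros_le by (simp_all add: S.T.dimE)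
qed

text \<open>A form \<open>l\<close> separating the zeros at \<open>\<theta>0\<close> is chosen once
  and kept for all parameters. The discriminant for this \<open>l\<close> is the required function
  \<open>D\<close>.\<close>

lemma maximal_count_open:
  assumes "card (obstruction_zeros \<theta>0) = (\<Prod>j\<in>I. m j + 1)"
  shows "\<exists>D. R D \<and> D \<theta>0 \<noteq> 0 \<and>
     (\<forall>\<theta>. D \<theta> \<noteq> 0 \<longrightarrow> card (obstruction_zeros \<theta>) = (\<Prod>j\<in>I. m j + 1))"
proof -
  obtain co where "system_family R I (\<lambda>j. Suc (m j)) co"
    and Z: "\<And>\<theta>. obstruction_zeros \<theta> = triangular_system.zeros I (\<lambda>j. Suc (m j)) (co \<theta>)"
    using obstruction_zeros_family by blast
  then interpret S: system_family R I "\<lambda>j. Suc (m j)" co by simp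
  obtain l where l: "inj_on (S.T.linear_form l) (S.T.zeros \<theta>0)"
    using separating_form_inj[OF finite_index S.T.finite_zeros] 
    unfolding S.T.zeros_def S.T.linear_form_def[abs_def] by blast
  have "S.T.discriminant \<theta>0 l \<noteq> 0"
    by (rule S.T.discriminant_nonzero[OF l order_refl]) (use assms in \<open>simp add: Z S.T.dimE\<close>)
  moreover have "card (obstruction_zeros \<theta>) = (\<Prod>j\<in>I. m j + 1)" if "S.T.discriminant \<theta> l \<noteq> 0" for \<theta>
    using S.T.card_zeros_eq[OF that] by (simp add: Z S.T.dimE)
  ultimately show ?thesis using S.R_discriminant by blast
qed

end


section \<open>Local expansions and the correspondence between equations and residues\<close>

lemma regular_singular_pointI:
  assumes PA: "PA has_fps_expansion A" and QB: "QB has_fps_expansion B"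
    and A0: "fps_nth A 0 = - of_nat m"
    and p: "eventually (\<lambda>z. p z = PA (z - a) / (z - a)) (at a)"
    and q: "eventually (\<lambda>z. q z = QB (z - a) / (z - a)) (at a)"
  shows "\<exists>r0. regular_singular_point p q a m A B r0"
proof -
  have rad: "0 < fps_conv_radius A" "0 < fps_conv_radius B"
    and "eventually (\<lambda>z. eval_fps A z = PA z) (nhds 0)" "eventually (\<lambda>z. eval_fps B z = QB z) (nhds 0)"
    using PA QB by (auto simp: has_fps_expansion_def)
  then obtain r1 r2 where r12: "r1 > 0" "\<And>z. dist z 0 < r1 \<Longrightarrow> eval_fps A z = PA z"
    "r2 > 0" "\<And>z. dist z 0 < r2 \<Longrightarrow> eval_fps B z = QB z"
    unfolding eventually_nhds_metric by auto
  obtain r3 where r3: "r3 > 0" "\<And>z. z \<noteq> a \<Longrightarrow> dist z a < r3 \<Longrightarrow> p z = PA (z - a) / (z - a)"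
    using p unfolding eventually_at by auto
  obtain r4 where r4: "r4 > 0" "\<And>z. z \<noteq> a \<Longrightarrow> dist z a < r4 \<Longrightarrow> q z = QB (z - a) / (z - a)"
    using q unfolding eventually_at by auto
  obtain r5 where r5: "0 < ereal r5" "ereal r5 < fps_conv_radius A" using ereal_dense2[OF rad(1)] by blast
  obtain r6 where r6: "0 < ereal r6" "ereal r6 < fps_conv_radius B" using ereal_dense2[OF rad(2)] by blast
  define r where "r = min (min r1 r2) (min (min r3 r4) (min r5 r6))"
  have r: "r > 0" "r \<le> r1" "r \<le> r2" "r \<le> r3" "r \<le> r4" "r \<le> r5" "r \<le> r6"
    using r12 r3 r4 r5 r6 by (auto simp: r_def)
  have R: "ereal r \<le> fps_conv_radius A" "ereal r \<le> fps_conv_radius B"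
    using r r5(2) r6(2) by (meson ereal_less_eq(3) less_imp_le order_trans)+
  have "regular_singular_point p q a m A B r"
  proof
    fix z assume z: "z \<in> ball a r - {a}"
    hence d: "dist z a < r" "z \<noteq> a" "dist (z - a) 0 < r" by (auto simp: dist_commute dist_norm)
    show "p z = series a A z / (z - a)" using d r r3(2)[of z] r12(2)[of "z - a"] by (simp add: series_def)
    show "q z = series a B z / (z - a)" using d r r4(2)[of z] r12(4)[of "z - a"] by (simp add: series_def)
  qed (use r R A0 in auto)
  thus ?thesis by blast
qed

text \<open>Taylor coefficients of \<open>1 / (w + t)\<close> at \<open>t = 0\<close>, written as a
  polynomial in \<open>1 / w\<close> so that only inverses of the differences of singular points
  enter.\<close>

definition geom_coeff :: "nat \<Rightarrow> complex \<Rightarrow> complex" where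
  "geom_coeff n w = (- 1) ^ n * (1 / w) ^ Suc n"

lemma geom_has_fps_expansion:
  assumes "w \<noteq> 0"
  shows "(\<lambda>t. 1 / (w + t)) has_fps_expansion Abs_fps (\<lambda>n. geom_coeff n w)"
proof -
  have "Abs_fps (\<lambda>n. geom_coeff n w) * (fps_const w + fps_X) = 1"
  proof (rule fps_ext)
    fix n show "fps_nth (Abs_fps (\<lambda>n. geom_coeff n w) * (fps_const w + fps_X)) n = fps_nth 1 n"
      using assms by (cases n) (simp_all add: distrib_left geom_coeff_def)
  qed
  hence "inverse (fps_const w + fps_X) = Abs_fps (\<lambda>n. geom_coeff n w)"
    by (metis fps_inverse_unique mult.commute)
  moreover have "(\<lambda>t. inverse (w + t)) has_fps_expansion inverse (fps_const w + fps_X)"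
    by (intro fps_expansion_intros) (use assms in simp)
  ultimately show ?thesis by (simp add: inverse_eq_divide)
qed

text \<open>Taylor coefficients at \<open>a j\<close> of \<open>z - a j\<close> times
  \<open>coeff_p\<close>: the pole at \<open>a j\<close> gives index 0, and the other poles
  contribute one index later.\<close>

definition coefA :: "nat \<Rightarrow> (nat \<Rightarrow> nat) \<Rightarrow> complex \<Rightarrow> complex \<Rightarrow> (nat \<Rightarrow> complex) \<Rightarrow> nat \<Rightarrow> nat \<Rightarrow> complex" where
  "coefA k m \<alpha> \<beta> a j n = (case n of 0 \<Rightarrow> - of_nat (m j)
     | Suc n \<Rightarrow> - (\<alpha> * geom_coeff n (a j) + \<beta> * geom_coeff n (a j - 1)
          + (\<Sum>i\<in>{1..k}-{j}. of_nat (m i) * geom_coeff n (a j - a i))))"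

text \<open>The numbers \<open>c i\<close> are the residues of the coefficient of \<open>y\<close> at the points \<open>a i\<close>; the
  residues at \<open>0\<close> and \<open>1\<close> are determined by them and by \<open>e = \<gamma> * \<delta>\<close>.\<close>

definition res0 :: "nat \<Rightarrow> complex \<Rightarrow> (nat \<Rightarrow> complex) \<Rightarrow> (nat \<Rightarrow> complex) \<Rightarrow> complex" where
  "res0 k e a c = (\<Sum>i=1..k. c i * (a i - 1)) + - e"

definition res1 :: "nat \<Rightarrow> complex \<Rightarrow> (nat \<Rightarrow> complex) \<Rightarrow> (nat \<Rightarrow> complex) \<Rightarrow> complex" where
  "res1 k e a c = (\<Sum>i=1..k. c i * - a i) + e"

definition coefB :: "nat \<Rightarrow> complex \<Rightarrow> (nat \<Rightarrow> complex) \<Rightarrow> (nat \<Rightarrow> complex) \<Rightarrow> nat \<Rightarrow> nat \<Rightarrow> complex" where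
  "coefB k e a c j n = (case n of 0 \<Rightarrow> c j
     | Suc n \<Rightarrow> geom_coeff n (a j) * res0 k e a c + geom_coeff n (a j - 1) * res1 k e a c
          + (\<Sum>i\<in>{1..k}-{j}. c i * geom_coeff n (a j - a i)))"

text \<open>Lagrange interpolation: the first summand fixes the leading coefficient
  \<open>e\<close>, and the second fixes the values at the points \<open>a i\<close> so that
  \<open>coeff_q\<close> has residue \<open>c i\<close> there.\<close>

definition accessory_poly :: "nat \<Rightarrow> complex \<Rightarrow> (nat \<Rightarrow> complex) \<Rightarrow> (nat \<Rightarrow> complex) \<Rightarrow> complex poly" where
  "accessory_poly k e a c = Polynomial.smult e (\<Prod>i=1..k. [:- a i, 1:]) +
     (\<Sum>i=1..k. Polynomial.smult (c i * a i * (a i - 1)) (\<Prod>l\<in>{1..k}-{i}. [:- a l, 1:]))"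

lemma poly_accessory_poly:
  "poly (accessory_poly k e a c) z = e * (\<Prod>i=1..k. z - a i) +
     (\<Sum>i=1..k. c i * a i * (a i - 1) * (\<Prod>l\<in>{1..k}-{i}. z - a l))"
  by (simp add: accessory_poly_def poly_sum poly_prod)

lemma three_pole_fractions:
  fixes z w :: complex
  assumes "z \<noteq> 0" "z - 1 \<noteq> 0" "z - w \<noteq> 0"
  shows "w * (w - 1) / (z * (z - 1) * (z - w)) = 1 / (z - w) + (w - 1) / z - w / (z - 1)"
proof -
  let ?D = "z * (z - 1) * (z - w)"
  have "1 / (z - w) = z * (z - 1) / ?D" "(w - 1) / z = (w - 1) * (z - 1) * (z - w) / ?D"
    "w / (z - 1) = w * z * (z - w) / ?D"
    using assms by (simp_all only: divide_eq_eq nonzero_divide_eq_eq eq_divide_eq mult_eq_0_iff) (simp_all add: mult_ac)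
  moreover have "w * (w - 1) = z * (z - 1) + (w - 1) * (z - 1) * (z - w) - w * z * (z - w)"
    by (simp add: algebra_simps)
  ultimately show ?thesis by (simp only: add_divide_distrib diff_divide_distrib)
qed

lemma coeff_q_partial_fractions:
  assumes "z \<noteq> 0" "z \<noteq> 1" "\<And>i. i \<in> {1..k} \<Longrightarrow> z \<noteq> a i"
  shows "coeff_q k a (accessory_poly k e a c) z =
    res0 k e a c / z + res1 k e a c / (z - 1) + (\<Sum>i=1..k. c i / (z - a i))"
proof -
  define M where "M = (\<Prod>i=1..k. z - a i)"
  have M0: "M \<noteq> 0" using assms(3) by (auto simp: M_def)
  have z1: "z - 1 \<noteq> 0" using assms by simp
  have "coeff_q k a (accessory_poly k e a c) z = e * M / (z * (z - 1) * M) +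
     (\<Sum>i=1..k. c i * a i * (a i - 1) * (\<Prod>l\<in>{1..k}-{i}. z - a l) / (z * (z - 1) * M))"
    by (simp add: coeff_q_def poly_accessory_poly M_def add_divide_distrib sum_divide_distrib)
  also have "(\<Sum>i=1..k. c i * a i * (a i - 1) * (\<Prod>l\<in>{1..k}-{i}. z - a l) / (z * (z - 1) * M)) =
     (\<Sum>i=1..k. c i / (z - a i) + c i * (a i - 1) / z + c i * - a i / (z - 1))"
  proof (rule sum.cong)
    fix i assume i: "i \<in> {1..k}"
    define N where "N = (\<Prod>l\<in>{1..k}-{i}. z - a l)"
    have MN: "M = (z - a i) * N" unfolding M_def N_def using i by (intro prod.remove) auto
    have "N \<noteq> 0" using M0 MN by auto
    have za: "z - a i \<noteq> 0" using assms(3)[OF i] by simp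
    have "c i * a i * (a i - 1) * N / (z * (z - 1) * M) = c i * (a i * (a i - 1) / (z * (z - 1) * (z - a i)))"
      using \<open>N \<noteq> 0\<close> unfolding MN by simp
    also have "a i * (a i - 1) / (z * (z - 1) * (z - a i)) = 1 / (z - a i) + (a i - 1) / z - a i / (z - 1)"
      by (rule three_pole_fractions[OF assms(1) z1 za])
    also have "c i * \<dots> = c i / (z - a i) + c i * (a i - 1) / z + c i * - a i / (z - 1)"
      by (simp add: distrib_left right_diff_distrib)
    finally show "c i * a i * (a i - 1) * (\<Prod>l\<in>{1..k}-{i}. z - a l) / (z * (z - 1) * M) = \<dots>"
      by (simp add: N_def)
  qed simp
  also have "e * M / (z * (z - 1) * M) = - e / z + e / (z - 1)"
    using M0 z1 assms(1) by (simp add: divide_simps) (simp add: algebra_simps)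
  also have "(\<Sum>i=1..k. c i / (z - a i) + c i * (a i - 1) / z + c i * - a i / (z - 1)) =
      (\<Sum>i=1..k. c i / (z - a i)) + (\<Sum>i=1..k. c i * (a i - 1)) / z + (\<Sum>i=1..k. c i * - a i) / (z - 1)"
    by (simp only: sum.distrib sum_divide_distrib)
  finally show ?thesis
    by (simp only: res0_def res1_def add_divide_distrib add_ac)
qed

lemma apparent_iff_obstruction:
  assumes adm: "admissible_points k a" and j: "j \<in> {1..k}"
  shows "apparent_singularity (coeff_p k m \<alpha> \<beta> a) (coeff_q k a (accessory_poly k e a c)) (a j) \<longleftrightarrow>
    obstruction (m j) (coefA k m \<alpha> \<beta> a j) (coefB k e a c j) = 0"
proof -
  let ?I = "{1..k} - {j}"
  let ?G = "\<lambda>w. Abs_fps (\<lambda>n. geom_coeff n w)"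
  have w: "a j \<noteq> 0" "a j - 1 \<noteq> 0" "\<And>i. i \<in> ?I \<Longrightarrow> a j - a i \<noteq> 0"
    using adm j by (auto simp: admissible_points_def dest: inj_onD)
  have simple_poles: "(\<lambda>t. x0 + t * (x1 * (1 / (a j + t)) + x2 * (1 / (a j - 1 + t)) + (\<Sum>i\<in>?I. y i * (1 / (a j - a i + t)))))
      has_fps_expansion fps_const x0 + fps_X * (fps_const x1 * ?G (a j) + fps_const x2 * ?G (a j - 1)
        + (\<Sum>i\<in>?I. fps_const (y i) * ?G (a j - a i)))" for x0 x1 x2 y
    by (intro fps_expansion_intros geom_has_fps_expansion w)
  have near: "eventually (\<lambda>z. z \<noteq> w) (at (a j))" if "w \<noteq> a j" for w
    using that by (auto simp: eventually_at dist_commute intro!: exI[of _ "dist w (a j)"])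
  have split: "(\<Sum>i=1..k. f i) = f j + (\<Sum>i\<in>?I. f i)" for f :: "nat \<Rightarrow> complex"
    using j by (intro sum.remove) auto
  have shift: "a j + (z - a j) = z" "a j - 1 + (z - a j) = z - 1" "a j - a i + (z - a j) = z - a i" for z i
    by simp_all
  let ?PA = "\<lambda>t. - of_nat (m j) + t * ((- \<alpha>) * (1 / (a j + t)) + (- \<beta>) * (1 / (a j - 1 + t))
       + (\<Sum>i\<in>?I. (- of_nat (m i)) * (1 / (a j - a i + t))))"
  have p: "eventually (\<lambda>z. coeff_p k m \<alpha> \<beta> a z = ?PA (z - a j) / (z - a j)) (at (a j))"
    unfolding eventually_at
  proof (intro exI[of _ 1] conjI ballI impI)
    fix z assume "z \<noteq> a j \<and> dist z (a j) < 1"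
    hence ne: "z - a j \<noteq> 0" by simp
    have "(x0 + (z - a j) * S) / (z - a j) = x0 / (z - a j) + S" for x0 S
      using ne by (simp add: add_divide_distrib)
    thus "coeff_p k m \<alpha> \<beta> a z = ?PA (z - a j) / (z - a j)"
      unfolding shift coeff_p_def split by (simp only:) (simp add: sum_negf)
  qed simp
  let ?QB = "\<lambda>t. c j + t * (res0 k e a c * (1 / (a j + t)) + res1 k e a c * (1 / (a j - 1 + t))
       + (\<Sum>i\<in>?I. c i * (1 / (a j - a i + t))))"
  have "eventually (\<lambda>z. z \<noteq> 0 \<and> z \<noteq> 1 \<and> (\<forall>i\<in>?I. z \<noteq> a i)) (at (a j))"
  proof (intro eventually_conj near eventually_ball_finite ballI)
    show "0 \<noteq> a j" "1 \<noteq> a j" using w by auto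
    show "a i \<noteq> a j" if "i \<in> ?I" for i using w(3)[OF that] by auto
  qed simp
  moreover have "eventually (\<lambda>z. z \<noteq> a j) (at (a j))" by (auto simp: eventually_at intro: exI[of _ 1])
  ultimately have q: "eventually (\<lambda>z. coeff_q k a (accessory_poly k e a c) z = ?QB (z - a j) / (z - a j)) (at (a j))"
  proof eventually_elim
    case (elim z)
    have "coeff_q k a (accessory_poly k e a c) z = res0 k e a c / z + res1 k e a c / (z - 1) + (\<Sum>i=1..k. c i / (z - a i))"
      using elim by (intro coeff_q_partial_fractions) auto
    moreover have "z - a j \<noteq> 0" using elim by simp
    ultimately show ?case unfolding shift split by (simp add: add_divide_distrib)
  qed
  obtain A where A: "?PA has_fps_expansion A" "fps_nth A = coefA k m \<alpha> \<beta> a j"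
  proof
    show "?PA has_fps_expansion (fps_const (- of_nat (m j)) + fps_X * (fps_const (- \<alpha>) * ?G (a j) + fps_const (- \<beta>) * ?G (a j - 1)
        + (\<Sum>i\<in>?I. fps_const (- of_nat (m i)) * ?G (a j - a i))))"
      by (rule simple_poles)
    show "fps_nth \<dots> = coefA k m \<alpha> \<beta> a j"
      by (rule ext) (simp add: coefA_def fps_sum_nth sum_negf split: nat.splits)
  qed
  obtain B where B: "?QB has_fps_expansion B" "fps_nth B = coefB k e a c j"
  proof
    show "?QB has_fps_expansion (fps_const (c j) + fps_X * (fps_const (res0 k e a c) * ?G (a j) + fps_const (res1 k e a c) * ?G (a j - 1)
        + (\<Sum>i\<in>?I. fps_const (c i) * ?G (a j - a i))))"
      by (rule simple_poles)
    show "fps_nth \<dots> = coefB k e a c j"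
      by (rule ext) (simp add: coefB_def fps_sum_nth mult.commute split: nat.splits)
  qed
  have "fps_nth A 0 = - of_nat (m j)" by (simp add: A(2) coefA_def)
  then obtain r0 where "regular_singular_point (coeff_p k m \<alpha> \<beta> a) (coeff_q k a (accessory_poly k e a c)) (a j) (m j) A B r0"
    using regular_singular_pointI[OF A(1) B(1) _ p q] by blast
  from regular_singular_point.apparent_iff[OF this] show ?thesis by (simp only: A(2) B(2))
qed

lemma accessory_poly_form:
  assumes "k \<ge> 1"
  shows "\<exists>R. accessory_poly k e a c = monom e k + R \<and> degree R \<le> k - 1"
proof -
  define M where "M = (\<Prod>i=1..k. [:- a i, 1:])"
  have dM: "degree M = k" unfolding M_def by (subst degree_prod_sum_eq) auto
  have "lead_coeff M = 1" by (simp add: M_def lead_coeff_prod)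
  have 1: "degree (Polynomial.smult e (M - monom 1 k)) \<le> k - 1"
  proof (rule order_trans[OF degree_smult_le], rule degree_le, intro allI impI)
    fix i assume "k - 1 < i"
    hence "i = k \<or> i > k" by auto
    thus "coeff (M - monom 1 k) i = 0"
      using dM \<open>lead_coeff M = 1\<close> by (auto simp: coeff_eq_0)
  qed
  have 2: "degree (\<Sum>i=1..k. Polynomial.smult (c i * a i * (a i - 1)) (\<Prod>l\<in>{1..k}-{i}. [:- a l, 1:])) \<le> k - 1"
  proof (rule degree_sum_le)
    fix i assume i: "i \<in> {1..k}"
    have "degree (\<Prod>l\<in>{1..k}-{i}. [:- a l, 1:]) = k - 1"
      using i by (subst degree_prod_sum_eq) auto
    thus "degree (Polynomial.smult (c i * a i * (a i - 1)) (\<Prod>l\<in>{1..k}-{i}. [:- a l, 1:])) \<le> k - 1"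
      using degree_smult_le order_trans by metis
  qed simp
  have "accessory_poly k e a c = monom e k + (Polynomial.smult e (M - monom 1 k) +
     (\<Sum>i=1..k. Polynomial.smult (c i * a i * (a i - 1)) (\<Prod>l\<in>{1..k}-{i}. [:- a l, 1:])))"
    by (simp add: accessory_poly_def M_def smult_diff_right smult_monom)
  thus ?thesis using degree_add_le[OF 1 2] by blast
qed

lemma poly_accessory_poly_at:
  assumes j: "j \<in> {1..k}"
  shows "poly (accessory_poly k e a c) (a j) = c j * (a j * (a j - 1) * (\<Prod>l\<in>{1..k}-{j}. a j - a l))"
proof -
  have "(\<Sum>i=1..k. c i * a i * (a i - 1) * (\<Prod>l\<in>{1..k}-{i}. a j - a l)) =
        (\<Sum>i\<in>{j}. c i * a i * (a i - 1) * (\<Prod>l\<in>{1..k}-{i}. a j - a l))"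
    using j by (intro sum.mono_neutral_right) (auto intro!: prod_zero)
  moreover have "(\<Prod>i=1..k. a j - a i) = 0" using j by (intro prod_zero) auto
  ultimately show ?thesis by (simp add: poly_accessory_poly mult.assoc)
qed

definition residue_solutions ::
  "nat \<Rightarrow> (nat \<Rightarrow> nat) \<Rightarrow> complex \<Rightarrow> complex \<Rightarrow> complex \<Rightarrow> (nat \<Rightarrow> complex) \<Rightarrow> (nat \<Rightarrow> complex) set" where
  "residue_solutions k m \<alpha> \<beta> e a = {c \<in> {1..k} \<rightarrow>\<^sub>E UNIV. \<forall>j\<in>{1..k}.
      obstruction (m j) (coefA k m \<alpha> \<beta> a j) (coefB k e a c j) = 0}"

text \<open>With the leading coefficient fixed, the \<open>k\<close> free coefficients of
  \<open>P\<close> are determined by the values of \<open>P\<close> at the \<open>k\<close> distinct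
  points, and these are the residues up to the nonzero factors \<open>w j\<close>.\<close>

lemma bij_residue_solutions:
  assumes k: "k \<ge> 1" and adm: "admissible_points k a"
  shows "bij_betw (accessory_poly k (\<gamma> * \<delta>) a)
    (residue_solutions k m \<alpha> \<beta> (\<gamma> * \<delta>) a) (apparent_equations k m \<alpha> \<beta> \<gamma> \<delta> a)"
proof -
  let ?e = "\<gamma> * \<delta>"
  define Z where "Z = residue_solutions k m \<alpha> \<beta> ?e a"
  note Z_def = Z_def[unfolded residue_solutions_def]
  define w where "w = (\<lambda>j. a j * (a j - 1) * (\<Prod>l\<in>{1..k}-{j}. a j - a l))"
  have w: "w j \<noteq> 0" if "j \<in> {1..k}" for j
    using that adm by (auto simp: w_def admissible_points_def dest: inj_onD)
  have at: "poly (accessory_poly k ?e a c) (a j) = c j * w j" if "j \<in> {1..k}" for c j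
    using poly_accessory_poly_at[OF that] by (simp add: w_def)
  have "inj_on (accessory_poly k ?e a) Z"
  proof (rule inj_onI)
    fix c c' assume *: "c \<in> Z" "c' \<in> Z" "accessory_poly k ?e a c = accessory_poly k ?e a c'"
    show "c = c'"
    proof (rule PiE_ext[of _ "{1..k}" "\<lambda>_. UNIV"])
      fix i assume i: "i \<in> {1..k}"
      have "c i * w i = c' i * w i" using at[OF i] *(3) by metis
      thus "c i = c' i" using w[OF i] by simp
    qed (use * in \<open>auto simp: Z_def\<close>)
  qed
  moreover have "accessory_poly k ?e a ` Z \<subseteq> apparent_equations k m \<alpha> \<beta> \<gamma> \<delta> a"
    using accessory_poly_form[OF k] apparent_iff_obstruction[OF adm]
    by (auto simp: Z_def apparent_equations_def)
  moreover have "P \<in> accessory_poly k ?e a ` Z" if P: "P \<in> apparent_equations k m \<alpha> \<beta> \<gamma> \<delta> a" for P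
  proof -
    define c where "c = restrict (\<lambda>j. poly P (a j) / w j) {1..k}"
    obtain R where R: "P = monom ?e k + R" "degree R \<le> k - 1"
      using P unfolding apparent_equations_def by blast
    obtain R' where R': "accessory_poly k ?e a c = monom ?e k + R'" "degree R' \<le> k - 1"
      using accessory_poly_form[OF k] by blast
    have "poly (accessory_poly k ?e a c - P) (a j) = 0" if "j \<in> {1..k}" for j
      using at[OF that, of c] w[OF that] that by (simp add: c_def)
    hence sub: "a ` {1..k} \<subseteq> {x. poly (accessory_poly k ?e a c - P) x = 0}" by auto
    \<comment> \<open>The leading terms cancel, leaving a polynomial of degree at most
      \<open>k - 1\<close> with \<open>k\<close> zeros.\<close>
    have "accessory_poly k ?e a c - P = 0"
    proof (rule ccontr)
      assume ne: "accessory_poly k ?e a c - P \<noteq> 0"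
      have "k = card (a ` {1..k})" using adm by (simp add: admissible_points_def card_image)
      also have "\<dots> \<le> card {x. poly (accessory_poly k ?e a c - P) x = 0}"
        by (intro card_mono sub poly_roots_finite ne)
      also have "\<dots> \<le> degree (accessory_poly k ?e a c - P)" by (rule poly_roots_degree[OF ne])
      also have "accessory_poly k ?e a c - P = R' - R" unfolding R(1) R'(1) by simp
      also have "degree (R' - R) \<le> k - 1" by (rule degree_diff_le[OF R'(2) R(2)])
      finally show False using k by simp
    qed
    hence eq: "P = accessory_poly k ?e a c" by simp
    moreover have "c \<in> Z"
      using P apparent_iff_obstruction[OF adm] unfolding eq apparent_equations_def
      by (auto simp: Z_def c_def)
    ultimately show ?thesis by blast
  qed
  ultimately have "bij_betw (accessory_poly k ?e a) Z (apparent_equations k m \<alpha> \<beta> \<gamma> \<delta> a)"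
    unfolding bij_betw_def by blast
  thus ?thesis unfolding Z_def residue_solutions_def .
qed

section \<open>Generic parameters\<close>


context param_ring begin

lemma R_geom: "R (\<lambda>\<theta>. 1 / u \<theta>) \<Longrightarrow> R (\<lambda>\<theta>. geom_coeff n (u \<theta>))"
  unfolding geom_coeff_def by (intro R_mult R_const R_power)

lemma poly_coefB:
  assumes e: "R e" and a: "\<And>i. i \<in> {1..k} \<Longrightarrow> R (\<lambda>\<theta>. a \<theta> i)" and j: "j \<in> {1..k}"
    and inv: "R (\<lambda>\<theta>. 1 / a \<theta> j)" "R (\<lambda>\<theta>. 1 / (a \<theta> j - 1))"
      "\<And>i. i \<in> {1..k} - {j} \<Longrightarrow> R (\<lambda>\<theta>. 1 / (a \<theta> j - a \<theta> i))"
  shows "poly_fun {1..k} 2 (\<lambda>\<theta> c. coefB k (e \<theta>) (a \<theta>) c j n)"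
proof (cases n)
  have lin: "poly_fun {1..k} 2 (\<lambda>\<theta> c. c i * r \<theta>)" if "i \<in> {1..k}" "R r" for i r
  proof -
    have "poly_fun {1..k} (Suc (Suc 0)) (\<lambda>\<theta> c. c i * r \<theta>)"
      using that by (intro poly_fun_var poly_fun_const) auto
    thus ?thesis by (simp add: numeral_2_eq_2)
  qed
  {
    case 0
    thus ?thesis using lin[OF j R_const[of 1]] by (simp add: coefB_def)
  next
    case (Suc n')
    have "poly_fun {1..k} 2 (\<lambda>\<theta> c. res0 k (e \<theta>) (a \<theta>) c)" "poly_fun {1..k} 2 (\<lambda>\<theta> c. res1 k (e \<theta>) (a \<theta>) c)"
      unfolding res0_def res1_def
      by (intro poly_fun_add poly_fun_sum lin poly_fun_const R_diff R_uminus R_const a e; simp)+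
    hence "poly_fun {1..k} 2 (\<lambda>\<theta> c. geom_coeff n' (a \<theta> j) * res0 k (e \<theta>) (a \<theta>) c
        + geom_coeff n' (a \<theta> j - 1) * res1 k (e \<theta>) (a \<theta>) c
          + (\<Sum>i\<in>{1..k}-{j}. c i * geom_coeff n' (a \<theta> j - a \<theta> i)))"
      by (intro poly_fun_add poly_fun_sum poly_fun_scale lin R_geom inv) auto
    thus ?thesis using Suc by (simp add: coefB_def)
  }
qed

lemma R_coefA:
  assumes "R \<alpha>" "R \<beta>" and j: "j \<in> {1..k}"
    and inv: "R (\<lambda>\<theta>. 1 / a \<theta> j)" "R (\<lambda>\<theta>. 1 / (a \<theta> j - 1))"
      "\<And>i. i \<in> {1..k} - {j} \<Longrightarrow> R (\<lambda>\<theta>. 1 / (a \<theta> j - a \<theta> i))"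
  shows "R (\<lambda>\<theta>. coefA k m (\<alpha> \<theta>) (\<beta> \<theta>) (a \<theta>) j n)"
proof (cases n)
  case 0
  thus ?thesis by (simp add: coefA_def R_const)
next
  case (Suc n')
  have "R (\<lambda>\<theta>. - (\<alpha> \<theta> * geom_coeff n' (a \<theta> j) + \<beta> \<theta> * geom_coeff n' (a \<theta> j - 1)
          + (\<Sum>i\<in>{1..k}-{j}. of_nat (m i) * geom_coeff n' (a \<theta> j - a \<theta> i))))"
    by (intro R_uminus R_add R_mult R_sum R_const R_geom inv assms)
  thus ?thesis using Suc by (simp add: coefA_def)
qed

lemma recursion_family_coef:
  assumes "R \<alpha>" "R \<beta>" "R e" "\<And>i. i \<in> {1..k} \<Longrightarrow> R (\<lambda>\<theta>. a \<theta> i)"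
    and "\<And>j. j \<in> {1..k} \<Longrightarrow> R (\<lambda>\<theta>. 1 / a \<theta> j)" "\<And>j. j \<in> {1..k} \<Longrightarrow> R (\<lambda>\<theta>. 1 / (a \<theta> j - 1))"
    and "\<And>j i. j \<in> {1..k} \<Longrightarrow> i \<in> {1..k} - {j} \<Longrightarrow> R (\<lambda>\<theta>. 1 / (a \<theta> j - a \<theta> i))"
  shows "recursion_family R {1..k} (\<lambda>\<theta>. coefA k m (\<alpha> \<theta>) (\<beta> \<theta>) (a \<theta>)) (\<lambda>\<theta>. coefB k (e \<theta>) (a \<theta>))"
proof unfold_locales
  fix j n assume j: "j \<in> {1..k}"
  show "R (\<lambda>\<theta>. coefA k m (\<alpha> \<theta>) (\<beta> \<theta>) (a \<theta>) j n)" by (intro R_coefA assms j)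
  show "poly_fun {1..k} 2 (\<lambda>\<theta> c. coefB k (e \<theta>) (a \<theta>) c j n)" by (intro poly_coefB assms j)
qed (auto simp: coefB_def)

end

lemma card_residue_solutions:
  "finite (residue_solutions k m \<alpha> \<beta> e a)" "residue_solutions k m \<alpha> \<beta> e a \<noteq> {}"
  "card (residue_solutions k m \<alpha> \<beta> e a) \<le> (\<Prod>j=1..k. m j + 1)"
proof -
  \<comment> \<open>A single equation is a family over a one-point parameter space on which every
    function is allowed.\<close>
  interpret param_ring "\<lambda>_ :: unit \<Rightarrow> complex. True" by unfold_locales auto
  interpret F: recursion_family "\<lambda>_ :: unit \<Rightarrow> complex. True" "{1..k}" m "\<lambda>_. coefA k m \<alpha> \<beta> a" "\<lambda>_. coefB k e a"
    by (rule recursion_family_coef) auto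
  have "residue_solutions k m \<alpha> \<beta> e a = F.obstruction_zeros ()"
    unfolding residue_solutions_def F.obstruction_zeros_def ..
  thus "finite (residue_solutions k m \<alpha> \<beta> e a)" "residue_solutions k m \<alpha> \<beta> e a \<noteq> {}"
    "card (residue_solutions k m \<alpha> \<beta> e a) \<le> (\<Prod>j=1..k. m j + 1)"
    using F.card_obstruction_zeros by simp_all
qed

text \<open>Weighted homogeneity under a rescaling of the local coordinate by
  \<open>\<epsilon>\<close>. The recursion reads \<open>A\<close> only at positive indices, which is
  why index 0 is exempt from the scaling.\<close>

lemma obstruction_scale:
  assumes A: "\<And>n. n > 0 \<Longrightarrow> A' n = \<epsilon> ^ n * A n" and B: "\<And>n. B' n = \<epsilon> ^ Suc n * B n"
  shows "obstruction m A' B' = \<epsilon> ^ Suc m * obstruction m A B"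
proof -
  have step: "(of_nat l * A' (n - l) + B' (n - Suc l)) * (\<epsilon> ^ l * y) = \<epsilon> ^ n * ((of_nat l * A (n - l) + B (n - Suc l)) * y)"
    if "l < n" for l n y
  proof -
    have "Suc (n - Suc l) = n - l" using that by simp
    hence eq: "(of_nat l * A' (n - l) + B' (n - Suc l)) = \<epsilon> ^ (n - l) * (of_nat l * A (n - l) + B (n - Suc l))"
      using that unfolding B by (simp add: A algebra_simps)
    have "\<epsilon> ^ n = \<epsilon> ^ (n - l) * \<epsilon> ^ l" using that by (simp flip: power_add)
    thus ?thesis unfolding eq by (simp only: mult_ac)
  qed
  have frob: "frobenius m A' B' 0 n = \<epsilon> ^ n * frobenius m A B 0 n" for n
  proof (induction n rule: less_induct)
    case (less n)
    have "(\<Sum>l<n. (of_nat l * A' (n - l) + B' (n - Suc l)) * frobenius m A' B' 0 l)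
        = (\<Sum>l<n. (of_nat l * A' (n - l) + B' (n - Suc l)) * (\<epsilon> ^ l * frobenius m A B 0 l))"
      by (intro sum.cong refl arg_cong2[where f = "(*)"] less.IH) auto
    also have "\<dots> = \<epsilon> ^ n * (\<Sum>l<n. (of_nat l * A (n - l) + B (n - Suc l)) * frobenius m A B 0 l)"
      unfolding sum_distrib_left by (intro sum.cong refl step) auto
    finally have S: "(\<Sum>l<n. (of_nat l * A' (n - l) + B' (n - Suc l)) * frobenius m A' B' 0 l) = \<dots>" .
    show ?case
      unfolding frobenius.simps[of m A' B' 0 n] frobenius.simps[of m A B 0 n] S by simp
  qed
  show ?thesis unfolding obstruction_def frob sum_distrib_left
    using step[of _ "Suc m"] by (intro sum.cong refl) simp
qed

text \<open>With \<open>\<alpha> = 1 / \<epsilon>\<close>, \<open>\<beta> = \<gamma> * \<delta> = 0\<close> and residues \<open>c = C / \<epsilon>\<close>, the rescaled system is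
  polynomial in \<open>\<epsilon>\<close>; for \<open>\<epsilon> = 0\<close> it decouples into the equations
  \<open>(\<Prod>l\<le>m j. C j - l / a j) = 0\<close>, which have the maximal number of solutions.\<close>

lemma exists_maximal_count:
  assumes adm: "admissible_points k a"
  shows "\<exists>\<alpha>. card (residue_solutions k m \<alpha> 0 0 a) = (\<Prod>j=1..k. m j + 1)"
proof -
  define R where "R = (\<lambda>f :: complex \<Rightarrow> complex. \<exists>p. \<forall>x. f x = poly p x)"
  have RI: "R f" if "\<And>x. f x = poly p x" for f p using that unfolding R_def by blast
  interpret param_ring R
  proof
    show "R (\<lambda>_. c)" for c by (rule RI[of _ "[:c:]"]) simp
    fix f g assume "R f" "R g"
    then obtain p q where "\<And>x. f x = poly p x" "\<And>x. g x = poly q x" unfolding R_def by blast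
    thus "R (\<lambda>\<theta>. f \<theta> + g \<theta>)" "R (\<lambda>\<theta>. f \<theta> * g \<theta>)"
      by (auto intro: RI[of _ "p + q"] RI[of _ "p * q"])
  qed
  have R_id: "R (\<lambda>\<epsilon>. \<epsilon>)" by (rule RI[of _ "[:0, 1:]"]) simp
  \<comment> \<open>At positive \<open>n\<close> and nonzero \<open>\<epsilon>\<close> this is
    \<open>\<epsilon> ^ n\<close> times \<open>coefA\<close> for \<alpha> = 1 / \<epsilon> and
    \<beta> = 0, with the pole in \<open>\<epsilon>\<close> cancelled so that it also makes sense at
    0.\<close>
  define A where "A = (\<lambda>\<epsilon> j n. case n of 0 \<Rightarrow> 0
     | Suc n \<Rightarrow> - (\<epsilon> ^ n * (geom_coeff n (a j) + \<epsilon> * (\<Sum>i\<in>{1..k}-{j}. of_nat (m i) * geom_coeff n (a j - a i)))))"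
  define B where "B = (\<lambda>\<epsilon> c j n. \<epsilon> ^ n * coefB k 0 a c j n)"
  interpret F: recursion_family R "{1..k}" m A B
  proof unfold_locales
    fix j n assume j: "j \<in> {1..k}"
    show "R (\<lambda>\<theta>. A \<theta> j n)"
      by (cases n) (auto simp: A_def intro!: R_const R_uminus R_mult R_power R_id R_add R_sum)
    show "poly_fun {1..k} 2 (\<lambda>\<theta> c. B \<theta> c j n)"
      unfolding B_def by (intro poly_fun_scale R_power R_id poly_coefB j R_const)
  qed (auto simp: B_def coefB_def)
  have a0: "a j \<noteq> 0" if "j \<in> {1..k}" for j using adm that by (auto simp: admissible_points_def)
  define Z where "Z = (\<Pi>\<^sub>E j\<in>{1..k}. (\<lambda>l. of_nat l / a j) ` {..m j})"
  have "card ((\<lambda>l. of_nat l / a j) ` {..m j}) = m j + 1" if "j \<in> {1..k}" for j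
    using a0[OF that] by (subst card_image) (auto simp: inj_on_def)
  hence "card Z = (\<Prod>j=1..k. m j + 1)" unfolding Z_def by (subst card_PiE) auto
  moreover have "Z \<subseteq> F.obstruction_zeros 0"
  proof
    fix c assume c: "c \<in> Z"
    have "obstruction (m j) (A 0 j) (B 0 c j) = 0" if j: "j \<in> {1..k}" for j
    proof -
      obtain l where l: "l \<le> m j" "c j = of_nat l / a j" using c j unfolding Z_def by fastforce
      \<comment> \<open>At \<open>\<epsilon> = 0\<close> only steps of length one survive, so the
        recursion becomes a two-term one.\<close>
      have step: "(\<Sum>i<Suc n. (of_nat i * A 0 j (Suc n - i) + B 0 c j (n - i)) * y i) =
          (c j - of_nat n / a j) * y n" for n y
      proof -
        have "(\<Sum>i<n. (of_nat i * A 0 j (Suc n - i) + B 0 c j (n - i)) * y i) = 0"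
        proof (rule sum.neutral, rule ballI)
          fix i assume "i \<in> {..<n}"
          then obtain d where "n - i = Suc d" "Suc n - i = Suc (Suc d)" 
            by (metis Suc_diff_Suc Suc_diff_le lessThan_iff less_imp_le)
          thus "(of_nat i * A 0 j (Suc n - i) + B 0 c j (n - i)) * y i = 0" by (simp add: A_def B_def)
        qed
        thus ?thesis by (simp add: A_def B_def coefB_def geom_coeff_def)
      qed
      let ?y = "frobenius (m j) (A 0 j) (B 0 c j) 0"
      have y: "?y (Suc n) = - ((c j - of_nat n / a j) * ?y n) / (of_nat (Suc n) * (of_nat (Suc n) - 1 - of_nat (m j)))" for n
        using step[of n ?y] by (subst frobenius.simps) simp
      \<comment> \<open>The choice \<open>c j = l / a j\<close> kills the factor of step
        \<open>l\<close>, so the series stops there. If \<open>l = m j\<close>, this factor is the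
        last one, in the obstruction itself.\<close>
      have "?y n = 0" if "l < n" for n
        using that
      proof (induction n)
        case (Suc n)
        show ?case using Suc l(2) unfolding y by (cases "n = l") auto
      qed simp
      hence "(c j - of_nat (m j) / a j) * ?y (m j) = 0" using l by (cases "l = m j") auto
      thus ?thesis unfolding obstruction_def step .
    qed
    thus "c \<in> F.obstruction_zeros 0"
      unfolding F.obstruction_zeros_def using c by (auto simp: Z_def PiE_iff)
  qed
  ultimately have "(\<Prod>j=1..k. m j + 1) \<le> card (F.obstruction_zeros 0)"
    using card_mono[OF F.card_obstruction_zeros(1)] by metis
  hence "card (F.obstruction_zeros 0) = (\<Prod>j=1..k. m j + 1)"
    using F.card_obstruction_zeros(3)[of 0] by simp
  then obtain D where D: "R D" "D 0 \<noteq> 0" "\<And>\<epsilon>. D \<epsilon> \<noteq> 0 \<Longrightarrow> card (F.obstruction_zeros \<epsilon>) = (\<Prod>j=1..k. m j + 1)"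
    using F.maximal_count_open[of 0] by blast
  obtain p where p: "\<And>x. D x = poly p x" using D(1) unfolding R_def by blast
  \<comment> \<open>The extra factor \<open>\<epsilon>\<close> guarantees that the chosen point is
    not the limit point 0 itself.\<close>
  have "[:0, 1:] * p \<noteq> 0" using D(2) p by auto
  then obtain \<epsilon> where "poly ([:0, 1:] * p) \<epsilon> \<noteq> 0" using poly_all_0_iff_0 by blast
  hence \<epsilon>: "\<epsilon> \<noteq> 0" "D \<epsilon> \<noteq> 0" by (auto simp: p)
  have "inj_on (\<lambda>c. \<lambda>j\<in>{1..k}. c j / \<epsilon>) (F.obstruction_zeros \<epsilon>)"
  proof (rule inj_onI)
    fix c c' assume *: "c \<in> F.obstruction_zeros \<epsilon>" "c' \<in> F.obstruction_zeros \<epsilon>"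
      "(\<lambda>j\<in>{1..k}. c j / \<epsilon>) = (\<lambda>j\<in>{1..k}. c' j / \<epsilon>)"
    show "c = c'"
    proof (rule PiE_ext[of _ "{1..k}" "\<lambda>_. UNIV"])
      fix i assume "i \<in> {1..k}"
      thus "c i = c' i" using fun_cong[OF *(3), of i] \<epsilon>(1) by simp
    qed (use *(1,2) in \<open>unfold F.obstruction_zeros_def, auto\<close>)
  qed
  moreover have "(\<lambda>c. \<lambda>j\<in>{1..k}. c j / \<epsilon>) ` F.obstruction_zeros \<epsilon> \<subseteq> residue_solutions k m (1 / \<epsilon>) 0 0 a"
  proof (rule image_subsetI)
    fix c assume c: "c \<in> F.obstruction_zeros \<epsilon>"
    define c' where "c' = (\<lambda>j\<in>{1..k}. c j / \<epsilon>)"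
    have cc: "c i = \<epsilon> * c' i" if "i \<in> {1..k}" for i using that \<epsilon> by (simp add: c'_def)
    have "obstruction (m j) (coefA k m (1 / \<epsilon>) 0 a j) (coefB k 0 a c' j) = 0" if j: "j \<in> {1..k}" for j
    proof -
      have "obstruction (m j) (A \<epsilon> j) (B \<epsilon> c j) =
          \<epsilon> ^ Suc (m j) * obstruction (m j) (coefA k m (1 / \<epsilon>) 0 a j) (coefB k 0 a c' j)"
      proof (rule obstruction_scale)
        fix n :: nat assume "n > 0"
        thus "A \<epsilon> j n = \<epsilon> ^ n * coefA k m (1 / \<epsilon>) 0 a j n"
          using \<epsilon> by (cases n) (simp_all add: A_def coefA_def algebra_simps)
      next
        fix n
        \<comment> \<open>The constant terms are \<open>- e\<close> and \<open>e\<close>; for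
          \<open>e = 0\<close> the residues at 0 and 1 are linear in \<open>c\<close>, so a scalar
          factor can be pulled out.\<close>
        have "res0 k 0 a c = \<epsilon> * res0 k 0 a c'" "res1 k 0 a c = \<epsilon> * res1 k 0 a c'"
          by (simp_all add: res0_def res1_def sum_distrib_left cc mult.assoc)
        moreover have "(\<Sum>i\<in>{1..k}-{j}. c i * geom_coeff n' (a j - a i)) = \<epsilon> * (\<Sum>i\<in>{1..k}-{j}. c' i * geom_coeff n' (a j - a i))" for n'
          by (simp add: sum_distrib_left cc mult.assoc)
        ultimately have "coefB k 0 a c j n = \<epsilon> * coefB k 0 a c' j n"
          using cc[OF j] by (simp add: coefB_def distrib_left mult.left_commute split: nat.splits)
        thus "B \<epsilon> c j n = \<epsilon> ^ Suc n * coefB k 0 a c' j n" by (simp add: B_def)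
      qed
      moreover have "obstruction (m j) (A \<epsilon> j) (B \<epsilon> c j) = 0" using c j unfolding F.obstruction_zeros_def by simp
      ultimately show ?thesis using \<epsilon> by simp
    qed
    thus "(\<lambda>j\<in>{1..k}. c j / \<epsilon>) \<in> residue_solutions k m (1 / \<epsilon>) 0 0 a"
      by (simp add: residue_solutions_def c'_def)
  qed
  ultimately have "card (F.obstruction_zeros \<epsilon>) \<le> card (residue_solutions k m (1 / \<epsilon>) 0 0 a)"
    by (intro card_inj_on_le card_residue_solutions(1))
  hence "card (residue_solutions k m (1 / \<epsilon>) 0 0 a) = (\<Prod>j=1..k. m j + 1)"
    using D(3)[OF \<epsilon>(2)] card_residue_solutions(3)[of k m "1 / \<epsilon>" 0 0 a] by simp
  thus ?thesis by blast
qed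

section \<open>Functions regular off the degeneracy locus of the parameters\<close>

interpretation polynomial_functions: param_ring "complex_polynomial_function n"
  by unfold_locales (auto intro: complex_polynomial_function.intros)

text \<open>The localization at \<open>h\<close>: a power of \<open>h\<close> clears the
  denominator. The identity is required only where \<open>h x \<noteq> 0\<close>, so the values of
  divisions by zero on the degeneracy locus are harmless.\<close>

definition regular_function :: "nat \<Rightarrow> ((nat \<Rightarrow> complex) \<Rightarrow> complex) \<Rightarrow> ((nat \<Rightarrow> complex) \<Rightarrow> complex) \<Rightarrow> bool" where
  "regular_function n h f \<longleftrightarrow> (\<exists>N g. complex_polynomial_function n g \<and> (\<forall>x. h x \<noteq> 0 \<longrightarrow> f x * h x ^ N = g x))"

lemma regular_functionI:
  "complex_polynomial_function n g \<Longrightarrow> (\<And>x. h x \<noteq> 0 \<Longrightarrow> f x * h x ^ N = g x) \<Longrightarrow> regular_function n h f"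
  unfolding regular_function_def by blast

lemma regular_function_poly: "complex_polynomial_function n f \<Longrightarrow> regular_function n h f"
  by (rule regular_functionI[where N = 0]) auto

lemma param_ring_regular:
  assumes h: "complex_polynomial_function n h"
  shows "param_ring (regular_function n h)"
proof
  show "regular_function n h (\<lambda>_. c)" for c
    by (intro regular_function_poly complex_polynomial_function.const)
  fix f1 f2 assume "regular_function n h f1" "regular_function n h f2"
  then obtain N1 g1 N2 g2 where 1: "complex_polynomial_function n g1" "\<And>x. h x \<noteq> 0 \<Longrightarrow> f1 x * h x ^ N1 = g1 x"
    and 2: "complex_polynomial_function n g2" "\<And>x. h x \<noteq> 0 \<Longrightarrow> f2 x * h x ^ N2 = g2 x"
    unfolding regular_function_def by blast
  show "regular_function n h (\<lambda>x. f1 x + f2 x)"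
  proof (rule regular_functionI)
    show "complex_polynomial_function n (\<lambda>x. g1 x * h x ^ N2 + g2 x * h x ^ N1)"
      by (intro polynomial_functions.R_add polynomial_functions.R_mult polynomial_functions.R_power 1 2 h)
    show "(f1 x + f2 x) * h x ^ (N1 + N2) = g1 x * h x ^ N2 + g2 x * h x ^ N1" if "h x \<noteq> 0" for x
      by (simp add: power_add algebra_simps flip: 1(2)[OF that] 2(2)[OF that])
  qed
  show "regular_function n h (\<lambda>x. f1 x * f2 x)"
  proof (rule regular_functionI)
    show "complex_polynomial_function n (\<lambda>x. g1 x * g2 x)"
      by (intro polynomial_functions.R_mult 1 2)
    show "(f1 x * f2 x) * h x ^ (N1 + N2) = g1 x * g2 x" if "h x \<noteq> 0" for x
      by (simp add: power_add algebra_simps flip: 1(2)[OF that] 2(2)[OF that])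
  qed
qed

lemma regular_function_inverse:
  assumes "complex_polynomial_function n v" "\<And>x. h x = u x * v x"
  shows "regular_function n h (\<lambda>x. 1 / u x)"
  by (rule regular_functionI[OF assms(1), where N = 1]) (simp add: assms(2))

definition degeneracy :: "nat \<Rightarrow> (nat \<Rightarrow> complex) \<Rightarrow> complex" where
  "degeneracy k x = (\<Prod>i=1..k. x (3 + i) * (x (3 + i) - 1) * (\<Prod>l\<in>{1..k}-{i}. x (3 + i) - x (3 + l)))"

lemma admissible_points_iff: "admissible_points k (\<lambda>i. x (3 + i)) \<longleftrightarrow> degeneracy k x \<noteq> 0"
  unfolding admissible_points_def degeneracy_def by (auto simp: inj_on_def)

lemma polynomial_point: "i \<in> {1..k} \<Longrightarrow> complex_polynomial_function (4 + k) (\<lambda>x. x (3 + i))"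
  by (rule complex_polynomial_function.coord) auto

lemmas polynomial_intros = polynomial_functions.R_mult polynomial_functions.R_diff
  polynomial_functions.R_prod polynomial_functions.R_const polynomial_point

lemma polynomial_degeneracy: "complex_polynomial_function (4 + k) (degeneracy k)"
  unfolding degeneracy_def[abs_def] by (intro polynomial_intros) auto

lemma regular_inverses:
  assumes j: "j \<in> {1..k}"
  shows "regular_function (4 + k) (degeneracy k) (\<lambda>x. 1 / x (3 + j))"
    "regular_function (4 + k) (degeneracy k) (\<lambda>x. 1 / (x (3 + j) - 1))"
    "i \<in> {1..k} - {j} \<Longrightarrow> regular_function (4 + k) (degeneracy k) (\<lambda>x. 1 / (x (3 + j) - x (3 + i)))"
proof -
  let ?f = "\<lambda>x i. x (3 + i) * (x (3 + i) - 1) * (\<Prod>l\<in>{1..k}-{i}. x (3 + i) - x (3 + l) :: complex)"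
  have deg: "degeneracy k x = x (3 + j) * (x (3 + j) - 1) * (\<Prod>l\<in>{1..k}-{j}. x (3 + j) - x (3 + l)) * (\<Prod>i\<in>{1..k}-{j}. ?f x i)" for x
    unfolding degeneracy_def using j by (intro prod.remove) auto
  show "regular_function (4 + k) (degeneracy k) (\<lambda>x. 1 / x (3 + j))"
    by (rule regular_function_inverse[where v = "\<lambda>x. (x (3 + j) - 1) * (\<Prod>l\<in>{1..k}-{j}. x (3 + j) - x (3 + l)) * (\<Prod>i\<in>{1..k}-{j}. ?f x i)"])
      (use j in \<open>auto intro!: polynomial_intros simp: deg\<close>)
  show "regular_function (4 + k) (degeneracy k) (\<lambda>x. 1 / (x (3 + j) - 1))"
    by (rule regular_function_inverse[where v = "\<lambda>x. x (3 + j) * (\<Prod>l\<in>{1..k}-{j}. x (3 + j) - x (3 + l)) * (\<Prod>i\<in>{1..k}-{j}. ?f x i)"])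
      (use j in \<open>auto intro!: polynomial_intros simp: deg\<close>)
  assume i: "i \<in> {1..k} - {j}"
  have "(\<Prod>l\<in>{1..k}-{j}. x (3 + j) - x (3 + l)) = (x (3 + j) - x (3 + i)) * (\<Prod>l\<in>{1..k}-{j}-{i}. x (3 + j) - x (3 + l))" for x :: "nat \<Rightarrow> complex"
    using i by (intro prod.remove) auto
  thus "regular_function (4 + k) (degeneracy k) (\<lambda>x. 1 / (x (3 + j) - x (3 + i)))"
    by (intro regular_function_inverse[where v = "\<lambda>x. x (3 + j) * (x (3 + j) - 1) * (\<Prod>l\<in>{1..k}-{j}-{i}. x (3 + j) - x (3 + l)) * (\<Prod>i\<in>{1..k}-{j}. ?f x i)"])
      (use j in \<open>auto intro!: polynomial_intros simp: deg\<close>)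
qed

lemma admissible_points_cong:
  assumes "\<And>i. i \<in> {1..k} \<Longrightarrow> a i = b i"
  shows "admissible_points k a \<longleftrightarrow> admissible_points k b"
  unfolding admissible_points_def using assms inj_on_cong[of "{1..k}" a b] by simp

text \<open>A parameter tuple encodes the points only at indices 1 to k; at index 0 the function
  \<open>\<lambda>i. x (3 + i)\<close> returns \<delta>. The witness and \<open>a0\<close> are
  therefore compared on \<open>{1..k}\<close> only.\<close>

lemma residue_solutions_cong:
  assumes "\<And>i. i \<in> {1..k} \<Longrightarrow> a i = b i"
  shows "residue_solutions k m \<alpha> \<beta> e a = residue_solutions k m \<alpha> \<beta> e b"
proof -
  have "res0 k e a c = res0 k e b c" "res1 k e a c = res1 k e b c" for c
    unfolding res0_def res1_def using assms by (auto intro!: sum.cong)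
  hence "coefA k m \<alpha> \<beta> a j = coefA k m \<alpha> \<beta> b j" "coefB k e a c j = coefB k e b c j" if "j \<in> {1..k}" for j c
    using assms that unfolding coefA_def coefB_def fun_eq_iff
    by (auto intro!: sum.cong split: nat.splits)
  thus ?thesis unfolding residue_solutions_def by (intro Collect_cong conj_cong refl ball_cong) auto
qed

theorem theorem2p4:
  fixes k d :: nat and m :: "nat \<Rightarrow> nat"
  assumes "k \<ge> 1"
    and "\<And>j. j \<in> {1..k} \<Longrightarrow> m j > 0"
    and "d = (\<Sum>j=1..k. m j)"
  shows "(\<forall>\<alpha> \<beta> \<gamma> \<delta> :: complex. \<forall>a :: nat \<Rightarrow> complex.
            \<gamma> + \<delta> = \<alpha> + \<beta> + 1 + of_nat d \<and> admissible_points k a \<longrightarrow>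
              finite (apparent_equations k m \<alpha> \<beta> \<gamma> \<delta> a) \<and>
              1 \<le> card (apparent_equations k m \<alpha> \<beta> \<gamma> \<delta> a) \<and>
              card (apparent_equations k m \<alpha> \<beta> \<gamma> \<delta> a) \<le> (\<Prod>j=1..k. (m j + 1))) \<and>
         generic_in (4 + k) (parameter_space k d)
           {x. admissible_points k (\<lambda>i. x (3 + i)) \<and>
               card (apparent_equations k m (x 0) (x 1) (x 2) (x 3) (\<lambda>i. x (3 + i)))
                 = (\<Prod>j=1..k. (m j + 1))}"
proof (intro conjI allI impI)
  fix \<alpha> \<beta> \<gamma> \<delta> :: complex and a :: "nat \<Rightarrow> complex"
  assume "\<gamma> + \<delta> = \<alpha> + \<beta> + 1 + of_nat d \<and> admissible_points k a"
  hence bij: "bij_betw (accessory_poly k (\<gamma> * \<delta>) a)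
    (residue_solutions k m \<alpha> \<beta> (\<gamma> * \<delta>) a) (apparent_equations k m \<alpha> \<beta> \<gamma> \<delta> a)"
    using bij_residue_solutions assms(1) by blast
  note card = card_residue_solutions[of k m \<alpha> \<beta> "\<gamma> * \<delta>" a]
  show "finite (apparent_equations k m \<alpha> \<beta> \<gamma> \<delta> a)" using bij_betw_finite[OF bij] card by simp
  show "1 \<le> card (apparent_equations k m \<alpha> \<beta> \<gamma> \<delta> a)"
    using bij_betw_same_card[OF bij] card by (metis One_nat_def Suc_leI card_gt_0_iff)
  show "card (apparent_equations k m \<alpha> \<beta> \<gamma> \<delta> a) \<le> (\<Prod>j=1..k. (m j + 1))"
    using bij_betw_same_card[OF bij] card by simp
next
  let ?h = "degeneracy k"
  let ?N = "\<Prod>j=1..k. m j + 1"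
  let ?R = "regular_function (4 + k) ?h"
  let ?Z = "\<lambda>x. residue_solutions k m (x 0) (x 1) (x 2 * x 3) (\<lambda>i. x (3 + i))"
  interpret param_ring ?R by (rule param_ring_regular[OF polynomial_degeneracy])
  have coord: "?R (\<lambda>x. x i)" if "i < 4 + k" for i
    by (intro regular_function_poly complex_polynomial_function.coord that)
  interpret F: recursion_family ?R "{1..k}" m "\<lambda>x. coefA k m (x 0) (x 1) (\<lambda>i. x (3 + i))"
      "\<lambda>x. coefB k (x 2 * x 3) (\<lambda>i. x (3 + i))"
    by (rule recursion_family_coef) (auto intro!: coord R_mult regular_inverses)
  have Z: "?Z x = F.obstruction_zeros x" for x
    unfolding residue_solutions_def F.obstruction_zeros_def ..
  \<comment> \<open>The points 2, ..., k + 1 are distinct and avoid 0 and 1.\<close>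
  define a0 :: "nat \<Rightarrow> complex" where "a0 = (\<lambda>i. of_nat (Suc i))"
  have adm0: "admissible_points k a0" by (auto simp: admissible_points_def a0_def inj_on_def simp del: of_nat_Suc)
  obtain \<alpha> where \<alpha>: "card (residue_solutions k m \<alpha> 0 0 a0) = ?N" using exists_maximal_count[OF adm0] by blast
  \<comment> \<open>Taking \<beta> = \<gamma> = 0 gives \<gamma> * \<delta> = 0, and \<delta> is
    then set to satisfy the linear relation while \<alpha> keeps the value found above.\<close>
  define x0 where "x0 = (\<lambda>n\<in>{..<4 + k}. if n = 0 then \<alpha> else if n \<le> 2 then 0
     else if n = 3 then \<alpha> + 1 + of_nat d else a0 (n - 3))"
  have x0: "x0 0 = \<alpha>" "x0 1 = 0" "x0 2 = 0" "x0 3 = \<alpha> + 1 + of_nat d" by (simp_all add: x0_def)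
  have x0a: "x0 (3 + i) = a0 i" if "i \<in> {1..k}" for i using that by (simp add: x0_def)
  have x0V: "x0 \<in> parameter_space k d"
  proof -
    have "x0 \<in> affine_space (4 + k)" unfolding affine_space_def x0_def by simp
    thus ?thesis unfolding parameter_space_def using x0 by simp
  qed
  have "admissible_points k (\<lambda>i. x0 (3 + i))"
    using admissible_points_cong[of k "\<lambda>i. x0 (3 + i)" a0, OF x0a] adm0 by blast
  hence h0: "?h x0 \<noteq> 0" using admissible_points_iff by blast
  have "?Z x0 = residue_solutions k m \<alpha> 0 0 a0"
    unfolding x0 using residue_solutions_cong[of k "\<lambda>i. x0 (3 + i)" a0] x0a by simp
  then obtain D where D: "?R D" "D x0 \<noteq> 0" "\<And>x. D x \<noteq> 0 \<Longrightarrow> card (?Z x) = ?N"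
    using F.maximal_count_open[of x0] \<alpha> unfolding Z by auto
  \<comment> \<open>The discriminant is regular off the degeneracy locus; \<open>g\<close> is its
    numerator, a polynomial on the whole space.\<close>
  obtain N g where g: "complex_polynomial_function (4 + k) g" "\<And>x. ?h x \<noteq> 0 \<Longrightarrow> D x * ?h x ^ N = g x"
    using D(1) unfolding regular_function_def by blast
  define lin :: "(nat \<Rightarrow> complex) \<Rightarrow> complex" where "lin = (\<lambda>x. x 2 + x 3 - (x 0 + x 1 + 1 + of_nat d))"
  \<comment> \<open>The exceptional set within the hyperplane of parameters: the factor
    \<open>?h\<close> covers inadmissible points, the factor \<open>g\<close> the vanishing of the
    discriminant. It is proper because it misses \<open>x0\<close>.\<close>
  define W where "W = {x \<in> affine_space (4 + k). \<forall>f\<in>{lin, \<lambda>x. ?h x * g x}. f x = 0}"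
  have "complex_polynomial_function (4 + k) lin" unfolding lin_def
    by (intro polynomial_functions.R_diff polynomial_functions.R_add polynomial_functions.R_const
        complex_polynomial_function.coord) auto
  moreover have "complex_polynomial_function (4 + k) (\<lambda>x. ?h x * g x)"
    by (intro polynomial_functions.R_mult polynomial_degeneracy g)
  ultimately have "algebraic_set (4 + k) W"
    unfolding algebraic_set_def W_def by (intro exI[of _ "{lin, \<lambda>x. ?h x * g x}"]) auto
  moreover have "W \<subseteq> parameter_space k d"
    by (auto simp: W_def parameter_space_def lin_def)
  moreover have "x0 \<notin> W"
    using h0 D(2) g(2)[OF h0] by (auto simp: W_def)
  moreover have "x \<in> W" if x: "x \<in> parameter_space k d"
    "\<not> (admissible_points k (\<lambda>i. x (3 + i)) \<and>
        card (apparent_equations k m (x 0) (x 1) (x 2) (x 3) (\<lambda>i. x (3 + i))) = ?N)" for x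
  proof (rule ccontr)
    assume "x \<notin> W"
    hence hg: "?h x \<noteq> 0" "g x \<noteq> 0" using x(1) by (auto simp: W_def parameter_space_def lin_def)
    hence adm: "admissible_points k (\<lambda>i. x (3 + i))" using admissible_points_iff by blast
    have "D x \<noteq> 0" using g(2)[OF hg(1)] hg(2) by auto
    hence "card (apparent_equations k m (x 0) (x 1) (x 2) (x 3) (\<lambda>i. x (3 + i))) = ?N"
      using D(3) bij_betw_same_card[OF bij_residue_solutions[OF assms(1) adm]] by metis
    thus False using x(2) adm by blast
  qed
  ultimately show "generic_in (4 + k) (parameter_space k d)
           {x. admissible_points k (\<lambda>i. x (3 + i)) \<and>
               card (apparent_equations k m (x 0) (x 1) (x 2) (x 3) (\<lambda>i. x (3 + i)))
                 = (\<Prod>j=1..k. (m j + 1))}"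
    unfolding generic_in_def using x0V by (intro exI[of _ W]) auto
qed

end
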